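(* Let $q$ and $\lambda$ be generic and $\mu,\mu'\in(\mathbb C^* )^r$. The modified $q$-Whittaker function $$W(\phi):=q^{\sum_{i=1}^r\phi_i}\,W_\lambda^{\mu,\mu'}(\phi;q^{-1})=\sum_{\beta\in Q_+}\Big(\prod_{i=1}^r(\mu_i\mu_i')^{\beta_i}\Big)q^{(\lambda+\rho-\beta|\phi)}\,Z_\beta$$ satisfies the $q$-difference Toda equation $H_q\,W(\phi)=E_{q,\lambda}\,W(\phi)$, where $$H_q=\sum_{i=0}^rT_i^2+(q-q^{-1})^2\sum_{i=1}^r\mu_i\mu_i'\,q^{-(\phi|\alpha_i)}\,T_{i-1}T_i,\qquad E_{q,\lambda}=\sum_{i=0}^rq^{2(\lambda+\rho|\omega_i-\omega_{i+1})} .$$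
   Context: Roots and weights. $C$ is the Cartan matrix of type $A_r$, $\alpha_1,\dots,\alpha_r$ the simple roots with $(\alpha_i|\alpha_j)=C_{i,j}$, $\omega_i$ the fundamental weights, $(\omega_i|\alpha_j)=\delta_{i,j}$, $\omega_0=\omega_{r+1}=0$, $\rho=\sum_i\omega_i$, $Q_+=\bigoplus_i\mathbb Z_{\ge0}\alpha_i$, $\lambda_i=(\lambda|\alpha_i)$, $\phi=\sum_{i=1}^r\phi_i\alpha_i$, $\beta=\sum_i\beta_i\alpha_i$. $q$-Whittaker function. $U_q(\mathfrak{sl}_{r+1})$ is generated by $E_i,F_i,K_i^{\pm1}$, $1\le i\le r$, with commuting $K_i$'s and $[E_i,F_j]=\delta_{i,j}\frac{K_i-K_i^{-1}}{q-q^{-1}}$, $K_iE_j=q^{C_{j,i}}E_jK_i$, $K_iF_j=q^{-C_{j,i}}F_jK_i$, and the standard quantum Serre relations. $V_\lambda$ is the (irreducible) Verma module generated by the $F_i$ from $|\lambda\rangle$ with $E_i|\lambda\rangle=0$, $K_i|\lambda\rangle=q^{\lambda_i}|\lambda\rangle$, completed as the product of its weight spaces. The dual right module $V_\lambda^*$ is generated by the $E_i$ from $\langle\lambda|$ with $\langle\lambda|F_i=0$, $\langle\lambda|K_i=q^{\lambda_i}\langle\lambda|$, $\langle\lambda|\lambda\rangle=1$, similarly completed, with pairing $(\langle\lambda|a)(b|\lambda\rangle)=\langle\lambda|ab|\lambda\rangle$. $|w\rangle_\lambda^\mu$ is the unique element of the completion of $V_\lambda$ with $\langle\lambda|w\rangle=1$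 and $E_i|w\rangle=\mu_i(K_i)^{i-1}|w\rangle$ for all $i$; ${}^{\mu'}_\lambda\langle w|$ is the unique element of the completion of $V_\lambda^*$ with $\langle w|\lambda\rangle=1$ and $\langle w|F_i=\mu_i'\langle w|(K_i)^{-(i-1)}$ for all $i$. The $q$-Whittaker function is the formal series $W_\lambda^{\mu,\mu'}(\phi;q)={}^{\mu'}_\lambda\langle w|\prod_{i=1}^r(K_i)^{-\phi_i}|w\rangle^\mu_\lambda$ (sum over $\beta$ of the pairings of components of weight $\lambda-\beta$, on which $\prod_iK_i^{-\phi_i}$ acts by $q^{-(\lambda-\beta|\phi)}$); $W_\lambda^{\mu,\mu'}(\phi;q^{-1})$ is obtained by replacing $q$ by $q^{-1}$. Partition function. $\mathcal P_\beta$ is the set of sequences $\mathbf p=(p_0,\dots,p_N)$ in $Q_+$ with $p_0=0$, $p_N=\beta$, $p_k-p_{k-1}=\alpha_{i_k}$ simple roots, and $Z_\beta=\sum_{\mathbf p\in\mathcal P_\beta}\prod_{k=1}^N\frac1{v^{(i_k)}(p_k)}$, where $v_q(\beta)=\frac1{(q-q^{-1})^2}\sum_{i=0}^rq^{2(\lambda+\rho|\omega_i-\omega_{i+1})}\big(1-q^{2(\beta|\omega_{i+1}-\omega_i)}\big)$, $\tau_i(\beta)=(\lambda+\rho-\beta|\omega_{i+1}-\omega_{i-1})$, $v^{(i)}(\beta)=q^{\tau_i(\beta)}v_q(\beta)$. Shift operators. On functions of $\phi$: $(S_if)(\phi)=f(\phi-\omega_i)$ for $1\le i\le r$, $S_0=S_{r+1}=1$,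 $T_i=S_{i+1}S_i^{-1}$ for $0\le i\le r$. Conventions. The equation is an identity of formal series (power series in the $\mu_i\mu_i'$ with coefficients functions of $\phi$). A determination of $\log q$ is fixed so that $q^x$ is defined. "Generic" means $q\ne0$ is not a root of unity, $V_\lambda$ is irreducible, and $v_q(\beta)\neq0$, $v_{q^{-1}}(\beta)\ne0$ for all $\beta\in Q_+\setminus\{0\}$. *)

theory Defs
  imports
    Complex_Main
    "HOL-Library.FuncSet"
    "HOL-Library.Function_Algebras"
    "HOL-Library.Set_Algebras"
    "HOL-Library.Poly_Mapping"
begin

section \<open>Roots and weights of type A\<close>

text \<open>
  A weight is given by its coordinates in the basis of simple roots, so that
  \<open>\<phi> k\<close> is $\phi_k$ in $\phi = \sum_k \phi_k \alpha_k$; only the coordinates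
  $1,\dots,r$ matter. Elements of the root lattice cone $Q_+$ have coordinates in \<open>nat\<close>.
\<close>

type_synonym weight = "nat \<Rightarrow> complex"
type_synonym qroot = "nat \<Rightarrow> nat"

definition cartan :: "nat \<Rightarrow> nat \<Rightarrow> int" where
  "cartan i j = (if i = j then 2 else if i = Suc j \<or> j = Suc i then - 1 else 0)"

definition form :: "nat \<Rightarrow> weight \<Rightarrow> weight \<Rightarrow> complex" where
  "form r x y = (\<Sum>i\<in>{1..r}. \<Sum>j\<in>{1..r}. x i * of_int (cartan i j) * y j)"

definition alpha :: "nat \<Rightarrow> nat \<Rightarrow> 'a::zero_neq_one" where
  "alpha i = (\<lambda>k. if k = i then 1 else 0)"

definition Qplus :: "nat \<Rightarrow> qroot set" where
  "Qplus r = {\<beta>. \<forall>k. k \<notin> {1..r} \<longrightarrow> \<beta> k = 0}"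

definition wt :: "qroot \<Rightarrow> weight" where
  "wt \<beta> = (\<lambda>k. of_nat (\<beta> k))"

text \<open>For \<open>i = 0\<close> and \<open>i = r + 1\<close> all the pairings below are required to be \<open>0\<close>, so
  that $\omega_0 = \omega_{r+1} = 0$.\<close>

definition omega :: "nat \<Rightarrow> nat \<Rightarrow> weight" where
  "omega r i = (THE x. (\<forall>k. k \<notin> {1..r} \<longrightarrow> x k = 0) \<and>
                       (\<forall>j\<in>{1..r}. form r x (alpha j) = (if i = j then 1 else 0)))"

definition rho :: "nat \<Rightarrow> weight" where
  "rho r = (\<Sum>i\<in>{1..r}. omega r i)"

text \<open>
  The deformation parameter enters through the chosen determination \<open>h\<close> of $\log q$:
  $q = e^h$ and $q^x = e^{h x}$. Replacing $q$ by $q^{-1}$ means replacing \<open>h\<close> by \<open>- h\<close>.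
\<close>

definition qpow :: "complex \<Rightarrow> complex \<Rightarrow> complex" where
  "qpow h x = exp (h * x)"

definition qdiff :: "complex \<Rightarrow> complex" where
  "qdiff h = qpow h 1 - qpow h (- 1)"


section \<open>The quantum group\<close>

text \<open>
  The free associative algebra on the letters \<open>E i\<close>, \<open>F i\<close>, \<open>K i\<close>, \<open>K i\<close>$^{-1}$ is the monoid
  algebra (finitely supported functions with convolution) of the free monoid of words.
\<close>

datatype gen = GenE nat | GenF nat | GenK nat | GenKinv nat

datatype uword = Word (letters: "gen list")

instantiation uword :: monoid_add
begin

definition zero_uword :: uword where "0 = Word []"

definition plus_uword :: "uword \<Rightarrow> uword \<Rightarrow> uword" where
  "u + v = Word (letters u @ letters v)"

instance
  by standard (simp_all add: zero_uword_def plus_uword_def)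

end

type_synonym free_alg = "uword \<Rightarrow>\<^sub>0 complex"

definition gen :: "gen \<Rightarrow> free_alg" where
  "gen g = Poly_Mapping.single (Word [g]) 1"

definition scal :: "complex \<Rightarrow> free_alg" where
  "scal c = Poly_Mapping.single 0 c"

abbreviation "E i \<equiv> gen (GenE i)"
abbreviation "F i \<equiv> gen (GenF i)"
abbreviation "K i \<equiv> gen (GenK i)"
abbreviation "Kinv i \<equiv> gen (GenKinv i)"

definition left_ideal :: "'a::ring_1 set \<Rightarrow> bool" where
  "left_ideal J \<longleftrightarrow> 0 \<in> J \<and> (\<forall>x\<in>J. \<forall>y\<in>J. x + y \<in> J) \<and> (\<forall>a. \<forall>x\<in>J. a * x \<in> J)"

definition right_ideal :: "'a::ring_1 set \<Rightarrow> bool" where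
  "right_ideal J \<longleftrightarrow> 0 \<in> J \<and> (\<forall>x\<in>J. \<forall>y\<in>J. x + y \<in> J) \<and> (\<forall>a. \<forall>x\<in>J. x * a \<in> J)"

definition left_ideal_gen :: "'a::ring_1 set \<Rightarrow> 'a set" where
  "left_ideal_gen X = \<Inter>{J. left_ideal J \<and> X \<subseteq> J}"

definition right_ideal_gen :: "'a::ring_1 set \<Rightarrow> 'a set" where
  "right_ideal_gen X = \<Inter>{J. right_ideal J \<and> X \<subseteq> J}"

definition ideal_gen :: "'a::ring_1 set \<Rightarrow> 'a set" where
  "ideal_gen X = \<Inter>{J. left_ideal J \<and> right_ideal J \<and> X \<subseteq> J}"

definition serre :: "complex \<Rightarrow> free_alg \<Rightarrow> free_alg \<Rightarrow> free_alg" where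
  "serre h x y = x * x * y - scal (qpow h 1 + qpow h (- 1)) * x * y * x + y * x * x"

text \<open>
  $U_q(\mathfrak{sl}_{r+1})$ is the quotient of the free algebra by the two-sided ideal \<open>uq_ideal\<close>.
  The letters are indexed by all natural numbers; the first set of relators removes those whose
  index is not in $\{1,\dots,r\}$.
\<close>

definition uq_relators :: "nat \<Rightarrow> complex \<Rightarrow> free_alg set" where
  "uq_relators r h =
     (\<Union>i\<in>- {1..r}. {E i, F i, K i, Kinv i})
   \<union> (\<Union>i\<in>{1..r}. {K i * Kinv i - 1, Kinv i * K i - 1})
   \<union> (\<Union>i\<in>{1..r}. \<Union>j\<in>{1..r}.
       {K i * K j - K j * K i,
        E i * F j - F j * E i
          - (if i = j then scal (1 / qdiff h) * (K i - Kinv i) else 0),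
        K i * E j - scal (qpow h (of_int (cartan j i))) * E j * K i,
        K i * F j - scal (qpow h (- of_int (cartan j i))) * F j * K i})
   \<union> (\<Union>i\<in>{1..r}. \<Union>j\<in>{j\<in>{1..r}. cartan i j = - 1}. {serre h (E i) (E j), serre h (F i) (F j)})
   \<union> (\<Union>i\<in>{1..r}. \<Union>j\<in>{j\<in>{1..r}. cartan i j = 0}. {E i * E j - E j * E i, F i * F j - F j * F i})"

definition uq_ideal :: "nat \<Rightarrow> complex \<Rightarrow> free_alg set" where
  "uq_ideal r h = ideal_gen (uq_relators r h)"


section \<open>The Verma module and its dual\<close>

text \<open>
  The Verma module $V_\lambda$ is $U_q$ modulo the left ideal generated by the $E_i$ and
  $K_i - q^{\lambda_i}$, hence the free algebra modulo \<open>ket_ideal\<close>; the coset of \<open>a\<close>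
  is $a|\lambda\rangle$. The zero vector is the coset \<open>ket_ideal\<close> itself, addition is addition
  of cosets (as sets), and since \<open>uq_ideal \<subseteq> ket_ideal\<close> is two-sided, $U_q$ acts.
  Symmetrically, $V_\lambda^*$ is the free algebra modulo the right ideal \<open>bra_ideal\<close>, and
  the coset of \<open>a\<close> is $\langle\lambda|a$.
\<close>

definition ket_ideal :: "nat \<Rightarrow> complex \<Rightarrow> weight \<Rightarrow> free_alg set" where
  "ket_ideal r h lam = left_ideal_gen (uq_ideal r h
     \<union> (\<Union>i\<in>{1..r}. {E i, K i - scal (qpow h (form r lam (alpha i)))}))"

definition bra_ideal :: "nat \<Rightarrow> complex \<Rightarrow> weight \<Rightarrow> free_alg set" where
  "bra_ideal r h lam = right_ideal_gen (uq_ideal r h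
     \<union> (\<Union>i\<in>{1..r}. {F i, K i - scal (qpow h (form r lam (alpha i)))}))"

definition ket :: "nat \<Rightarrow> complex \<Rightarrow> weight \<Rightarrow> free_alg \<Rightarrow> free_alg set" where
  "ket r h lam a = a +o ket_ideal r h lam"

definition bra :: "nat \<Rightarrow> complex \<Rightarrow> weight \<Rightarrow> free_alg \<Rightarrow> free_alg set" where
  "bra r h lam a = a +o bra_ideal r h lam"

definition verma :: "nat \<Rightarrow> complex \<Rightarrow> weight \<Rightarrow> free_alg set set" where
  "verma r h lam = range (ket r h lam)"

definition dual_verma :: "nat \<Rightarrow> complex \<Rightarrow> weight \<Rightarrow> free_alg set set" where
  "dual_verma r h lam = range (bra r h lam)"

definition lact :: "nat \<Rightarrow> complex \<Rightarrow> weight \<Rightarrow> free_alg \<Rightarrow> free_alg set \<Rightarrow> free_alg set" where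
  "lact r h lam u X = (u *o X) + ket_ideal r h lam"

definition ract :: "nat \<Rightarrow> complex \<Rightarrow> weight \<Rightarrow> free_alg set \<Rightarrow> free_alg \<Rightarrow> free_alg set" where
  "ract r h lam X u = (\<lambda>x. x * u) ` X + bra_ideal r h lam"

text \<open>Linearity of submodules is included, as scalars are elements of the free algebra.\<close>

definition verma_submodule :: "nat \<Rightarrow> complex \<Rightarrow> weight \<Rightarrow> free_alg set set \<Rightarrow> bool" where
  "verma_submodule r h lam N \<longleftrightarrow>
     N \<subseteq> verma r h lam \<and> ket_ideal r h lam \<in> N \<and>
     (\<forall>X\<in>N. \<forall>Y\<in>N. X + Y \<in> N) \<and> (\<forall>u. \<forall>X\<in>N. lact r h lam u X \<in> N)"

definition verma_irreducible :: "nat \<Rightarrow> complex \<Rightarrow> weight \<Rightarrow> bool" where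
  "verma_irreducible r h lam \<longleftrightarrow>
     verma r h lam \<noteq> {ket_ideal r h lam} \<and>
     (\<forall>N. verma_submodule r h lam N \<longrightarrow> N = {ket_ideal r h lam} \<or> N = verma r h lam)"

text \<open>
  $\langle\lambda|a|\lambda\rangle$ is the scalar to which \<open>a\<close> reduces under the
  relations of $U_q$, the rules for $|\lambda\rangle$ and $\langle\lambda|$, and the normalisation
  $\langle\lambda|\lambda\rangle = 1$.
\<close>

definition vev :: "nat \<Rightarrow> complex \<Rightarrow> weight \<Rightarrow> free_alg \<Rightarrow> complex" where
  "vev r h lam a = (THE c. a - scal c \<in> bra_ideal r h lam + ket_ideal r h lam)"

definition pairing :: "nat \<Rightarrow> complex \<Rightarrow> weight \<Rightarrow> free_alg set \<Rightarrow> free_alg set \<Rightarrow> complex" where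
  "pairing r h lam X Y = (THE c. \<exists>a\<in>X. \<exists>b\<in>Y. c = vev r h lam (a * b))"

definition ket_space :: "nat \<Rightarrow> complex \<Rightarrow> weight \<Rightarrow> qroot \<Rightarrow> free_alg set set" where
  "ket_space r h lam \<beta> = {X \<in> verma r h lam. \<forall>i\<in>{1..r}.
     lact r h lam (K i) X = lact r h lam (scal (qpow h (form r (lam - wt \<beta>) (alpha i)))) X}"

definition bra_space :: "nat \<Rightarrow> complex \<Rightarrow> weight \<Rightarrow> qroot \<Rightarrow> free_alg set set" where
  "bra_space r h lam \<beta> = {X \<in> dual_verma r h lam. \<forall>i\<in>{1..r}.
     ract r h lam X (K i) = ract r h lam X (scal (qpow h (form r (lam - wt \<beta>) (alpha i))))}"


section \<open>Whittaker vectors and the q-Whittaker function\<close>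

text \<open>
  An element \<open>w\<close> of the completion of $V_\lambda$ is the family of its components \<open>w \<beta>\<close>
  of weight $\lambda-\beta$. The component of $E_i|w\rangle$ of weight $\lambda-\beta$ is
  $E_i$ applied to the component \<open>w (\<beta> + alpha i)\<close>, while polynomials in $K_i$ act
  componentwise; the same holds for the action of $F_i$ on the completion of $V_\lambda^*$.
\<close>

definition whittaker_ket :: "nat \<Rightarrow> complex \<Rightarrow> weight \<Rightarrow> (nat \<Rightarrow> complex) \<Rightarrow> qroot \<Rightarrow> free_alg set" where
  "whittaker_ket r h lam \<mu> =
     (THE w. w \<in> (\<Pi>\<^sub>E \<beta>\<in>Qplus r. ket_space r h lam \<beta>) \<and>
             pairing r h lam (bra r h lam 1) (w 0) = 1 \<and>
             (\<forall>i\<in>{1..r}. \<forall>\<beta>\<in>Qplus r.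
                lact r h lam (E i) (w (\<beta> + alpha i)) =
                lact r h lam (scal (\<mu> i) * K i ^ (i - 1)) (w \<beta>)))"

definition whittaker_bra :: "nat \<Rightarrow> complex \<Rightarrow> weight \<Rightarrow> (nat \<Rightarrow> complex) \<Rightarrow> qroot \<Rightarrow> free_alg set" where
  "whittaker_bra r h lam \<mu>' =
     (THE w. w \<in> (\<Pi>\<^sub>E \<beta>\<in>Qplus r. bra_space r h lam \<beta>) \<and>
             pairing r h lam (w 0) (ket r h lam 1) = 1 \<and>
             (\<forall>i\<in>{1..r}. \<forall>\<beta>\<in>Qplus r.
                ract r h lam (w (\<beta> + alpha i)) (F i) =
                ract r h lam (w \<beta>) (scal (\<mu>' i) * Kinv i ^ (i - 1))))"

text \<open>
  A formal series (a power series in the $x_i = \mu_i\mu_i'$ with functions of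
  $\phi$ as coefficients) is given by the family of its homogeneous terms: \<open>f \<beta> \<phi>\<close> is the
  term of degree \<open>\<beta>\<close>, including the monomial $\prod_i (\mu_i\mu_i')^{\beta_i}$.
\<close>

type_synonym series = "qroot \<Rightarrow> weight \<Rightarrow> complex"

definition whittaker ::
    "nat \<Rightarrow> complex \<Rightarrow> weight \<Rightarrow> (nat \<Rightarrow> complex) \<Rightarrow> (nat \<Rightarrow> complex) \<Rightarrow> series" where
  "whittaker r h lam \<mu> \<mu>' \<beta> \<phi> =
     qpow h (- form r (lam - wt \<beta>) \<phi>) *
     pairing r h lam (whittaker_bra r h lam \<mu>' \<beta>) (whittaker_ket r h lam \<mu> \<beta>)"

definition mod_whittaker ::
    "nat \<Rightarrow> complex \<Rightarrow> weight \<Rightarrow> (nat \<Rightarrow> complex) \<Rightarrow> (nat \<Rightarrow> complex) \<Rightarrow> series" where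
  "mod_whittaker r h lam \<mu> \<mu>' \<beta> \<phi> =
     qpow h (\<Sum>i\<in>{1..r}. \<phi> i) * whittaker r (- h) lam \<mu> \<mu>' \<beta> \<phi>"


section \<open>The path partition function\<close>

definition vq :: "nat \<Rightarrow> complex \<Rightarrow> weight \<Rightarrow> qroot \<Rightarrow> complex" where
  "vq r h lam \<beta> = 1 / (qdiff h)\<^sup>2 *
     (\<Sum>i=0..r. qpow h (2 * form r (lam + rho r) (omega r i - omega r (i + 1))) *
                (1 - qpow h (2 * form r (wt \<beta>) (omega r (i + 1) - omega r i))))"

definition tau :: "nat \<Rightarrow> weight \<Rightarrow> nat \<Rightarrow> qroot \<Rightarrow> complex" where
  "tau r lam i \<beta> = form r (lam + rho r - wt \<beta>) (omega r (i + 1) - omega r (i - 1))"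

definition step_weight :: "nat \<Rightarrow> complex \<Rightarrow> weight \<Rightarrow> nat \<Rightarrow> qroot \<Rightarrow> complex" where
  "step_weight r h lam i \<beta> = qpow h (tau r lam i \<beta>) * vq r h lam \<beta>"

definition paths :: "nat \<Rightarrow> qroot \<Rightarrow> qroot list set" where
  "paths r \<beta> = {p. p \<noteq> [] \<and> set p \<subseteq> Qplus r \<and> hd p = 0 \<and> last p = \<beta> \<and>
     (\<forall>k\<in>{1..<length p}. \<exists>i\<in>{1..r}. p ! k = p ! (k - 1) + alpha i)}"

definition step_index :: "nat \<Rightarrow> qroot list \<Rightarrow> nat \<Rightarrow> nat" where
  "step_index r p k = (THE i. i \<in> {1..r} \<and> p ! k = p ! (k - 1) + alpha i)"

definition Zpath :: "nat \<Rightarrow> complex \<Rightarrow> weight \<Rightarrow> qroot \<Rightarrow> complex" where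
  "Zpath r h lam \<beta> =
     (\<Sum>p\<in>paths r \<beta>. \<Prod>k\<in>{1..<length p}. 1 / step_weight r h lam (step_index r p k) (p ! k))"


section \<open>The q-difference Toda operator\<close>

definition shiftS :: "nat \<Rightarrow> nat \<Rightarrow> (weight \<Rightarrow> complex) \<Rightarrow> (weight \<Rightarrow> complex)" where
  "shiftS r i f = (\<lambda>\<phi>. f (\<phi> - omega r i))"

definition shiftT :: "nat \<Rightarrow> nat \<Rightarrow> (weight \<Rightarrow> complex) \<Rightarrow> (weight \<Rightarrow> complex)" where
  "shiftT r i = shiftS r (i + 1) \<circ> inv (shiftS r i)"

text \<open>Multiplication by $\mu_i\mu_i'$ raises the degree of a homogeneous term by $\alpha_i$, so
  the degree \<open>\<beta>\<close> term of the second sum comes from the degree $\beta-\alpha_i$ term of \<open>f\<close>.\<close>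

definition toda ::
    "nat \<Rightarrow> complex \<Rightarrow> (nat \<Rightarrow> complex) \<Rightarrow> (nat \<Rightarrow> complex) \<Rightarrow> series \<Rightarrow> series" where
  "toda r h \<mu> \<mu>' f \<beta> \<phi> =
     (\<Sum>i=0..r. (shiftT r i ^^ 2) (f \<beta>) \<phi>) +
     (qdiff h)\<^sup>2 *
       (\<Sum>i=1..r. if \<beta> i = 0 then 0 else
          \<mu> i * \<mu>' i * qpow h (- form r \<phi> (alpha i)) *
          (shiftT r (i - 1) \<circ> shiftT r i) (f (\<beta> - alpha i)) \<phi>)"

definition toda_eigenvalue :: "nat \<Rightarrow> complex \<Rightarrow> weight \<Rightarrow> complex" where
  "toda_eigenvalue r h lam =
     (\<Sum>i=0..r. qpow h (2 * form r (lam + rho r) (omega r i - omega r (i + 1))))"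

definition generic :: "nat \<Rightarrow> complex \<Rightarrow> weight \<Rightarrow> bool" where
  "generic r h lam \<longleftrightarrow>
     (\<forall>n::nat. n \<ge> 1 \<longrightarrow> exp h ^ n \<noteq> 1) \<and>
     verma_irreducible r h lam \<and>
     (\<forall>\<beta>\<in>Qplus r - {0}. vq r h lam \<beta> \<noteq> 0 \<and> vq r (- h) lam \<beta> \<noteq> 0)"

end

theory Submission
  imports Defs
begin

text \<open>
  The Whittaker vector is given by the path model: the vectors defined by
  $v_q(\beta)\, w_\beta = \sum_i q^{-\tau_i(\beta)}\, \chi_i(\beta)\, F_i\, w_{\beta-\alpha_i}$, $w_0 = |\lambda\rangle$,
  where $\chi_i(\beta)$ is the prescribed eigenvalue of $E_i$, satisfy $E_j w_\beta = \chi_j(\beta)\, w_{\beta-\alpha_j}$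
  by induction on $\beta$, because
  $v_q(\beta) - v_q(\beta-\alpha_j) = q^{-\tau_j(\beta)}\, [(\lambda-\beta+\alpha_j|\alpha_j)]_q$. Neither the
  Serre relations nor the quantum Casimir element is needed. Uniqueness follows from the absence of
  singular vectors in an irreducible Verma module. The dual vector is the image of the Whittaker vector
  for $q^{-1}$ under an anti-isomorphism exchanging $E_i, F_i$ and inverting $K_i$. Pairing both
  turns the recursion for $w_\beta$ into the one for the partition function, which in turn is the
  Toda equation in degree $\beta$. The pairing at $q^{-1}$ yields the partition function at
  $q^{-1}$; it equals the one at $q$ because the two recursion operators commute.
\<close>

section \<open>The free algebra\<close>

text \<open>\<open>vev\<close>, \<open>pairing\<close> and both Whittaker families are definite
  descriptions, so nothing can be computed before existence and uniqueness are settled. For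
  \<open>vev\<close> this means that 1 is not in \<open>bra_ideal + ket_ideal\<close>.
  Irreducibility puts 1 outside \<open>ket_ideal\<close>; as q is not a root of unity, the K_i
  separate weights differing by integral combinations of simple roots, so 1 is not congruent to a
  sum of vectors of weight below lambda, and modulo \<open>ket_ideal\<close> elements of
  \<open>bra_ideal\<close> are such sums. A second obstacle is that irreducibility is assumed at q
  while W is built at 1/q. It is condensed into the absence of singular vectors of weight below
  lambda, a statement about single elements, which \<open>theta\<close> transports to 1/q. The
  number v_q(beta) has a double origin: up to (q - 1/q)^2 it is the drop in the eigenvalue of the
  sum of the T_i^2 from degree 0 to degree beta, and its increments are q^(-tau_j) times the value
  of [E_j, F_j], which is invariant under q -> 1/q. This invariance and the antisymmetry of the
  shifts of tau make the recursion operators commute.\<close>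

lemma scal_0 [simp]: "scal 0 = 0"
  and scal_1 [simp]: "scal 1 = 1"
  by (simp_all add: scal_def)

lemma scal_add: "scal (a + b) = scal a + scal b"
  and scal_diff: "scal (a - b) = scal a - scal b"
  and scal_minus: "scal (- a) = - scal a"
  and scal_mult: "scal (a * b) = scal a * scal b"
  by (simp_all add: scal_def single_add single_diff single_uminus mult_single)

lemma scal_scal: "scal a * (scal b * x) = scal (a * b) * x"
  by (simp add: scal_mult mult.assoc)

lemma free_alg_induct [case_names single add]:
  assumes "\<And>w c. P (Poly_Mapping.single w c)" "\<And>x y. P x \<Longrightarrow> P y \<Longrightarrow> P (x + y)"
  shows "P (x :: free_alg)"
proof (induction x rule: update_induct)
  case const
  show ?case using assms(1)[of 0 0] by simp
next
  case (update f a b)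
  \<comment> \<open>The key is fresh at each step of the induction, so updating it amounts to adding
    a monomial.\<close>
  have "Poly_Mapping.update a b f = f + Poly_Mapping.single a b"
    using update(1) by (intro poly_mapping_eqI)
      (auto simp: lookup_update lookup_add lookup_single when_def in_keys_iff)
  then show ?case using assms update by simp
qed

lemma single_Cons:
  "Poly_Mapping.single (Word (g # ws)) c = gen g * Poly_Mapping.single (Word ws) c"
  by (simp add: gen_def mult_single plus_uword_def)

lemma single_Nil: "Poly_Mapping.single (Word []) c = scal c"
  by (simp add: scal_def zero_uword_def)

lemma scal_comm: "x * scal c = scal c * x"
  by (induction x rule: free_alg_induct)
     (simp_all add: scal_def mult_single algebra_simps)

lemma scal_left_comm: "x * (scal c * y) = scal c * (x * y)"
  by (metis scal_comm mult.assoc)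

lemma scal_gen_comm: "gen g * scal c = scal c * gen g"
  "gen g * (scal c * y) = scal c * (gen g * y)"
  by (rule scal_comm scal_left_comm)+

text \<open>Words are products of letters, so stability under scalars and letters suffices.
  \<open>L\<close> is not assumed to be an ideal in advance; this is how the span \<open>low\<close>
  is seen to be stable under the whole algebra.\<close>

lemma left_mult_closed:
  assumes add: "\<And>x y. x \<in> L \<Longrightarrow> y \<in> L \<Longrightarrow> x + y \<in> L"
    and scal: "\<And>c x. x \<in> L \<Longrightarrow> scal c * x \<in> L"
    and gen: "\<And>g x. x \<in> L \<Longrightarrow> gen g * x \<in> L"
    and x: "x \<in> L"
  shows "a * x \<in> L"
proof (induction a rule: free_alg_induct)
  case (single w c)
  have "Poly_Mapping.single (Word ws) c * x \<in> L" for ws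
    by (induction ws) (auto simp: single_Nil single_Cons mult.assoc scal gen x)
  then show ?case by (cases w) simp
next
  case (add a b)
  then show ?case by (simp add: distrib_right assms)
qed

section \<open>Left, right and two-sided ideals given by generators\<close>

lemma left_ideal_gen_left_ideal: "left_ideal (left_ideal_gen X)"
  unfolding left_ideal_gen_def left_ideal_def by blast

lemma left_ideal_gen_base: "X \<subseteq> left_ideal_gen X"
  unfolding left_ideal_gen_def by blast

lemma left_ideal_gen_least: "left_ideal J \<Longrightarrow> X \<subseteq> J \<Longrightarrow> left_ideal_gen X \<subseteq> J"
  unfolding left_ideal_gen_def by blast

lemma right_ideal_gen_right_ideal: "right_ideal (right_ideal_gen X)"
  unfolding right_ideal_gen_def right_ideal_def by blast

lemma right_ideal_gen_base: "X \<subseteq> right_ideal_gen X"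
  unfolding right_ideal_gen_def by blast

lemma right_ideal_gen_least: "right_ideal J \<Longrightarrow> X \<subseteq> J \<Longrightarrow> right_ideal_gen X \<subseteq> J"
  unfolding right_ideal_gen_def by blast

lemma ideal_gen_left_ideal: "left_ideal (ideal_gen X)"
  unfolding ideal_gen_def left_ideal_def by blast

lemma ideal_gen_right_ideal: "right_ideal (ideal_gen X)"
  unfolding ideal_gen_def right_ideal_def by blast

lemma ideal_gen_base: "X \<subseteq> ideal_gen X"
  unfolding ideal_gen_def by blast

lemma ideal_gen_least: "left_ideal J \<Longrightarrow> right_ideal J \<Longrightarrow> X \<subseteq> J \<Longrightarrow> ideal_gen X \<subseteq> J"
  unfolding ideal_gen_def by blast

lemma left_idealD:
  assumes "left_ideal J"
  shows "0 \<in> J" "x \<in> J \<Longrightarrow> y \<in> J \<Longrightarrow> x + y \<in> J" "x \<in> J \<Longrightarrow> a * x \<in> J"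
    "x \<in> J \<Longrightarrow> - x \<in> J" "x \<in> J \<Longrightarrow> y \<in> J \<Longrightarrow> x - y \<in> J"
proof -
  show 0: "0 \<in> J" and add: "x \<in> J \<Longrightarrow> y \<in> J \<Longrightarrow> x + y \<in> J" and mult: "x \<in> J \<Longrightarrow> a * x \<in> J" for x y a
    using assms unfolding left_ideal_def by blast+
  show m: "x \<in> J \<Longrightarrow> - x \<in> J" for x using mult[of x "- 1"] by simp
  show "x \<in> J \<Longrightarrow> y \<in> J \<Longrightarrow> x - y \<in> J" using add[OF _ m] by simp
qed

lemma right_idealD:
  assumes "right_ideal J"
  shows "0 \<in> J" "x \<in> J \<Longrightarrow> y \<in> J \<Longrightarrow> x + y \<in> J" "x \<in> J \<Longrightarrow> x * a \<in> J"
    "x \<in> J \<Longrightarrow> - x \<in> J" "x \<in> J \<Longrightarrow> y \<in> J \<Longrightarrow> x - y \<in> J"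
proof -
  show 0: "0 \<in> J" and add: "x \<in> J \<Longrightarrow> y \<in> J \<Longrightarrow> x + y \<in> J" and mult: "x \<in> J \<Longrightarrow> x * a \<in> J" for x y a
    using assms unfolding right_ideal_def by blast+
  show m: "x \<in> J \<Longrightarrow> - x \<in> J" for x using mult[of x "- 1"] by simp
  show "x \<in> J \<Longrightarrow> y \<in> J \<Longrightarrow> x - y \<in> J" using add[OF _ m] by simp
qed

lemma left_ideal_sum:
  assumes "left_ideal J" "\<And>k. k \<in> S \<Longrightarrow> f k \<in> J"
  shows "sum f S \<in> J"
  using assms(2) by (induction S rule: infinite_finite_induct) (auto intro: left_idealD[OF assms(1)])

section \<open>Symmetries of the quantum group\<close>

fun flip_K :: "gen \<Rightarrow> gen" where
  "flip_K (GenE i) = GenE i"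
| "flip_K (GenF i) = GenF i"
| "flip_K (GenK i) = GenKinv i"
| "flip_K (GenKinv i) = GenK i"

fun swap_EF :: "gen \<Rightarrow> gen" where
  "swap_EF (GenE i) = GenF i"
| "swap_EF (GenF i) = GenE i"
| "swap_EF (GenK i) = GenK i"
| "swap_EF (GenKinv i) = GenKinv i"

lemma flip_K_flip_K [simp]: "flip_K (flip_K g) = g" by (cases g) simp_all
lemma swap_EF_swap_EF [simp]: "swap_EF (swap_EF g) = g" by (cases g) simp_all

definition flip_word :: "uword \<Rightarrow> uword" where
  "flip_word w = Word (map flip_K (letters w))"

definition swap_word :: "uword \<Rightarrow> uword" where
  "swap_word w = Word (rev (map swap_EF (letters w)))"

lemma flip_word_flip_word [simp]: "flip_word (flip_word w) = w"
  by (cases w) (simp add: flip_word_def o_def)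

lemma swap_word_swap_word [simp]: "swap_word (swap_word w) = w"
  by (cases w) (simp add: swap_word_def o_def rev_map)

text \<open>\<open>theta\<close> carries the relations for \<open>q\<close> to those for $q^{-1}$ and Verma modules to Verma modules;
  the anti-automorphism \<open>sigma\<close> carries Verma modules to their duals.\<close>

definition theta :: "free_alg \<Rightarrow> free_alg" where
  "theta = Poly_Mapping.map_key flip_word"

definition sigma :: "free_alg \<Rightarrow> free_alg" where
  "sigma = Poly_Mapping.map_key swap_word"

lemma inj_flip_word: "inj flip_word" and inj_swap_word: "inj swap_word"
  by (metis flip_word_flip_word injI, metis swap_word_swap_word injI)

text \<open>\<open>map_key\<close> pulls coefficients back along the map on words; since that map is
  an involution, this is the same as pushing words forward.\<close>

lemma theta_single: "theta (Poly_Mapping.single w c) = Poly_Mapping.single (flip_word w) c"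
  unfolding theta_def
  using map_key_single[OF inj_flip_word, of "flip_word w" c] by simp

lemma sigma_single: "sigma (Poly_Mapping.single w c) = Poly_Mapping.single (swap_word w) c"
  unfolding sigma_def
  using map_key_single[OF inj_swap_word, of "swap_word w" c] by simp

lemma theta_add: "theta (x + y) = theta x + theta y"
  and sigma_add: "sigma (x + y) = sigma x + sigma y"
  by (simp_all add: theta_def sigma_def map_key_plus inj_flip_word inj_swap_word)

lemma theta_0: "theta 0 = 0" and sigma_0: "sigma 0 = 0"
  by (simp_all add: theta_def sigma_def inj_flip_word inj_swap_word)

lemma theta_minus: "theta (- x) = - theta x"
  by (metis add_eq_0_iff theta_add theta_0)

lemma sigma_minus: "sigma (- x) = - sigma x"
  by (metis add_eq_0_iff sigma_add sigma_0)

lemma theta_diff: "theta (x - y) = theta x - theta y"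
  by (metis diff_conv_add_uminus theta_add theta_minus)

lemma sigma_diff: "sigma (x - y) = sigma x - sigma y"
  by (metis diff_conv_add_uminus sigma_add sigma_minus)

lemma theta_mult: "theta (x * y) = theta x * theta y"
proof (induction x rule: free_alg_induct)
  case (single w c)
  show ?case
    by (induction y rule: free_alg_induct)
       (simp_all add: mult_single theta_single theta_add distrib_left flip_word_def plus_uword_def)
qed (simp add: distrib_right theta_add)

lemma sigma_mult: "sigma (x * y) = sigma y * sigma x"
proof (induction x rule: free_alg_induct)
  case (single w c)
  show ?case
    by (induction y rule: free_alg_induct)
       (simp_all add: mult_single sigma_single sigma_add distrib_left distrib_right
          swap_word_def plus_uword_def mult.commute)
qed (simp add: distrib_right distrib_left sigma_add)

lemma theta_theta [simp]: "theta (theta x) = x"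
  by (induction x rule: free_alg_induct) (simp_all add: theta_single theta_add)

lemma sigma_sigma [simp]: "sigma (sigma x) = x"
  by (induction x rule: free_alg_induct) (simp_all add: sigma_single sigma_add)

lemma theta_scal: "theta (scal c) = scal c" and sigma_scal: "sigma (scal c) = scal c"
  by (simp_all add: scal_def theta_single sigma_single flip_word_def swap_word_def zero_uword_def)

lemma theta_1: "theta 1 = 1" and sigma_1: "sigma 1 = 1"
  using theta_scal[of 1] sigma_scal[of 1] by simp_all

lemma theta_gen: "theta (gen g) = gen (flip_K g)" and sigma_gen: "sigma (gen g) = gen (swap_EF g)"
  by (simp_all add: gen_def theta_single sigma_single flip_word_def swap_word_def)

lemmas theta_simps = theta_add theta_0 theta_diff theta_minus theta_mult theta_scal theta_1 theta_gen
lemmas sigma_simps = sigma_add sigma_0 sigma_diff sigma_minus sigma_mult sigma_scal sigma_1 sigma_gen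

text \<open>A generated ideal is the least one containing its generators, so once the preimage of an
  ideal is known to be an ideal, an inclusion need only be checked on generators.
  \<open>sigma\<close> reverses products and hence exchanges left and right.\<close>

lemma left_ideal_vimage_theta: "left_ideal J \<Longrightarrow> left_ideal (theta -` J)"
  by (auto simp: left_ideal_def theta_simps)

lemma right_ideal_vimage_theta: "right_ideal J \<Longrightarrow> right_ideal (theta -` J)"
  by (auto simp: right_ideal_def theta_simps)

lemma left_ideal_vimage_sigma: "right_ideal J \<Longrightarrow> left_ideal (sigma -` J)"
  by (auto simp: left_ideal_def right_ideal_def sigma_simps)

lemma right_ideal_vimage_sigma: "left_ideal J \<Longrightarrow> right_ideal (sigma -` J)"
  by (auto simp: left_ideal_def right_ideal_def sigma_simps)

section \<open>The defining ideal of U_q and the relations for the inverse Cartan generators\<close>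

lemma uq_ideal_left: "left_ideal (uq_ideal r h)" and uq_ideal_right: "right_ideal (uq_ideal r h)"
  by (simp_all add: uq_ideal_def ideal_gen_left_ideal ideal_gen_right_ideal)

lemma ket_ideal_left: "left_ideal (ket_ideal r h lam)"
  by (simp add: ket_ideal_def left_ideal_gen_left_ideal)

lemma bra_ideal_right: "right_ideal (bra_ideal r h lam)"
  by (simp add: bra_ideal_def right_ideal_gen_right_ideal)

lemma uq_ideal_ket: "uq_ideal r h \<subseteq> ket_ideal r h lam"
  unfolding ket_ideal_def using left_ideal_gen_base by blast

lemma uq_ideal_bra: "uq_ideal r h \<subseteq> bra_ideal r h lam"
  unfolding bra_ideal_def using right_ideal_gen_base by blast

lemmas uqD = left_idealD[OF uq_ideal_left] right_idealD(3)[OF uq_ideal_right]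

lemma uq_relator: "x \<in> uq_relators r h \<Longrightarrow> x \<in> uq_ideal r h"
  unfolding uq_ideal_def using ideal_gen_base by blast

lemma uq_out:
  assumes "i \<notin> {1..r}"
  shows "E i \<in> uq_ideal r h" "F i \<in> uq_ideal r h" "K i \<in> uq_ideal r h" "Kinv i \<in> uq_ideal r h"
  by (rule uq_relator, unfold uq_relators_def, (rule UnI1)+, rule UN_I[of i], use assms in simp, simp)+

lemma uq_rels:
  assumes "i \<in> {1..r}" "j \<in> {1..r}"
  shows "K i * Kinv i - 1 \<in> uq_ideal r h" "Kinv i * K i - 1 \<in> uq_ideal r h"
    "K i * K j - K j * K i \<in> uq_ideal r h"
    "E i * F j - F j * E i - (if i = j then scal (1 / qdiff h) * (K i - Kinv i) else 0) \<in> uq_ideal r h"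
    "K i * E j - scal (qpow h (of_int (cartan j i))) * E j * K i \<in> uq_ideal r h"
    "K i * F j - scal (qpow h (- of_int (cartan j i))) * F j * K i \<in> uq_ideal r h"
    "cartan i j = - 1 \<Longrightarrow> serre h (E i) (E j) \<in> uq_ideal r h"
    "cartan i j = - 1 \<Longrightarrow> serre h (F i) (F j) \<in> uq_ideal r h"
    "cartan i j = 0 \<Longrightarrow> E i * E j - E j * E i \<in> uq_ideal r h"
    "cartan i j = 0 \<Longrightarrow> F i * F j - F j * F i \<in> uq_ideal r h"
proof -
  show "K i * Kinv i - 1 \<in> uq_ideal r h" "Kinv i * K i - 1 \<in> uq_ideal r h"
    unfolding uq_relators_def by (rule uq_relator, unfold uq_relators_def, use assms in blast)+
  show "K i * K j - K j * K i \<in> uq_ideal r h"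
    "E i * F j - F j * E i - (if i = j then scal (1 / qdiff h) * (K i - Kinv i) else 0) \<in> uq_ideal r h"
    "K i * E j - scal (qpow h (of_int (cartan j i))) * E j * K i \<in> uq_ideal r h"
    "K i * F j - scal (qpow h (- of_int (cartan j i))) * F j * K i \<in> uq_ideal r h"
    unfolding uq_relators_def by (rule uq_relator, unfold uq_relators_def, use assms in blast)+
  show "serre h (E i) (E j) \<in> uq_ideal r h" "serre h (F i) (F j) \<in> uq_ideal r h" if "cartan i j = - 1"
    by (rule uq_relator, unfold uq_relators_def, rule UnI1, rule UnI2, rule UN_I[OF assms(1)],
        rule UN_I[of j], use assms that in simp, simp)+
  show "E i * E j - E j * E i \<in> uq_ideal r h" "F i * F j - F j * F i \<in> uq_ideal r h" if "cartan i j = 0"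
    by (rule uq_relator, unfold uq_relators_def, rule UnI2, rule UN_I[OF assms(1)],
        rule UN_I[of j], use assms that in simp, simp)+
qed

lemma uq_relators_cases [consumes 1, case_names outE outF outK outKinv KKinv KinvK KK EF KE KF
    serreE serreF commE commF]:
  assumes "x \<in> uq_relators r h"
    and "\<And>i. i \<notin> {1..r} \<Longrightarrow> P (E i)" "\<And>i. i \<notin> {1..r} \<Longrightarrow> P (F i)"
    "\<And>i. i \<notin> {1..r} \<Longrightarrow> P (K i)" "\<And>i. i \<notin> {1..r} \<Longrightarrow> P (Kinv i)"
    "\<And>i. i \<in> {1..r} \<Longrightarrow> P (K i * Kinv i - 1)" "\<And>i. i \<in> {1..r} \<Longrightarrow> P (Kinv i * K i - 1)"
    "\<And>i j. i \<in> {1..r} \<Longrightarrow> j \<in> {1..r} \<Longrightarrow> P (K i * K j - K j * K i)"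
    "\<And>i j. i \<in> {1..r} \<Longrightarrow> j \<in> {1..r} \<Longrightarrow>
       P (E i * F j - F j * E i - (if i = j then scal (1 / qdiff h) * (K i - Kinv i) else 0))"
    "\<And>i j. i \<in> {1..r} \<Longrightarrow> j \<in> {1..r} \<Longrightarrow> P (K i * E j - scal (qpow h (of_int (cartan j i))) * E j * K i)"
    "\<And>i j. i \<in> {1..r} \<Longrightarrow> j \<in> {1..r} \<Longrightarrow> P (K i * F j - scal (qpow h (- of_int (cartan j i))) * F j * K i)"
    "\<And>i j. i \<in> {1..r} \<Longrightarrow> j \<in> {1..r} \<Longrightarrow> cartan i j = - 1 \<Longrightarrow> P (serre h (E i) (E j))"
    "\<And>i j. i \<in> {1..r} \<Longrightarrow> j \<in> {1..r} \<Longrightarrow> cartan i j = - 1 \<Longrightarrow> P (serre h (F i) (F j))"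
    "\<And>i j. i \<in> {1..r} \<Longrightarrow> j \<in> {1..r} \<Longrightarrow> cartan i j = 0 \<Longrightarrow> P (E i * E j - E j * E i)"
    "\<And>i j. i \<in> {1..r} \<Longrightarrow> j \<in> {1..r} \<Longrightarrow> cartan i j = 0 \<Longrightarrow> P (F i * F j - F j * F i)"
  shows "P x"
  using assms(1) unfolding uq_relators_def
  apply (elim UnE UN_E insertE emptyE CollectE conjE)
  by (simp_all only: Compl_iff) (rule assms(2-); assumption)+

lemma qpow_add: "qpow h (x + y) = qpow h x * qpow h y"
  by (simp add: qpow_def exp_add distrib_left)

lemma qpow_0 [simp]: "qpow h 0 = 1"
  by (simp add: qpow_def)

lemma qpow_neq_0 [simp]: "qpow h x \<noteq> 0"
  by (simp add: qpow_def)

lemma qpow_uminus: "qpow (- h) x = qpow h (- x)"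
  by (simp add: qpow_def)

lemma qdiff_uminus: "qdiff (- h) = - qdiff h"
  by (simp add: qdiff_def qpow_uminus)

text \<open>Sandwich k x = c x k between two copies of k'. The equations below write the difference
  as explicit multiples of the three given elements, so that closure of the ideal on both sides
  finishes.\<close>

lemma conj_inverse:
  fixes k k' x :: free_alg
  assumes J: "left_ideal J" "right_ideal J"
    and k: "k * k' - 1 \<in> J" "k' * k - 1 \<in> J"
    and x: "k * x - scal c * x * k \<in> J"
    and c: "c * d = 1"
  shows "k' * x - scal d * x * k' \<in> J"
proof -
  have "k' * x - scal d * x * k'
      = - (k' * x) * (k * k' - 1) + scal d * (scal c * (k' * x * k * k')) - scal d * x * k'"
    using c by (simp add: scal_scal mult.commute[of d c]) (simp add: algebra_simps)
  also have "scal d * (scal c * (k' * x * k * k'))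
      = scal d * ((k' * k - 1) * (x * k')) - scal d * (k' * (k * x - scal c * x * k) * k') + scal d * x * k'"
    by (simp add: algebra_simps scal_left_comm[of k' c])
  finally have "k' * x - scal d * x * k' = - (k' * x) * (k * k' - 1) + (scal d * ((k' * k - 1) * (x * k'))
     - scal d * (k' * (k * x - scal c * x * k) * k'))" by simp
  moreover have "- (k' * x) * (k * k' - 1) \<in> J" "scal d * ((k' * k - 1) * (x * k')) \<in> J"
    "scal d * (k' * (k * x - scal c * x * k) * k') \<in> J"
    by (rule left_idealD(3)[OF J(1) k(1)],
        rule left_idealD(3)[OF J(1) right_idealD(3)[OF J(2) k(2)]],
        rule left_idealD(3)[OF J(1) right_idealD(3)[OF J(2) left_idealD(3)[OF J(1) x]]])
  ultimately show ?thesis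
    by (simp only:) (intro left_idealD(2)[OF J(1)] left_idealD(5)[OF J(1)])
qed

lemma uq_Kinv:
  assumes "i \<in> {1..r}" "j \<in> {1..r}"
  shows "Kinv i * E j - scal (qpow h (- of_int (cartan j i))) * E j * Kinv i \<in> uq_ideal r h"
    "Kinv i * F j - scal (qpow h (of_int (cartan j i))) * F j * Kinv i \<in> uq_ideal r h"
    "Kinv i * Kinv j - Kinv j * Kinv i \<in> uq_ideal r h"
    "Kinv i * K j - K j * Kinv i \<in> uq_ideal r h"
proof -
  note c = conj_inverse[OF uq_ideal_left uq_ideal_right uq_rels(1,2)[OF assms(1,1), of h]]
  show "Kinv i * E j - scal (qpow h (- of_int (cartan j i))) * E j * Kinv i \<in> uq_ideal r h"
    by (rule c[OF uq_rels(5)]) (use assms in \<open>simp_all flip: qpow_add\<close>)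
  show "Kinv i * F j - scal (qpow h (of_int (cartan j i))) * F j * Kinv i \<in> uq_ideal r h"
    by (rule c[OF uq_rels(6)]) (use assms in \<open>simp_all flip: qpow_add\<close>)
  show KinvK: "Kinv i * K j - K j * Kinv i \<in> uq_ideal r h"
    using c[of "K j" 1 1] uq_rels(3)[OF assms] by simp
  \<comment> \<open>A second conjugation, now by \<open>K j\<close>, turns this relation into the
    commutation of the two inverses.\<close>
  have "K j * Kinv i - Kinv i * K j \<in> uq_ideal r h" using uqD(4)[OF KinvK] by simp
  then have "Kinv j * Kinv i - Kinv i * Kinv j \<in> uq_ideal r h"
    using conj_inverse[OF uq_ideal_left uq_ideal_right uq_rels(1,2)[OF assms(2,2), of h], of "Kinv i" 1 1]
    by simp
  from uqD(4)[OF this] show "Kinv i * Kinv j - Kinv j * Kinv i \<in> uq_ideal r h" by simp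
qed

section \<open>Images of the ideals under the two symmetries\<close>

lemma theta_uq_ideal: "x \<in> uq_ideal r h \<Longrightarrow> theta x \<in> uq_ideal r (- h)"
proof -
  have "uq_relators r h \<subseteq> theta -` uq_ideal r (- h)"
  proof
    fix x assume "x \<in> uq_relators r h"
    then show "x \<in> theta -` uq_ideal r (- h)"
    proof (induction rule: uq_relators_cases)
      case (EF i j)
      then have "E i * F j - F j * E i - (if i = j then scal (1 / qdiff (- h)) * (K i - Kinv i) else 0)
         \<in> uq_ideal r (- h)" by (rule uq_rels(4))
      \<comment> \<open>Inverting q changes the sign of q - 1/q, which compensates the exchange of
        \<open>K i\<close> and \<open>Kinv i\<close>.\<close>
      moreover have "scal (1 / qdiff (- h)) * (K i - Kinv i) = scal (1 / qdiff h) * (Kinv i - K i)"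
        by (simp add: qdiff_uminus scal_minus right_diff_distrib)
      ultimately show ?case by (cases "i = j") (simp_all add: theta_simps)
    next
      case (KE i j)
      then show ?case using uq_Kinv(1)[OF KE, of "- h"] by (simp add: theta_simps qpow_uminus)
    next
      case (KF i j)
      then show ?case using uq_Kinv(2)[OF KF, of "- h"] by (simp add: theta_simps qpow_uminus)
    next
      case (serreE i j)
      then show ?case using uq_rels(7)[OF serreE, of "- h"]
        by (simp add: theta_simps serre_def qpow_uminus add.commute)
    next
      case (serreF i j)
      then show ?case using uq_rels(8)[OF serreF, of "- h"]
        by (simp add: theta_simps serre_def qpow_uminus add.commute)
    qed (simp_all add: theta_simps uq_out uq_rels uq_Kinv)
  qed
  then show "x \<in> uq_ideal r h \<Longrightarrow> theta x \<in> uq_ideal r (- h)"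
    unfolding uq_ideal_def[of r h]
    using ideal_gen_least[OF left_ideal_vimage_theta[OF uq_ideal_left]
        right_ideal_vimage_theta[OF uq_ideal_right], of "uq_relators r h" r "- h"] by auto
qed

lemma sigma_uq_ideal: "x \<in> uq_ideal r h \<Longrightarrow> sigma x \<in> uq_ideal r h"
proof -
  have "uq_relators r h \<subseteq> sigma -` uq_ideal r h"
  proof
    fix x assume "x \<in> uq_relators r h"
    then show "x \<in> sigma -` uq_ideal r h"
    proof (induction rule: uq_relators_cases)
      case (KK i j)
      then show ?case using uq_rels(3)[OF KK(2,1), of h] by (simp add: sigma_simps)
    next
      case (EF i j)
      then show ?case using uq_rels(4)[OF EF(2,1), of h]
        by (cases "i = j") (simp_all add: sigma_simps scal_comm[of "gen a - gen b" for a b])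
    next
      case (KE i j)
      \<comment> \<open>The image of the K-E relator is a nonzero multiple of the K-F relator:
        reversing the product puts the scalar on the other side, where its inverse is
        wanted.\<close>
      have "F j * K i - scal (qpow h (of_int (cartan j i))) * K i * F j
         = - (scal (qpow h (of_int (cartan j i))) * (K i * F j - scal (qpow h (- of_int (cartan j i))) * F j * K i))"
        by (simp add: right_diff_distrib mult.assoc scal_scal flip: qpow_add)
      also have "\<dots> \<in> uq_ideal r h" by (intro uqD uq_rels KE)
      finally show ?case by (simp add: sigma_simps scal_gen_comm mult.assoc)
    next
      case (KF i j)
      have "E j * K i - scal (qpow h (- of_int (cartan j i))) * K i * E j
         = - (scal (qpow h (- of_int (cartan j i))) * (K i * E j - scal (qpow h (of_int (cartan j i))) * E j * K i))"
        by (simp add: right_diff_distrib mult.assoc scal_scal flip: qpow_add)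
      also have "\<dots> \<in> uq_ideal r h" by (intro uqD uq_rels KF)
      finally show ?case by (simp add: sigma_simps scal_gen_comm mult.assoc)
    next
      case (serreE i j)
      \<comment> \<open>The Serre expression reads the same in both directions, so reversing words
        only replaces E by F.\<close>
      have "sigma (serre h (E i) (E j)) = serre h (F i) (F j)"
        by (simp add: sigma_simps serre_def scal_gen_comm mult.assoc)
      then show ?case using uq_rels(8)[OF serreE] by simp
    next
      case (serreF i j)
      have "sigma (serre h (F i) (F j)) = serre h (E i) (E j)"
        by (simp add: sigma_simps serre_def scal_gen_comm mult.assoc)
      then show ?case using uq_rels(7)[OF serreF] by simp
    next
      case (commE i j)
      then have "cartan j i = 0" by (auto simp: cartan_def split: if_splits)
      then show ?case using uq_rels(10)[OF commE(2,1)] by (simp add: sigma_simps)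
    next
      case (commF i j)
      then have "cartan j i = 0" by (auto simp: cartan_def split: if_splits)
      then show ?case using uq_rels(9)[OF commF(2,1)] by (simp add: sigma_simps)
    qed (simp_all add: sigma_simps uq_out uq_rels)
  qed
  then show "x \<in> uq_ideal r h \<Longrightarrow> sigma x \<in> uq_ideal r h"
    unfolding uq_ideal_def[of r h]
    using ideal_gen_least[OF left_ideal_vimage_sigma[OF uq_ideal_right]
        right_ideal_vimage_sigma[OF uq_ideal_left], of "uq_relators r h" r h]
    by (auto simp: uq_ideal_def)
qed

lemma ket_E: "i \<in> {1..r} \<Longrightarrow> E i \<in> ket_ideal r h lam"
  and ket_K: "i \<in> {1..r} \<Longrightarrow> K i - scal (qpow h (form r lam (alpha i))) \<in> ket_ideal r h lam"
  unfolding ket_ideal_def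
  by (rule subsetD[OF left_ideal_gen_base], rule UnI2, rule UN_I[of i], assumption, simp)+

lemma bra_F: "i \<in> {1..r} \<Longrightarrow> F i \<in> bra_ideal r h lam"
  and bra_K: "i \<in> {1..r} \<Longrightarrow> K i - scal (qpow h (form r lam (alpha i))) \<in> bra_ideal r h lam"
  unfolding bra_ideal_def
  by (rule subsetD[OF right_ideal_gen_base], rule UnI2, rule UN_I[of i], assumption, simp)+

text \<open>The weight lambda stays the same: the generator K_i - q^(lambda_i) becomes one for the
  inverse of K_i, which at 1/q acts on the highest weight vector by the inverse of
  (1/q)^(lambda_i).\<close>

lemma theta_ket_ideal: "x \<in> ket_ideal r h lam \<Longrightarrow> theta x \<in> ket_ideal r (- h) lam"
proof -
  let ?I = "ket_ideal r (- h) lam"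
  note I = left_idealD[OF ket_ideal_left]
  have K: "Kinv i - scal (qpow h (form r lam (alpha i))) \<in> ?I" if i: "i \<in> {1..r}" for i
  proof -
    define c where "c = qpow h (form r lam (alpha i))"
    define d where "d = qpow (- h) (form r lam (alpha i))"
    have cd: "c * d = 1" by (simp add: c_def d_def qpow_uminus flip: qpow_add)
    have "Kinv i - scal c = scal c * (Kinv i * K i - 1) - scal c * Kinv i * (K i - scal d)"
      using cd by (simp add: right_diff_distrib mult.assoc scal_gen_comm scal_scal flip: scal_mult)
    also have "\<dots> \<in> ?I"
    proof (rule I(5)[OF I(3) I(3)])
      show "Kinv i * K i - 1 \<in> ?I" using uq_rels(2)[OF i i] uq_ideal_ket by blast
      show "K i - scal d \<in> ?I" unfolding d_def by (rule ket_K[OF i])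
    qed
    finally show ?thesis by (simp add: c_def)
  qed
  have "ket_ideal r h lam \<subseteq> theta -` ?I"
    unfolding ket_ideal_def[of r h]
  proof (rule left_ideal_gen_least[OF left_ideal_vimage_theta[OF ket_ideal_left]])
    show "uq_ideal r h \<union> (\<Union>i\<in>{1..r}. {E i, K i - scal (qpow h (form r lam (alpha i)))}) \<subseteq> theta -` ?I"
      using K theta_uq_ideal[of _ r h] uq_ideal_ket[of r "- h" lam]
      by (auto simp: theta_simps ket_E)
  qed
  then show "x \<in> ket_ideal r h lam \<Longrightarrow> theta x \<in> ket_ideal r (- h) lam" by auto
qed

lemma sigma_ket_ideal: "x \<in> ket_ideal r h lam \<Longrightarrow> sigma x \<in> bra_ideal r h lam"
proof -
  have "ket_ideal r h lam \<subseteq> sigma -` bra_ideal r h lam"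
    unfolding ket_ideal_def
  proof (rule left_ideal_gen_least[OF left_ideal_vimage_sigma[OF bra_ideal_right]])
    show "uq_ideal r h \<union> (\<Union>i\<in>{1..r}. {E i, K i - scal (qpow h (form r lam (alpha i)))})
       \<subseteq> sigma -` bra_ideal r h lam"
      using sigma_uq_ideal[of _ r h] uq_ideal_bra[of r h lam]
      by (auto simp: sigma_simps bra_F bra_K)
  qed
  then show "x \<in> ket_ideal r h lam \<Longrightarrow> sigma x \<in> bra_ideal r h lam" by auto
qed

lemma sigma_bra_ideal: "x \<in> bra_ideal r h lam \<Longrightarrow> sigma x \<in> ket_ideal r h lam"
proof -
  have "bra_ideal r h lam \<subseteq> sigma -` ket_ideal r h lam"
    unfolding bra_ideal_def
  proof (rule right_ideal_gen_least[OF right_ideal_vimage_sigma[OF ket_ideal_left]])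
    show "uq_ideal r h \<union> (\<Union>i\<in>{1..r}. {F i, K i - scal (qpow h (form r lam (alpha i)))})
       \<subseteq> sigma -` ket_ideal r h lam"
      using sigma_uq_ideal[of _ r h] uq_ideal_ket[of r h lam]
      by (auto simp: sigma_simps ket_E ket_K)
  qed
  then show "x \<in> bra_ideal r h lam \<Longrightarrow> sigma x \<in> ket_ideal r h lam" by auto
qed

text \<open>Inverting K_i is what matches the two Whittaker conditions: \<open>K i ^ (i - 1)\<close>
  on kets goes to \<open>Kinv i ^ (i - 1)\<close> on bras, so kets at q yield bras at 1/q for the
  same characters.\<close>

definition psi :: "free_alg \<Rightarrow> free_alg" where "psi x = sigma (theta x)"

lemma sigma_theta: "sigma (theta x) = theta (sigma x)"
proof (induction x rule: free_alg_induct)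
  case (single w c)
  have "swap_EF (flip_K g) = flip_K (swap_EF g)" for g by (cases g) simp_all
  then show ?case by (simp add: sigma_single theta_single flip_word_def swap_word_def o_def rev_map)
qed (simp add: theta_simps sigma_simps)

lemma psi_psi [simp]: "psi (psi x) = x"
  by (simp add: psi_def sigma_theta)

lemma psi_mult: "psi (x * y) = psi y * psi x"
  by (simp add: psi_def theta_simps sigma_simps)

lemma psi_simps: "psi (x + y) = psi x + psi y" "psi 0 = 0" "psi (x - y) = psi x - psi y"
  "psi (- x) = - psi x" "psi (scal c) = scal c" "psi 1 = 1"
  "psi (E i) = F i" "psi (F i) = E i" "psi (K i) = Kinv i" "psi (Kinv i) = K i"
  by (simp_all add: psi_def theta_simps sigma_simps)

lemma psi_power: "psi (x ^ n) = psi x ^ n"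
  by (induction n) (simp_all add: psi_simps psi_mult power_commutes)

lemma psi_ket_ideal: "psi x \<in> bra_ideal r (- h) lam \<longleftrightarrow> x \<in> ket_ideal r h lam"
proof
  assume "x \<in> ket_ideal r h lam"
  then show "psi x \<in> bra_ideal r (- h) lam" by (simp add: psi_def sigma_ket_ideal theta_ket_ideal)
next
  assume "psi x \<in> bra_ideal r (- h) lam"
  then have "theta x \<in> ket_ideal r (- h) lam" using sigma_bra_ideal[of "psi x"] by (simp add: psi_def)
  then show "x \<in> ket_ideal r h lam" using theta_ket_ideal[of "theta x" r "- h" lam] by simp
qed

section \<open>Pairings in coordinates\<close>

lemma cartan_commute: "cartan i j = cartan j i"
  by (auto simp: cartan_def)

lemma form_commute: "form r x y = form r y x"
  unfolding form_def
  by (subst sum.swap) (auto intro!: sum.cong simp: cartan_commute mult_ac)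

lemma form_add: "form r (x + y) z = form r x z + form r y z"
  and form_diff: "form r (x - y) z = form r x z - form r y z"
  and form_add_right: "form r z (x + y) = form r z x + form r z y"
  and form_diff_right: "form r z (x - y) = form r z x - form r z y"
  by (simp_all add: form_def algebra_simps sum.distrib sum_subtractf)

lemma form_0 [simp]: "form r 0 x = 0" "form r x 0 = 0"
  by (simp_all add: form_def)

lemma form_sum: "form r (sum f S) y = (\<Sum>i\<in>S. form r (f i) y)"
proof (induction S rule: infinite_finite_induct)
  case (insert x F)
  then show ?case unfolding sum.insert[OF insert(1,2)] form_add by simp
qed (metis form_0(1) sum.empty sum.infinite)+

text \<open>The pairing with omega_i in coordinates. Extending by zero realises omega_0 =
  omega_{r+1} = 0, so boundary terms of differences need no separate treatment.\<close>

definition cut :: "nat \<Rightarrow> weight \<Rightarrow> nat \<Rightarrow> complex" where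
  "cut r x i = (if i \<in> {1..r} then x i else 0)"

lemma cut_0: "cut r 0 i = 0"
  by (simp add: cut_def)

lemma cut_diff: "cut r (x - y) i = cut r x i - cut r y i"
  by (simp add: cut_def)

lemma form_alpha:
  assumes "j \<in> {1..r}"
  shows "form r x (alpha j) = 2 * cut r x j - cut r x (j - 1) - cut r x (j + 1)"
proof -
  have "form r x (alpha j) = (\<Sum>i\<in>{1..r}. x i * of_int (cartan i j))"
    unfolding form_def
  proof (rule sum.cong[OF refl])
    fix i
    have "(\<Sum>k\<in>{1..r}. x i * of_int (cartan i k) * alpha j k)
        = (\<Sum>k\<in>{1..r}. if k = j then x i * of_int (cartan i j) else 0)"
      by (rule sum.cong) (auto simp: alpha_def)
    then show "(\<Sum>k\<in>{1..r}. x i * of_int (cartan i k) * alpha j k) = x i * of_int (cartan i j)"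
      using assms by simp
  qed
  also have "\<dots> = (\<Sum>i\<in>{1..r}. (if i = j then 2 * cut r x j else 0)
      - (if i = j - 1 then cut r x (j - 1) else 0) - (if i = j + 1 then cut r x (j + 1) else 0))"
    using assms by (intro sum.cong) (auto simp: cartan_def cut_def)
  also have "\<dots> = 2 * cut r x j - cut r x (j - 1) - cut r x (j + 1)"
    using assms by (simp add: sum_subtractf cut_def)
  finally show ?thesis .
qed

lemma form_alpha_expand: "form r x y = (\<Sum>j\<in>{1..r}. y j * form r x (alpha j))"
proof -
  have "form r x (alpha j) = (\<Sum>i\<in>{1..r}. x i * of_int (cartan i j))" if "j \<in> {1..r}" for j
  proof -
    have "(\<Sum>k\<in>{1..r}. x i * of_int (cartan i k) * alpha j k) = x i * of_int (cartan i j)" for i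
      using that sum.delta[of "{1..r}" j "\<lambda>k. x i * of_int (cartan i k)"]
      by (simp add: alpha_def if_distrib cong: if_cong)
    then show ?thesis by (simp add: form_def)
  qed
  then show ?thesis
    unfolding form_def[of r x y]
    by (subst sum.swap) (auto simp: sum_distrib_left mult_ac intro!: sum.cong)
qed

text \<open>The inverse of the Cartan matrix, whose rows are the fundamental weights.\<close>

definition icartan :: "nat \<Rightarrow> nat \<Rightarrow> weight" where
  "icartan r i k = (if k \<in> {1..r} then of_nat (min i k * (r + 1 - max i k)) / of_nat (r + 1) else 0)"

text \<open>For fixed i the row is piecewise linear in k, vanishes at 0 and r + 1, and has its only
  kink at i; the Cartan matrix takes second differences, which are therefore concentrated at
  i.\<close>

lemma form_icartan:
  assumes i: "i \<le> r + 1" and j: "j \<in> {1..r}"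
  shows "form r (icartan r i) (alpha j) = (if i = j then 1 else 0)"
proof -
  define g where "g k = (of_nat (min i k * (r + 1 - max i k)) / of_nat (r + 1) :: complex)" for k
  have cut: "cut r (icartan r i) k = g k" if "k \<le> r + 1" for k
    using that i by (auto simp: cut_def icartan_def g_def not_le le_Suc_eq max_def min_def)
  define N :: complex where "N = of_nat (r + 1)"
  have n: "N \<noteq> 0" unfolding N_def by (metis add_is_0 of_nat_eq_0_iff zero_neq_one)
  have "2 * g j - g (j - 1) - g (j + 1) = (if i = j then 1 else 0)"
  proof -
    have lo: "g k = of_nat k * (N - of_nat i) / N" if "k \<le> i" for k
      using that i by (simp add: g_def N_def max_def min_def of_nat_diff)
    have hi: "g k = of_nat i * (N - of_nat k) / N" if "i \<le> k" "k \<le> r + 1" for k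
      using that i by (simp add: g_def N_def max_def min_def of_nat_diff)
    obtain l where l: "j = Suc l" using j by (cases j) auto
    consider "j < i" | "j = i" | "i < j" by linarith
    then show ?thesis
    proof cases
      case 1
      then show ?thesis using n by (simp add: l lo divide_simps) (simp add: algebra_simps)
    next
      case 2
      then have "i = Suc l" by (simp add: l)
      have "g j = of_nat i * (N - of_nat i) / N" "g (j - 1) = (of_nat i - 1) * (N - of_nat i) / N"
        "g (j + 1) = of_nat i * (N - of_nat i - 1) / N"
        using lo[of "Suc l"] lo[of l] hi[of "Suc (Suc l)"] j \<open>i = Suc l\<close> by (simp_all add: l diff_diff_add)
      then show ?thesis using n 2 by (simp only: if_True) (simp add: field_simps)
    next
      case 3
      then show ?thesis using n j by (simp add: l hi divide_simps) (simp add: algebra_simps)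
    qed
  qed
  moreover have "1 \<le> j" "j \<le> r" using j by auto
  ultimately show ?thesis using form_alpha[OF j] by (simp add: cut)
qed

lemma form_icartan_right:
  assumes "i \<le> r + 1"
  shows "form r x (icartan r i) = cut r x i"
proof -
  have "form r x (icartan r i) = (\<Sum>j\<in>{1..r}. x j * (if j = i then 1 else 0))"
    unfolding form_commute[of r x] form_alpha_expand[of r _ x]
    using assms by (intro sum.cong) (auto simp: form_icartan)
  then show ?thesis by (simp add: cut_def if_distrib cong: if_cong)
qed

text \<open>Uniqueness holds because pairing with row k of the inverse Cartan matrix reads off the
  k-th coordinate. The indices 0 and r + 1 are included and give the zero row.\<close>

lemma omega_eq:
  assumes "i \<le> r + 1"
  shows "omega r i = icartan r i"
  unfolding omega_def
proof (rule the_equality)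
  show "(\<forall>k. k \<notin> {1..r} \<longrightarrow> icartan r i k = 0) \<and>
    (\<forall>j\<in>{1..r}. form r (icartan r i) (alpha j) = (if i = j then 1 else 0))"
    using assms by (simp add: form_icartan) (simp add: icartan_def)
next
  fix x assume x: "(\<forall>k. k \<notin> {1..r} \<longrightarrow> x k = 0) \<and>
    (\<forall>j\<in>{1..r}. form r x (alpha j) = (if i = j then 1 else 0))"
  show "x = icartan r i"
  proof
    fix k
    show "x k = icartan r i k"
    proof (cases "k \<in> {1..r}")
      case True
      then have "x k - icartan r i k = form r (x - icartan r i) (icartan r k)"
        using form_icartan_right[of k r "x - icartan r i"] by (simp add: cut_def)
      also have "\<dots> = 0"
        unfolding form_alpha_expand[of r _ "icartan r k"]
        using x assms by (intro sum.neutral ballI) (simp add: form_diff form_icartan)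
      finally show ?thesis by simp
    next
      case False
      then show ?thesis using x by (simp add: icartan_def del: atLeastAtMost_iff)
    qed
  qed
qed

lemma form_omega: "i \<le> r + 1 \<Longrightarrow> form r x (omega r i) = cut r x i"
  by (simp add: omega_eq form_icartan_right)

lemma form_rho: "form r (rho r) x = (\<Sum>i\<in>{1..r}. x i)"
  by (simp add: rho_def form_sum form_commute[of r "omega r _"] form_omega cut_def)

lemma form_rho_alpha: "j \<in> {1..r} \<Longrightarrow> form r (rho r) (alpha j) = 1"
  by (simp add: form_rho alpha_def)

lemma wt_0: "wt 0 = 0" by (rule ext) (simp add: wt_def)

lemma wt_add: "wt (\<beta> + \<gamma>) = wt \<beta> + wt \<gamma>" by (rule ext) (simp add: wt_def)

lemma wt_alpha: "wt (alpha i) = alpha i" by (rule ext) (simp add: wt_def alpha_def)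

lemma wt_diff_alpha: "\<beta> i \<noteq> 0 \<Longrightarrow> wt (\<beta> - alpha i) = wt \<beta> - alpha i"
  by (rule ext) (auto simp: wt_def alpha_def of_nat_diff)

lemma cut_alpha: "i \<in> {1..r} \<Longrightarrow> cut r (alpha i) k = (if k = i then 1 else 0)"
  by (auto simp: cut_def alpha_def)

section \<open>Lowering a degree by a simple root\<close>

text \<open>The convention that f vanishes outside Q_+. Without the guard, truncated subtraction
  would return the value at \<beta> itself when its i-th coordinate is 0.\<close>

definition lower :: "nat \<Rightarrow> (qroot \<Rightarrow> 'a::zero) \<Rightarrow> qroot \<Rightarrow> 'a" where
  "lower i f \<beta> = (if \<beta> i = 0 then 0 else f (\<beta> - alpha i))"

definition height :: "nat \<Rightarrow> qroot \<Rightarrow> nat" where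
  "height r \<beta> = (\<Sum>i\<in>{1..r}. \<beta> i)"

lemma Qplus_0: "0 \<in> Qplus r" by (simp add: Qplus_def)

lemma Qplus_diff_alpha: "\<beta> \<in> Qplus r \<Longrightarrow> \<beta> - alpha i \<in> Qplus r" by (simp add: Qplus_def)

lemma Qplus_add_alpha: "\<beta> \<in> Qplus r \<Longrightarrow> i \<in> {1..r} \<Longrightarrow> \<beta> + alpha i \<in> Qplus r"
  by (auto simp: Qplus_def alpha_def)

lemma diff_alpha_add: "\<beta> i \<noteq> 0 \<Longrightarrow> \<beta> - alpha i + alpha i = (\<beta> :: qroot)"
  by (rule ext) (auto simp: alpha_def)

lemma add_alpha_diff: "\<beta> + alpha i - alpha i = (\<beta> :: qroot)"
  by (rule ext) (auto simp: alpha_def)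

lemma alpha_self [simp]: "alpha i i = 1"
  by (simp add: alpha_def)

lemma alpha_inj: "alpha i = (alpha j :: nat \<Rightarrow> nat) \<Longrightarrow> i = j"
  by (metis alpha_def zero_neq_one)

lemma height_add_alpha: "i \<in> {1..r} \<Longrightarrow> height r (\<beta> + alpha i) = Suc (height r \<beta>)"
  by (simp add: height_def sum.distrib) (simp add: alpha_def)

lemma height_diff_alpha: "i \<in> {1..r} \<Longrightarrow> \<beta> i \<noteq> 0 \<Longrightarrow> height r \<beta> = Suc (height r (\<beta> - alpha i))"
  by (metis diff_alpha_add height_add_alpha)

lemma Qplus_induct [consumes 1, case_names step]:
  assumes "\<beta> \<in> Qplus r"
    and "\<And>\<beta>. \<beta> \<in> Qplus r \<Longrightarrow> (\<And>i. i \<in> {1..r} \<Longrightarrow> \<beta> i \<noteq> 0 \<Longrightarrow> P (\<beta> - alpha i)) \<Longrightarrow> P \<beta>"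
  shows "P \<beta>"
  using assms(1)
proof (induction "height r \<beta>" arbitrary: \<beta> rule: less_induct)
  case less
  show ?case
    by (rule assms(2)[OF less.prems])
       (metis height_diff_alpha less.hyps less.prems lessI Qplus_diff_alpha)
qed

lemma lower_commute: "lower i (lower j f) \<beta> = lower j (lower i f) \<beta>"
proof -
  have "\<beta> - alpha i - alpha j = \<beta> - alpha j - alpha i" by (rule ext) simp
  then show ?thesis by (auto simp: lower_def) (auto simp: alpha_def split: if_splits)
qed

lemma lower_mult: "lower i (\<lambda>\<gamma>. g \<gamma> * f \<gamma>) \<beta> = g (\<beta> - alpha i) * lower i f (\<beta> :: qroot)"
  for f g :: "qroot \<Rightarrow> 'a::mult_zero"
  by (simp add: lower_def)

lemma lower_diff: "lower i (\<lambda>\<gamma>. g \<gamma> - f \<gamma>) \<beta> = lower i g \<beta> - lower i f \<beta>"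
  for f g :: "qroot \<Rightarrow> 'a::group_add"
  by (simp add: lower_def)

lemma lower_sum: "lower i (\<lambda>\<gamma>. \<Sum>k\<in>S. f k \<gamma>) \<beta> = (\<Sum>k\<in>S. lower i (f k) \<beta>)"
  by (simp add: lower_def)

lemma lower_eq_0: "(\<beta> i \<noteq> 0 \<Longrightarrow> f (\<beta> - alpha i) = 0) \<Longrightarrow> lower i f \<beta> = 0"
  unfolding lower_def by metis

lemma lower_0_root [simp]: "lower i f 0 = 0" by (simp add: lower_def)

lemma lower_add_alpha: "lower i f (\<beta> + alpha i) = f \<beta>"
  by (simp add: lower_def add_alpha_diff)

section \<open>The weights of the path model\<close>

lemma vq_cut: "vq r h lam \<beta> = 1 / (qdiff h)\<^sup>2 *
     (\<Sum>i=0..r. qpow h (2 * (cut r (lam + rho r) i - cut r (lam + rho r) (i + 1))) *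
                (1 - qpow h (2 * (cut r (wt \<beta>) (i + 1) - cut r (wt \<beta>) i))))"
  unfolding vq_def by (intro arg_cong2[of _ _ _ _ "(*)"] refl sum.cong) (simp_all add: form_diff_right form_omega)

lemma vq_0: "vq r h lam 0 = 0"
  by (simp add: vq_cut wt_0 cut_0)

lemma tau_cut:
  assumes "i \<in> {1..r}"
  shows "tau r lam i \<beta> = cut r (lam + rho r - wt \<beta>) (i + 1) - cut r (lam + rho r - wt \<beta>) (i - 1)"
  using assms by (auto simp: tau_def form_diff_right form_omega)

text \<open>The value of $[E_i, F_i]$ on the weight space from which \<open>F i\<close> leads to weight $\lambda-\beta$.\<close>

definition efcomm :: "nat \<Rightarrow> complex \<Rightarrow> weight \<Rightarrow> nat \<Rightarrow> qroot \<Rightarrow> complex" where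
  "efcomm r h lam i \<beta> = (qpow h (form r (lam - wt \<beta>) (alpha i) + 2) -
     qpow h (- (form r (lam - wt \<beta>) (alpha i) + 2))) / qdiff h"

lemma efcomm_uminus: "efcomm r (- h) lam i \<beta> = efcomm r h lam i \<beta>"
proof -
  have "(b - a) / - d = (a - b) / d" for a b d :: complex
    by (metis minus_diff_eq minus_divide_divide)
  then show ?thesis by (simp only: efcomm_def qpow_uminus qdiff_uminus minus_minus)
qed

text \<open>Only the summands with index j and j - 1 see the j-th coordinate, and they change by
  factors q^2 and q^(-2). Taking out q^(-tau_j) leaves a q-number; pairing rho with alpha_j
  contributes the unit shift between its exponent and (lambda - beta|alpha_j) + 2.\<close>

lemma vq_diff:
  assumes j: "j \<in> {1..r}" and bj: "\<beta> j \<noteq> 0" and d: "qdiff h \<noteq> 0"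
  shows "vq r h lam \<beta> - vq r h lam (\<beta> - alpha j) = qpow h (- tau r lam j \<beta>) * efcomm r h lam j \<beta>"
proof -
  let ?y = "cut r (lam + rho r)" and ?b = "cut r (wt \<beta>)" and ?q = "qpow h"
  define c where "c k = cut r (lam + rho r - wt \<beta>) k" for k
  have b': "cut r (wt (\<beta> - alpha j)) k = ?b k - (if k = j then 1 else 0)" for k
    using bj j by (simp add: wt_diff_alpha cut_diff cut_alpha)
  \<comment> \<open>\<open>X i\<close> is the factor by which T_i^2 multiplies the exponential
    q^((lambda + rho - beta|phi)) of degree beta.\<close>
  define X where "X i = ?q (2 * (c i - c (i + 1)))" for i
  have X: "?q (2 * (?y i - ?y (i + 1))) * ?q (2 * (?b (i + 1) - ?b i) + s) = X i * ?q s" for i s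
    unfolding X_def qpow_add[symmetric] by (simp add: c_def cut_diff algebra_simps)
  have summand: "?q (2 * (?y i - ?y (i + 1))) * (1 - ?q (2 * (?b (i + 1) - ?b i)))
      - ?q (2 * (?y i - ?y (i + 1))) * (1 - ?q (2 * (cut r (wt (\<beta> - alpha j)) (i + 1) - cut r (wt (\<beta> - alpha j)) i)))
      = (if i = j then X j * (?q 2 - 1) else 0) + (if i = j - 1 then X (j - 1) * (?q (- 2) - 1) else 0)"
    (is "?l = _") for i
  proof -
    define s :: complex where "s = (if i = j then 2 else if i = j - 1 then - 2 else 0)"
    have s: "2 * (cut r (wt (\<beta> - alpha j)) (i + 1) - cut r (wt (\<beta> - alpha j)) i) = 2 * (?b (i + 1) - ?b i) + s"
      using j by (auto simp: b' s_def)
    have "?l = X i * (?q s - 1)"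
      unfolding s using X[of i s] X[of i 0] by (simp add: algebra_simps)
    then show ?thesis using j by (auto simp: s_def)
  qed
  have "form r (lam - wt \<beta>) (alpha j) + 1 = form r (lam + rho r - wt \<beta>) (alpha j)"
    using j by (simp add: form_diff form_add form_rho_alpha)
  also have "\<dots> = 2 * c j - c (j - 1) - c (j + 1)" using j by (simp add: form_alpha c_def)
  finally have f: "form r (lam - wt \<beta>) (alpha j) = 2 * c j - c (j - 1) - c (j + 1) - 1"
    by (simp add: algebra_simps)
  have t: "tau r lam j \<beta> = c (j + 1) - c (j - 1)" using j by (simp add: tau_cut c_def)
  have X1: "X j * ?q 1 = ?q (- tau r lam j \<beta>) * ?q (form r (lam - wt \<beta>) (alpha j) + 2)"
    unfolding X_def qpow_add[symmetric] f t by (simp add: algebra_simps)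
  have X2: "X (j - 1) * ?q (- 1) = ?q (- tau r lam j \<beta>) * ?q (- (form r (lam - wt \<beta>) (alpha j) + 2))"
    unfolding X_def qpow_add[symmetric] f t using j by (simp add: algebra_simps)
  have "vq r h lam \<beta> - vq r h lam (\<beta> - alpha j) = 1 / (qdiff h)\<^sup>2 *
      (\<Sum>i=0..r. (if i = j then X j * (?q 2 - 1) else 0) + (if i = j - 1 then X (j - 1) * (?q (- 2) - 1) else 0))"
    unfolding vq_cut summand[symmetric] sum_subtractf by (rule right_diff_distrib[symmetric])
  also have "\<dots> = 1 / (qdiff h)\<^sup>2 * (X j * (?q 2 - 1) + X (j - 1) * (?q (- 2) - 1))"
    using j by (auto simp: sum.distrib)
  also have "?q 2 - 1 = ?q 1 * qdiff h" by (simp add: qdiff_def right_diff_distrib flip: qpow_add)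
  also have "?q (- 2) - 1 = - (?q (- 1) * qdiff h)" by (simp add: qdiff_def right_diff_distrib flip: qpow_add)
  also have "1 / (qdiff h)\<^sup>2 * (X j * (?q 1 * qdiff h) + X (j - 1) * - (?q (- 1) * qdiff h))
      = (X j * ?q 1 - X (j - 1) * ?q (- 1)) / qdiff h"
    using d by (simp add: power2_eq_square field_simps)
  finally show ?thesis unfolding X1 X2 by (simp only: efcomm_def right_diff_distrib times_divide_eq_right)
qed

text \<open>The signed adjacency matrix of the oriented Dynkin diagram. Its antisymmetry is what
  lets two lowering steps be interchanged between the recursions at q and 1/q.\<close>

definition eps :: "nat \<Rightarrow> nat \<Rightarrow> complex" where
  "eps i j = (if j = i + 1 then 1 else if i = j + 1 then - 1 else 0)"

lemma eps_swap: "eps j i = - eps i j"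
  by (simp add: eps_def)

lemma tau_diff_alpha:
  assumes "i \<in> {1..r}" "j \<in> {1..r}" "\<beta> j \<noteq> 0"
  shows "tau r lam i (\<beta> - alpha j) = tau r lam i \<beta> + eps i j"
  using assms by (auto simp: tau_cut wt_diff_alpha cut_diff cut_alpha eps_def)

section \<open>Recursion for the partition function\<close>

text \<open>The last vertex is split off. The condition on the i-th coordinate keeps the predecessor
  a true difference, and the one-vertex path at 0 is the only one without a last step.\<close>

lemma paths_rec:
  assumes b: "\<beta> \<in> Qplus r"
  shows "paths r \<beta> = (if \<beta> = 0 then {[0]} else {}) \<union>
    (\<Union>i\<in>{i\<in>{1..r}. \<beta> i \<noteq> 0}. (\<lambda>p. p @ [\<beta>]) ` paths r (\<beta> - alpha i))"
proof (intro equalityI subsetI)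
  fix p assume p: "p \<in> paths r \<beta>"
  then obtain p' where p': "p = p' @ [\<beta>]"
    by (cases p rule: rev_cases) (auto simp: paths_def)
  show "p \<in> (if \<beta> = 0 then {[0]} else {}) \<union>
    (\<Union>i\<in>{i\<in>{1..r}. \<beta> i \<noteq> 0}. (\<lambda>p. p @ [\<beta>]) ` paths r (\<beta> - alpha i))"
  proof (cases "p' = []")
    case True
    then show ?thesis using p p' by (auto simp: paths_def)
  next
    case False
    have step: "\<exists>i\<in>{1..r}. p ! k = p ! (k - 1) + alpha i" if "k \<in> {1..<length p}" for k
      using p that by (auto simp: paths_def)
    have "length p' \<in> {1..<length p}" using False by (simp add: p' Suc_le_eq)
    moreover have "p ! length p' = \<beta>" "p ! (length p' - 1) = last p'"
      using False by (simp_all add: p' nth_append last_conv_nth)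
    ultimately obtain i where i: "i \<in> {1..r}" "\<beta> = last p' + alpha i"
      using step by metis
    have "p' \<in> paths r (\<beta> - alpha i)"
      unfolding paths_def
    proof (intro CollectI conjI ballI)
      show "last p' = \<beta> - alpha i" using i by (simp add: add_alpha_diff)
      show "\<exists>i\<in>{1..r}. p' ! k = p' ! (k - 1) + alpha i" if "k \<in> {1..<length p'}" for k
        using step[of k] that by (auto simp: p' nth_append split: if_splits)
    qed (use p False p' in \<open>auto simp: paths_def\<close>)
    moreover have "\<beta> i \<noteq> 0" using i by simp
    ultimately show ?thesis using p' i by blast
  qed
next
  fix p assume "p \<in> (if \<beta> = 0 then {[0]} else {}) \<union>
    (\<Union>i\<in>{i\<in>{1..r}. \<beta> i \<noteq> 0}. (\<lambda>p. p @ [\<beta>]) ` paths r (\<beta> - alpha i))"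
  then consider "\<beta> = 0" "p = [0]"
    | i p' where "i \<in> {1..r}" "\<beta> i \<noteq> 0" "p' \<in> paths r (\<beta> - alpha i)" "p = p' @ [\<beta>]"
    by (auto split: if_splits)
  then show "p \<in> paths r \<beta>"
  proof cases
    case 1
    then show ?thesis by (auto simp: paths_def Qplus_0)
  next
    case 2
    have "\<exists>i\<in>{1..r}. p ! k = p ! (k - 1) + alpha i" if k: "k \<in> {1..<length p}" for k
    proof (cases "k = length p'")
      case True
      then have "p ! k = \<beta>" "p ! (k - 1) = \<beta> - alpha i"
        using 2 k by (auto simp: nth_append paths_def last_conv_nth)
      then show ?thesis using 2 diff_alpha_add by metis
    next
      case False
      then have "p ! k = p' ! k" "p ! (k - 1) = p' ! (k - 1)" "k \<in> {1..<length p'}"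
        using 2 k by (auto simp: nth_append)
      then show ?thesis using 2 by (auto simp: paths_def)
    qed
    then show ?thesis using 2 b by (auto simp: paths_def)
  qed
qed

lemma finite_paths: "\<beta> \<in> Qplus r \<Longrightarrow> finite (paths r \<beta>)"
proof (induction rule: Qplus_induct)
  case (step \<beta>)
  have "finite (\<Union>i\<in>{i\<in>{1..r}. \<beta> i \<noteq> 0}. (\<lambda>p. p @ [\<beta>]) ` paths r (\<beta> - alpha i))"
    by (intro finite_UN_I finite_imageI step.IH) auto
  then show ?case unfolding paths_rec[OF step.hyps] by simp
qed

lemma Zpath_0: "Zpath r h lam 0 = 1"
  by (simp add: Zpath_def paths_rec[OF Qplus_0])

lemma Zpath_rec:
  assumes b: "\<beta> \<in> Qplus r" "\<beta> \<noteq> 0"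
  shows "Zpath r h lam \<beta> = (\<Sum>i\<in>{1..r}. 1 / step_weight r h lam i \<beta> * lower i (Zpath r h lam) \<beta>)"
proof -
  let ?w = "\<lambda>p. \<Prod>k\<in>{1..<length p}. 1 / step_weight r h lam (step_index r p k) (p ! k)"
  let ?S = "{i\<in>{1..r}. \<beta> i \<noteq> 0}"
  have w: "?w (p @ [\<beta>]) = 1 / step_weight r h lam i \<beta> * ?w p"
    if i: "i \<in> ?S" and p: "p \<in> paths r (\<beta> - alpha i)" for i p
  proof -
    have len: "length p \<ge> 1" and l: "p ! (length p - 1) = \<beta> - alpha i"
      using p by (auto simp: paths_def last_conv_nth Suc_le_eq)
    have lt: "length p - 1 < length p" using len by simp
    \<comment> \<open>\<open>step_index\<close> is a definite description; its value is unique
      because distinct simple roots are distinct functions.\<close>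
    have si: "step_index r (p @ [\<beta>]) (length p) = i"
      unfolding step_index_def
    proof (rule the_equality)
      show "i \<in> {1..r} \<and> (p @ [\<beta>]) ! length p = (p @ [\<beta>]) ! (length p - 1) + alpha i"
        using i l lt by (simp add: nth_append diff_alpha_add)
    next
      fix i' assume "i' \<in> {1..r} \<and> (p @ [\<beta>]) ! length p = (p @ [\<beta>]) ! (length p - 1) + alpha i'"
      then have "\<beta> - alpha i + alpha i' = \<beta> - alpha i + alpha i"
        using l lt i by (simp add: nth_append diff_alpha_add)
      then show "i' = i" by (intro alpha_inj) simp
    qed
    have "?w (p @ [\<beta>]) = (\<Prod>k\<in>insert (length p) {1..<length p}.
        1 / step_weight r h lam (step_index r (p @ [\<beta>]) k) ((p @ [\<beta>]) ! k))"
      using len by (intro prod.cong) auto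
    also have "\<dots> = 1 / step_weight r h lam i \<beta> * (\<Prod>k\<in>{1..<length p}.
        1 / step_weight r h lam (step_index r (p @ [\<beta>]) k) ((p @ [\<beta>]) ! k))"
      by (simp add: si)
    also have "(\<Prod>k\<in>{1..<length p}. 1 / step_weight r h lam (step_index r (p @ [\<beta>]) k) ((p @ [\<beta>]) ! k)) = ?w p"
      by (rule prod.cong) (auto simp: step_index_def nth_append)
    finally show ?thesis .
  qed
  have "Zpath r h lam \<beta> = (\<Sum>p\<in>(\<Union>i\<in>?S. (\<lambda>p. p @ [\<beta>]) ` paths r (\<beta> - alpha i)). ?w p)"
    unfolding Zpath_def using b by (subst paths_rec) auto
  also have "\<dots> = (\<Sum>i\<in>?S. \<Sum>p\<in>(\<lambda>p. p @ [\<beta>]) ` paths r (\<beta> - alpha i). ?w p)"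
  proof (rule sum.UNION_disjoint)
    show "\<forall>i\<in>?S. finite ((\<lambda>p. p @ [\<beta>]) ` paths r (\<beta> - alpha i))"
      using b by (auto intro!: finite_paths Qplus_diff_alpha)
    \<comment> \<open>A path records its endpoint, so the removed simple root can be recovered from
      the shortened path.\<close>
    have "i = j" if "i \<in> ?S" "j \<in> ?S" "p \<in> paths r (\<beta> - alpha i)" "p \<in> paths r (\<beta> - alpha j)" for i j p
    proof -
      have "\<beta> - alpha i = \<beta> - alpha j" using that by (auto simp: paths_def)
      then have "(\<beta> - alpha i) i = (\<beta> - alpha j) i" by metis
      then show ?thesis using that by (auto simp: alpha_def split: if_splits)
    qed
    then show "\<forall>i\<in>?S. \<forall>j\<in>?S. i \<noteq> j \<longrightarrow>
      (\<lambda>p. p @ [\<beta>]) ` paths r (\<beta> - alpha i) \<inter> (\<lambda>p. p @ [\<beta>]) ` paths r (\<beta> - alpha j) = {}"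
      by blast
  qed simp
  also have "\<dots> = (\<Sum>i\<in>?S. \<Sum>p\<in>paths r (\<beta> - alpha i). ?w (p @ [\<beta>]))"
    by (subst sum.reindex) (auto intro: inj_onI)
  also have "\<dots> = (\<Sum>i\<in>?S. 1 / step_weight r h lam i \<beta> * lower i (Zpath r h lam) \<beta>)"
  proof (rule sum.cong[OF refl])
    fix i assume i: "i \<in> ?S"
    have "(\<Sum>p\<in>paths r (\<beta> - alpha i). ?w (p @ [\<beta>]))
        = (\<Sum>p\<in>paths r (\<beta> - alpha i). 1 / step_weight r h lam i \<beta> * ?w p)"
      by (rule sum.cong[OF refl w[OF i]])
    then show "(\<Sum>p\<in>paths r (\<beta> - alpha i). ?w (p @ [\<beta>])) = 1 / step_weight r h lam i \<beta> * lower i (Zpath r h lam) \<beta>"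
      using i by (simp add: Zpath_def lower_def sum_distrib_left)
  qed
  also have "\<dots> = (\<Sum>i\<in>{1..r}. 1 / step_weight r h lam i \<beta> * lower i (Zpath r h lam) \<beta>)"
    by (rule sum.mono_neutral_left) (auto simp: lower_def)
  finally show ?thesis .
qed

text \<open>With denominators cleared the recursion also holds in degree 0, where both sides vanish
  because v_q(0) = 0. It thus becomes a linear equation in all degrees, with Z_0 = 1 as a separate
  normalisation.\<close>

lemma vq_Zpath:
  assumes b: "\<beta> \<in> Qplus r" and v: "\<beta> \<noteq> 0 \<Longrightarrow> vq r h lam \<beta> \<noteq> 0"
  shows "vq r h lam \<beta> * Zpath r h lam \<beta>
     = (\<Sum>i\<in>{1..r}. qpow h (- tau r lam i \<beta>) * lower i (Zpath r h lam) \<beta>)"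
proof (cases "\<beta> = 0")
  case False
  have "vq r h lam \<beta> * (1 / step_weight r h lam i \<beta> * x) = qpow h (- tau r lam i \<beta>) * x" for i x
  proof -
    have "qpow h (- tau r lam i \<beta>) = 1 / qpow h (tau r lam i \<beta>)"
      by (simp add: qpow_def exp_minus field_simps)
    then show ?thesis using v[OF False] by (simp add: step_weight_def)
  qed
  then show ?thesis unfolding Zpath_rec[OF b False] sum_distrib_left by simp
qed (simp add: vq_0)

text \<open>
  The path recursions for \<open>q\<close> and $q^{-1}$ are the kernels of two commuting operators, and each
  recursion determines its solution up to normalisation; hence both partition functions agree.
\<close>

definition path_op :: "nat \<Rightarrow> complex \<Rightarrow> weight \<Rightarrow> (qroot \<Rightarrow> complex) \<Rightarrow> qroot \<Rightarrow> complex" where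
  "path_op r h lam f \<beta> = vq r h lam \<beta> * f \<beta> - (\<Sum>i\<in>{1..r}. qpow h (- tau r lam i \<beta>) * lower i f \<beta>)"

text \<open>The product is sorted by the number of lowerings, so that a commutator can be compared
  order by order; independent parameters make both orders of composition instances of one
  formula.\<close>

lemma path_op_path_op:
  "path_op r h lam (path_op r k lam f) \<beta> = vq r h lam \<beta> * vq r k lam \<beta> * f \<beta>
    - (\<Sum>i\<in>{1..r}. (vq r h lam \<beta> * qpow k (- tau r lam i \<beta>)
        + qpow h (- tau r lam i \<beta>) * vq r k lam (\<beta> - alpha i)) * lower i f \<beta>)
    + (\<Sum>i\<in>{1..r}. \<Sum>j\<in>{1..r}. qpow h (- tau r lam i \<beta>) * qpow k (- tau r lam j (\<beta> - alpha i))
        * lower i (lower j f) \<beta>)"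
proof -
  have "lower i (path_op r k lam f) \<beta> = vq r k lam (\<beta> - alpha i) * lower i f \<beta>
     - (\<Sum>j\<in>{1..r}. qpow k (- tau r lam j (\<beta> - alpha i)) * lower i (lower j f) \<beta>)" for i
  proof -
    have "path_op r k lam f = (\<lambda>\<gamma>. vq r k lam \<gamma> * f \<gamma> - (\<Sum>j\<in>{1..r}. qpow k (- tau r lam j \<gamma>) * lower j f \<gamma>))"
      by (rule ext) (simp add: path_op_def)
    then show ?thesis by (simp only: lower_diff lower_sum lower_mult)
  qed
  then have "path_op r h lam (path_op r k lam f) \<beta> = vq r h lam \<beta> *
      (vq r k lam \<beta> * f \<beta> - (\<Sum>i\<in>{1..r}. qpow k (- tau r lam i \<beta>) * lower i f \<beta>))
    - (\<Sum>i\<in>{1..r}. qpow h (- tau r lam i \<beta>) * (vq r k lam (\<beta> - alpha i) * lower i f \<beta>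
     - (\<Sum>j\<in>{1..r}. qpow k (- tau r lam j (\<beta> - alpha i)) * lower i (lower j f) \<beta>)))"
    by (simp only: path_op_def[of r h] path_op_def[of r k lam f \<beta>])
  then show ?thesis
    by (simp add: right_diff_distrib distrib_right sum_subtractf sum.distrib sum_distrib_left mult.assoc)
qed

text \<open>With one lowering, substitute \<open>vq_diff\<close> at q and at 1/q: the same
  \<open>efcomm\<close> appears, with reciprocal prefactors, and the two sides become equal. With
  two lowerings, exchange i and j; the shifts of tau agree because \<open>eps\<close> is
  antisymmetric.\<close>

lemma path_op_commute:
  assumes d: "qdiff h \<noteq> 0"
  shows "path_op r h lam (path_op r (- h) lam f) \<beta> = path_op r (- h) lam (path_op r h lam f) \<beta>"
proof -
  have 1: "(vq r h lam \<beta> * qpow (- h) (- tau r lam i \<beta>)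
        + qpow h (- tau r lam i \<beta>) * vq r (- h) lam (\<beta> - alpha i)) * lower i f \<beta>
      = (vq r (- h) lam \<beta> * qpow h (- tau r lam i \<beta>)
        + qpow (- h) (- tau r lam i \<beta>) * vq r h lam (\<beta> - alpha i)) * lower i f \<beta>"
    if i: "i \<in> {1..r}" for i
  proof (cases "\<beta> i = 0")
    case False
    define t where "t = qpow h (tau r lam i \<beta>)"
    define t' where "t' = qpow h (- tau r lam i \<beta>)"
    have tt: "t * t' = 1" by (simp add: t_def t'_def flip: qpow_add)
    have a: "vq r h lam \<beta> = vq r h lam (\<beta> - alpha i) + t' * efcomm r h lam i \<beta>"
      using vq_diff[of i r \<beta> h lam] i False d by (simp add: t'_def algebra_simps)
    have b: "vq r (- h) lam \<beta> = vq r (- h) lam (\<beta> - alpha i) + t * efcomm r h lam i \<beta>"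
      using vq_diff[of i r \<beta> "- h" lam] i False d by (simp add: t_def qpow_uminus qdiff_uminus efcomm_uminus algebra_simps)
    show ?thesis
      unfolding a b qpow_uminus minus_minus t_def[symmetric] t'_def[symmetric]
      by (simp add: algebra_simps)
  qed (simp add: lower_def)
  have 2: "qpow h (- tau r lam i \<beta>) * qpow (- h) (- tau r lam j (\<beta> - alpha i)) * lower i (lower j f) \<beta>
    = qpow (- h) (- tau r lam j \<beta>) * qpow h (- tau r lam i (\<beta> - alpha j)) * lower j (lower i f) \<beta>"
    if ij: "i \<in> {1..r}" "j \<in> {1..r}" for i j
  proof (cases "\<beta> i = 0 \<or> \<beta> j = 0")
    case True
    then have "lower i (lower j f) \<beta> = 0" by (auto simp: lower_def alpha_def)
    then show ?thesis by (simp add: lower_commute[of j])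
  next
    case False
    then show ?thesis
      using ij by (simp add: lower_commute[of j] tau_diff_alpha qpow_uminus eps_swap[of j] flip: qpow_add)
        (simp add: algebra_simps)
  qed
  have "(\<Sum>i\<in>{1..r}. \<Sum>j\<in>{1..r}. qpow h (- tau r lam i \<beta>) * qpow (- h) (- tau r lam j (\<beta> - alpha i))
        * lower i (lower j f) \<beta>)
     = (\<Sum>i\<in>{1..r}. \<Sum>j\<in>{1..r}. qpow (- h) (- tau r lam j \<beta>) * qpow h (- tau r lam i (\<beta> - alpha j))
        * lower j (lower i f) \<beta>)"
    using 2 by (intro sum.cong refl)
  also have "\<dots> = (\<Sum>i\<in>{1..r}. \<Sum>j\<in>{1..r}. qpow (- h) (- tau r lam i \<beta>) * qpow h (- tau r lam j (\<beta> - alpha i))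
        * lower i (lower j f) \<beta>)"
    by (rule sum.swap)
  finally have S2: "(\<Sum>i\<in>{1..r}. \<Sum>j\<in>{1..r}. qpow h (- tau r lam i \<beta>) * qpow (- h) (- tau r lam j (\<beta> - alpha i))
        * lower i (lower j f) \<beta>)
    = (\<Sum>i\<in>{1..r}. \<Sum>j\<in>{1..r}. qpow (- h) (- tau r lam i \<beta>) * qpow h (- tau r lam j (\<beta> - alpha i))
        * lower i (lower j f) \<beta>)" .
  have S1: "(\<Sum>i\<in>{1..r}. (vq r h lam \<beta> * qpow (- h) (- tau r lam i \<beta>)
        + qpow h (- tau r lam i \<beta>) * vq r (- h) lam (\<beta> - alpha i)) * lower i f \<beta>)
      = (\<Sum>i\<in>{1..r}. (vq r (- h) lam \<beta> * qpow h (- tau r lam i \<beta>)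
        + qpow (- h) (- tau r lam i \<beta>) * vq r h lam (\<beta> - alpha i)) * lower i f \<beta>)"
    by (rule sum.cong[OF refl 1])
  show ?thesis
    unfolding path_op_path_op S1 S2 by (simp only: mult.commute[of "vq r h lam \<beta>"])
qed

lemma path_op_unique:
  assumes "\<beta> \<in> Qplus r" "f 0 = 0"
    and v: "\<And>\<beta>. \<beta> \<in> Qplus r \<Longrightarrow> \<beta> \<noteq> 0 \<Longrightarrow> vq r h lam \<beta> \<noteq> 0"
    and f: "\<And>\<beta>. \<beta> \<in> Qplus r \<Longrightarrow> path_op r h lam f \<beta> = 0"
  shows "f \<beta> = 0"
  using assms(1)
proof (induction rule: Qplus_induct)
  case (step \<beta>)
  have "lower i f \<beta> = 0" if "i \<in> {1..r}" for i
    using step.IH[OF that] by (rule lower_eq_0)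
  then have "vq r h lam \<beta> * f \<beta> = 0" using f[OF step.hyps] by (simp add: path_op_def)
  then show ?case using v[OF step.hyps] assms(2) mult_eq_0_iff by metis
qed

lemma Zpath_uminus:
  assumes d: "qdiff h \<noteq> 0"
    and v: "\<And>\<beta>. \<beta> \<in> Qplus r \<Longrightarrow> \<beta> \<noteq> 0 \<Longrightarrow> vq r h lam \<beta> \<noteq> 0"
    and v': "\<And>\<beta>. \<beta> \<in> Qplus r \<Longrightarrow> \<beta> \<noteq> 0 \<Longrightarrow> vq r (- h) lam \<beta> \<noteq> 0"
    and b: "\<beta> \<in> Qplus r"
  shows "Zpath r (- h) lam \<beta> = Zpath r h lam \<beta>"
proof -
  let ?Z = "Zpath r h lam" and ?Z' = "Zpath r (- h) lam"
  have Z: "path_op r h lam ?Z \<beta> = 0" if "\<beta> \<in> Qplus r" for \<beta>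
    using vq_Zpath[OF that v[OF that]] by (simp add: path_op_def)
  have Z': "path_op r (- h) lam ?Z' \<beta> = 0" if "\<beta> \<in> Qplus r" for \<beta>
    using vq_Zpath[OF that v'[OF that]] by (simp add: path_op_def)
  have "path_op r h lam (path_op r (- h) lam ?Z) \<beta> = 0" if "\<beta> \<in> Qplus r" for \<beta>
    unfolding path_op_commute[OF d]
    using that lower_eq_0[of \<beta> _ "path_op r h lam ?Z", OF Z[OF Qplus_diff_alpha[OF that]]]
    by (simp add: path_op_def[of r "- h"] Z)
  \<comment> \<open>In degree 0 the function vanishes since v(0) = 0 and nothing can be lowered, so
    uniqueness forces it to be zero in every degree.\<close>
  then have ZZ: "path_op r (- h) lam ?Z \<beta> = 0" if "\<beta> \<in> Qplus r" for \<beta>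
    using path_op_unique[OF that, of "path_op r (- h) lam ?Z" h lam] v
    by (simp add: path_op_def[of r "- h" lam _ 0] vq_0)
  have "?Z' \<beta> - ?Z \<beta> = 0"
  proof (rule path_op_unique[OF b, of "\<lambda>\<beta>. ?Z' \<beta> - ?Z \<beta>" "- h" lam])
    show "path_op r (- h) lam (\<lambda>\<beta>. ?Z' \<beta> - ?Z \<beta>) \<beta> = 0" if "\<beta> \<in> Qplus r" for \<beta>
      using Z'[OF that] ZZ[OF that]
      by (simp add: path_op_def lower_diff right_diff_distrib sum_subtractf)
  qed (use v' in \<open>auto simp: Zpath_0\<close>)
  then show ?thesis by simp
qed

section \<open>Weight vectors in the Verma module\<close>

lemma form_alpha_alpha:
  assumes "i \<in> {1..r}" "j \<in> {1..r}"
  shows "form r (alpha i) (alpha j) = of_int (cartan i j)"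
  using assms by (auto simp: form_alpha cut_alpha cartan_def)

text \<open>Elements of the free algebra represent vectors; congruence modulo \<open>ket_ideal\<close> is equality
  in the Verma module, and \<open>wv \<delta> x\<close> says that \<open>x\<close> represents a vector of weight $\lambda-\delta$.\<close>

locale verma_rep =
  fixes r :: nat and h :: complex and lam :: weight
begin

abbreviation I :: "free_alg set" where "I \<equiv> ket_ideal r h lam"

definition cg :: "free_alg \<Rightarrow> free_alg \<Rightarrow> bool" (infix \<open>\<approx>\<close> 50) where
  "x \<approx> y \<longleftrightarrow> x - y \<in> I"

definition ev :: "weight \<Rightarrow> nat \<Rightarrow> complex" where
  "ev \<delta> i = qpow h (form r (lam - \<delta>) (alpha i))"

definition wv :: "weight \<Rightarrow> free_alg \<Rightarrow> bool" where
  "wv \<delta> x \<longleftrightarrow> (\<forall>i\<in>{1..r}. K i * x \<approx> scal (ev \<delta> i) * x)"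

lemmas ID = left_idealD[OF ket_ideal_left[of r h lam]]

lemma cg_refl [simp]: "x \<approx> x" by (simp add: cg_def ID)

lemma cg_sym: "x \<approx> y \<Longrightarrow> y \<approx> x"
  using ID(4)[of "x - y"] by (simp add: cg_def)

lemma cg_trans [trans]: "x \<approx> y \<Longrightarrow> y \<approx> z \<Longrightarrow> x \<approx> z"
  using ID(2)[of "x - y" "y - z"] by (simp add: cg_def)

lemma cg_eq_trans [trans]: "x \<approx> y \<Longrightarrow> y = z \<Longrightarrow> x \<approx> z" by simp

lemma eq_cg_trans [trans]: "x = y \<Longrightarrow> y \<approx> z \<Longrightarrow> x \<approx> z" by simp

lemma cg_add: "x \<approx> y \<Longrightarrow> x' \<approx> y' \<Longrightarrow> x + x' \<approx> y + y'"
  using ID(2)[of "x - y" "x' - y'"] by (simp add: cg_def algebra_simps)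

lemma cg_diff: "x \<approx> y \<Longrightarrow> x' \<approx> y' \<Longrightarrow> x - x' \<approx> y - y'"
  using ID(5)[of "x - y" "x' - y'"] by (simp add: cg_def algebra_simps)

lemma cg_mult: "x \<approx> y \<Longrightarrow> a * x \<approx> a * y"
  using ID(3)[of "x - y" a] by (simp add: cg_def right_diff_distrib)

lemma cg_sum: "(\<And>k. k \<in> S \<Longrightarrow> f k \<approx> g k) \<Longrightarrow> sum f S \<approx> sum g S"
  using left_ideal_sum[OF ket_ideal_left, of S "\<lambda>k. f k - g k"] by (simp add: cg_def sum_subtractf)

lemma cg_0: "x \<approx> 0 \<longleftrightarrow> x \<in> I" by (simp add: cg_def)

lemma cg_ideal: "x \<approx> y \<Longrightarrow> x \<in> I \<longleftrightarrow> y \<in> I"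
  using cg_0 cg_sym cg_trans by blast

lemma scal_cancel:
  assumes "scal c * x \<approx> scal c * y" "c \<noteq> 0"
  shows "x \<approx> y"
  using cg_mult[OF assms(1), of "scal (1 / c)"] assms(2) by (simp add: scal_scal)

text \<open>Relations of U_q may be applied in front of any vector because \<open>uq_ideal\<close>
  is two-sided; the ideal \<open>I\<close> is only known to absorb multiplication from the
  left.\<close>

lemma uq_cg: "u - v \<in> uq_ideal r h \<Longrightarrow> u * x \<approx> v * x"
  using uqD(6)[of "u - v" r h x] uq_ideal_ket by (auto simp: cg_def left_diff_distrib)

lemma uq_in: "u \<in> uq_ideal r h \<Longrightarrow> u * x \<in> I"
  using uqD(6)[of u r h x] uq_ideal_ket by auto

lemma KF: "i \<in> {1..r} \<Longrightarrow> j \<in> {1..r} \<Longrightarrow>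
    K i * (F j * x) \<approx> scal (qpow h (- of_int (cartan j i))) * (F j * (K i * x))"
  using uq_cg[OF uq_rels(6), of i j x] by (simp add: mult.assoc)

lemma KE: "i \<in> {1..r} \<Longrightarrow> j \<in> {1..r} \<Longrightarrow>
    K i * (E j * x) \<approx> scal (qpow h (of_int (cartan j i))) * (E j * (K i * x))"
  using uq_cg[OF uq_rels(5), of i j x] by (simp add: mult.assoc)

lemma KinvF: "i \<in> {1..r} \<Longrightarrow> j \<in> {1..r} \<Longrightarrow>
    Kinv i * (F j * x) \<approx> scal (qpow h (of_int (cartan j i))) * (F j * (Kinv i * x))"
  using uq_cg[OF uq_Kinv(2), of i j x] by (simp add: mult.assoc)

lemma KinvK: "i \<in> {1..r} \<Longrightarrow> Kinv i * (K i * x) \<approx> x"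
  using uq_cg[OF uq_rels(2), of i i x] by (simp add: mult.assoc)

lemma EF: "i \<in> {1..r} \<Longrightarrow> j \<in> {1..r} \<Longrightarrow>
    E i * (F j * x) \<approx> F j * (E i * x) + (if i = j then scal (1 / qdiff h) * (K i * x - Kinv i * x) else 0)"
proof -
  assume ij: "i \<in> {1..r}" "j \<in> {1..r}"
  have "E i * F j - (F j * E i + (if i = j then scal (1 / qdiff h) * (K i - Kinv i) else 0)) \<in> uq_ideal r h"
    using uq_rels(4)[OF ij, of h] by (simp add: diff_diff_add)
  from uq_cg[OF this, of x] show ?thesis
    by (cases "i = j") (simp_all add: distrib_right left_diff_distrib mult.assoc)
qed

lemma wvD: "wv \<delta> x \<Longrightarrow> i \<in> {1..r} \<Longrightarrow> K i * x \<approx> scal (ev \<delta> i) * x"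
  by (simp add: wv_def)

lemma wv_ideal: "x \<in> I \<Longrightarrow> wv \<delta> x"
  by (simp add: wv_def cg_def ID)

lemma wv_cong: "x \<approx> y \<Longrightarrow> wv \<delta> y \<Longrightarrow> wv \<delta> x"
  unfolding wv_def using cg_mult cg_sym cg_trans by meson

lemma wv_add:
  assumes "wv \<delta> x" "wv \<delta> y"
  shows "wv \<delta> (x + y)"
  unfolding wv_def
proof
  fix i assume i: "i \<in> {1..r}"
  show "K i * (x + y) \<approx> scal (ev \<delta> i) * (x + y)"
    using cg_add[OF wvD[OF assms(1) i] wvD[OF assms(2) i]] by (simp add: distrib_left)
qed

lemma wv_scal:
  assumes "wv \<delta> x"
  shows "wv \<delta> (scal c * x)"
  unfolding wv_def
proof
  fix i assume i: "i \<in> {1..r}"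
  show "K i * (scal c * x) \<approx> scal (ev \<delta> i) * (scal c * x)"
    using cg_mult[OF wvD[OF assms i], of "scal c"] by (simp add: scal_gen_comm scal_scal mult.commute)
qed

lemma wv_diff: "wv \<delta> x \<Longrightarrow> wv \<delta> y \<Longrightarrow> wv \<delta> (x - y)"
  using wv_add[of \<delta> x "scal (- 1) * y"] wv_scal[of \<delta> y "- 1"] by (simp add: scal_minus)

lemma wv_sum: "(\<And>k. k \<in> S \<Longrightarrow> wv \<delta> (f k)) \<Longrightarrow> wv \<delta> (sum f S)"
  by (induction S rule: infinite_finite_induct) (simp_all add: wv_add wv_ideal ID)

lemma wv_1: "wv 0 1"
  by (simp add: wv_def cg_def ev_def ket_K del: atLeastAtMost_iff)

lemma wv_Kinv:
  assumes "wv \<delta> x" "i \<in> {1..r}"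
  shows "Kinv i * x \<approx> scal (1 / ev \<delta> i) * x"
proof -
  have "ev \<delta> i \<noteq> 0" by (simp add: ev_def)
  then have "Kinv i * x = scal (1 / ev \<delta> i) * (Kinv i * (scal (ev \<delta> i) * x))"
    by (simp add: scal_gen_comm scal_scal)
  also have "\<dots> \<approx> scal (1 / ev \<delta> i) * (Kinv i * (K i * x))"
    by (intro cg_mult cg_sym[OF wvD] assms)
  also have "\<dots> \<approx> scal (1 / ev \<delta> i) * x" by (intro cg_mult KinvK assms)
  finally show ?thesis .
qed

lemma wv_F:
  assumes "wv \<delta> x" "j \<in> {1..r}"
  shows "wv (\<delta> + alpha j) (F j * x)"
  unfolding wv_def
proof
  fix i assume i: "i \<in> {1..r}"
  have "K i * (F j * x) \<approx> scal (qpow h (- of_int (cartan j i))) * (F j * (K i * x))"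
    by (rule KF[OF i assms(2)])
  also have "\<dots> \<approx> scal (qpow h (- of_int (cartan j i))) * (F j * (scal (ev \<delta> i) * x))"
    by (intro cg_mult wvD assms i)
  also have "\<dots> = scal (ev (\<delta> + alpha j) i) * (F j * x)"
    unfolding scal_gen_comm scal_scal ev_def qpow_add[symmetric]
    using form_alpha_alpha[OF assms(2) i] by (simp add: form_diff form_add algebra_simps)
  finally show "K i * (F j * x) \<approx> scal (ev (\<delta> + alpha j) i) * (F j * x)" .
qed

lemma wv_E:
  assumes "wv \<delta> x" "j \<in> {1..r}"
  shows "wv (\<delta> - alpha j) (E j * x)"
  unfolding wv_def
proof
  fix i assume i: "i \<in> {1..r}"
  have "K i * (E j * x) \<approx> scal (qpow h (of_int (cartan j i))) * (E j * (K i * x))"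
    by (rule KE[OF i assms(2)])
  also have "\<dots> \<approx> scal (qpow h (of_int (cartan j i))) * (E j * (scal (ev \<delta> i) * x))"
    by (intro cg_mult wvD assms i)
  also have "\<dots> = scal (ev (\<delta> - alpha j) i) * (E j * x)"
    unfolding scal_gen_comm scal_scal ev_def qpow_add[symmetric]
    using form_alpha_alpha[OF assms(2) i] by (simp add: form_diff form_add algebra_simps)
  finally show "K i * (E j * x) \<approx> scal (ev (\<delta> - alpha j) i) * (E j * x)" .
qed

lemma wv_K_power:
  assumes "wv \<delta> x" "i \<in> {1..r}"
  shows "K i ^ n * x \<approx> scal (ev \<delta> i ^ n) * x"
proof (induction n)
  case (Suc n)
  have "K i ^ Suc n * x = K i * (K i ^ n * x)" by (simp add: mult.assoc)
  also have "\<dots> \<approx> K i * (scal (ev \<delta> i ^ n) * x)" by (intro cg_mult Suc)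
  also have "\<dots> = scal (ev \<delta> i ^ n) * (K i * x)" by (rule scal_gen_comm)
  also have "\<dots> \<approx> scal (ev \<delta> i ^ n) * (scal (ev \<delta> i) * x)" by (intro cg_mult wvD assms)
  also have "\<dots> = scal (ev \<delta> i ^ Suc n) * x" by (simp add: scal_scal mult.commute)
  finally show ?case .
qed simp

subsection \<open>Sums of weight vectors\<close>

text \<open>Lists are used because independence of the weight spaces is not yet known: summands may
  repeat a weight, and different weights may still have equal eigenvalues.\<close>

definition wsum :: "weight set \<Rightarrow> free_alg set" where
  "wsum B = {y. \<exists>ds. (\<forall>d\<in>set ds. \<exists>\<delta>\<in>B. wv \<delta> d) \<and> y \<approx> sum_list ds}"

lemma wsum_ideal: "x \<in> I \<Longrightarrow> x \<in> wsum B"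
  unfolding wsum_def by (auto intro!: exI[of _ "[]"] simp: cg_0)

lemma wsum_wv: "wv \<delta> x \<Longrightarrow> \<delta> \<in> B \<Longrightarrow> x \<in> wsum B"
  unfolding wsum_def by (auto intro!: exI[of _ "[x]"])

lemma wsum_add:
  assumes "x \<in> wsum B" "y \<in> wsum B"
  shows "x + y \<in> wsum B"
proof -
  obtain ds es where "\<forall>d\<in>set ds. \<exists>\<delta>\<in>B. wv \<delta> d" "x \<approx> sum_list ds"
    "\<forall>d\<in>set es. \<exists>\<delta>\<in>B. wv \<delta> d" "y \<approx> sum_list es"
    using assms unfolding wsum_def by blast
  then show ?thesis
    unfolding wsum_def by (auto intro!: exI[of _ "ds @ es"] cg_add)
qed

lemma wsum_cong: "x \<approx> y \<Longrightarrow> y \<in> wsum B \<Longrightarrow> x \<in> wsum B"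
  unfolding wsum_def using cg_trans by blast

lemma wsum_mult:
  assumes "x \<in> wsum B" and "\<And>\<delta> d. \<delta> \<in> B \<Longrightarrow> wv \<delta> d \<Longrightarrow> a * d \<in> wsum B'"
  shows "a * x \<in> wsum B'"
proof -
  obtain ds where ds: "\<forall>d\<in>set ds. \<exists>\<delta>\<in>B. wv \<delta> d" and x: "x \<approx> sum_list ds"
    using assms(1) unfolding wsum_def by blast
  have "a * sum_list ds \<in> wsum B'"
    using ds by (induction ds) (auto simp: distrib_left wsum_ideal ID intro!: wsum_add assms(2))
  then show ?thesis using wsum_cong[OF cg_mult[OF x]] by blast
qed

lemma wsum_scal: "x \<in> wsum B \<Longrightarrow> scal c * x \<in> wsum B"
  by (erule wsum_mult) (blast intro: wsum_wv wv_scal)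

text \<open>Induction on the number of summands: an operator K_i minus the eigenvalue of one summand
  kills that summand and multiplies x by a nonzero scalar.\<close>

lemma wsum_separated:
  assumes "x \<in> wsum B" "wv \<delta> x"
    and sep: "\<And>\<gamma>. \<gamma> \<in> B \<Longrightarrow> \<exists>i\<in>{1..r}. ev \<delta> i \<noteq> ev \<gamma> i"
  shows "x \<in> I"
proof -
  obtain ds where "\<forall>d\<in>set ds. \<exists>\<delta>\<in>B. wv \<delta> d" "x \<approx> sum_list ds"
    using assms(1) unfolding wsum_def by blast
  then show ?thesis
    using assms(2)
  proof (induction "length ds" arbitrary: ds x)
    case 0
    then show ?case by (simp add: cg_0)
  next
    case (Suc n)
    then obtain d es where ds: "ds = d # es" and n: "n = length es" by (cases ds) auto
    obtain \<gamma> where g: "\<gamma> \<in> B" "wv \<gamma> d" using Suc.prems ds by auto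
    obtain i where i: "i \<in> {1..r}" "ev \<delta> i \<noteq> ev \<gamma> i" using sep[OF g(1)] by blast
    let ?A = "K i - scal (ev \<gamma> i)"
    have A: "?A * y \<approx> scal (ev \<eta> i - ev \<gamma> i) * y" if "wv \<eta> y" for \<eta> y
      using cg_diff[OF wvD[OF that i(1)] cg_refl[of "scal (ev \<gamma> i) * y"]]
      by (simp add: left_diff_distrib scal_diff)
    have "?A * x \<approx> ?A * sum_list ds" by (intro cg_mult Suc.prems)
    also have "\<dots> = ?A * d + sum_list (map ((*) ?A) es)"
      by (simp add: ds distrib_left sum_list_const_mult)
    also have "\<dots> \<approx> 0 + sum_list (map ((*) ?A) es)"
      using A[OF g(2)] by (intro cg_add cg_refl) simp
    finally have "?A * x \<approx> sum_list (map ((*) ?A) es)" by simp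
    moreover have "\<exists>\<eta>\<in>B. wv \<eta> d'" if d': "d' \<in> set (map ((*) ?A) es)" for d'
    proof -
      obtain y \<eta> where "d' = ?A * y" "\<eta> \<in> B" "wv \<eta> y" using d' Suc.prems(1) ds by auto
      then show ?thesis using wv_cong[OF A wv_scal] by blast
    qed
    moreover have "wv \<delta> (?A * x)" by (rule wv_cong[OF A[OF Suc.prems(3)] wv_scal[OF Suc.prems(3)]])
    ultimately have "?A * x \<in> I" using Suc.hyps(1)[of "map ((*) ?A) es" "?A * x"] n by auto
    then have z: "scal (ev \<delta> i - ev \<gamma> i) * x \<approx> scal (ev \<delta> i - ev \<gamma> i) * 0"
      using cg_ideal[OF A[OF Suc.prems(3)]] by (simp add: cg_0)
    then show ?case using scal_cancel[OF z] i(2) by (simp add: cg_0)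
  qed
qed

text \<open>For a singular weight vector \<open>a\<close> this span is stable under all generators, hence is the
  submodule generated by \<open>a\<close>.\<close>

inductive_set low :: "free_alg \<Rightarrow> free_alg set" for a where
  base: "a \<in> low a"
| F: "x \<in> low a \<Longrightarrow> i \<in> {1..r} \<Longrightarrow> F i * x \<in> low a"
| add: "x \<in> low a \<Longrightarrow> y \<in> low a \<Longrightarrow> x + y \<in> low a"
| scal: "x \<in> low a \<Longrightarrow> scal c * x \<in> low a"
| ideal: "x \<in> I \<Longrightarrow> x \<in> low a"

lemma low_cong: "x \<approx> y \<Longrightarrow> y \<in> low a \<Longrightarrow> x \<in> low a"
  using low.add[of "x - y" a y] low.ideal[of "x - y" a] by (simp add: cg_def)

lemma low_diff: "x \<in> low a \<Longrightarrow> y \<in> low a \<Longrightarrow> x - y \<in> low a"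
  using low.add[OF _ low.scal[of y a "- 1"], of x] by (simp add: scal_minus)

text \<open>Moving E past F leaves terms with K and its inverse, so the three stability statements
  have to be proved in one induction.\<close>

lemma low_gens:
  assumes E: "\<And>i. i \<in> {1..r} \<Longrightarrow> E i * a \<in> I" and wv: "wv \<beta> a" and x: "x \<in> low a" and j: "j \<in> {1..r}"
  shows "E j * x \<in> low a \<and> K j * x \<in> low a \<and> Kinv j * x \<in> low a"
  using x
proof induction
  case base
  show ?case using low.ideal[OF E[OF j]] low_cong[OF wvD[OF wv j]] low_cong[OF wv_Kinv[OF wv j]]
      low.scal[OF low.base] by blast
next
  case (F x i)
  have "E j * (F i * x) \<in> low a"
    using F by (intro low_cong[OF EF[OF j]]) (auto intro!: low.add low.F low.scal low_diff)
  moreover have "K j * (F i * x) \<in> low a"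
    using F by (intro low_cong[OF KF[OF j]]) (auto intro!: low.F low.scal)
  moreover have "Kinv j * (F i * x) \<in> low a"
    using F by (intro low_cong[OF KinvF[OF j]]) (auto intro!: low.F low.scal)
  ultimately show ?case by blast
next
  case (add x y)
  then show ?case by (simp add: distrib_left low.add)
next
  case (scal x c)
  then show ?case by (simp add: scal_gen_comm low.scal)
next
  case (ideal x)
  then show ?case by (auto intro: low.ideal ID)
qed

lemma low_submodule:
  assumes E: "\<And>i. i \<in> {1..r} \<Longrightarrow> E i * a \<in> I" and wv: "wv \<beta> a"
  shows "u * a \<in> low a"
proof (rule left_mult_closed[OF low.add low.scal _ low.base])
  fix g x assume x: "x \<in> low a"
  show "gen g * x \<in> low a"
  proof (cases g)
    case (GenE i)
    then show ?thesis
      using low_gens[OF E wv x, of i] low.ideal[OF uq_in[OF uq_out(1), of i x]] by (cases "i \<in> {1..r}") auto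
  next
    case (GenF i)
    then show ?thesis
      using low.F[OF x, of i] low.ideal[OF uq_in[OF uq_out(2), of i x]] by (cases "i \<in> {1..r}") auto
  next
    case (GenK i)
    then show ?thesis
      using low_gens[OF E wv x, of i] low.ideal[OF uq_in[OF uq_out(3), of i x]] by (cases "i \<in> {1..r}") auto
  next
    case (GenKinv i)
    then show ?thesis
      using low_gens[OF E wv x, of i] low.ideal[OF uq_in[OF uq_out(4), of i x]] by (cases "i \<in> {1..r}") auto
  qed
qed

lemma low_wsum:
  assumes "wv \<beta> a" "x \<in> low a"
  shows "x \<in> wsum {\<beta> + wt \<gamma> |\<gamma>. \<gamma> \<in> Qplus r}"
  using assms(2)
proof induction
  case base
  have "\<beta> + wt 0 \<in> {\<beta> + wt \<gamma> |\<gamma>. \<gamma> \<in> Qplus r}" using Qplus_0 by blast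
  then show ?case using wsum_wv[OF assms(1)] by (simp only: wt_0 add_0_right)
next
  case (F x i)
  show ?case
  proof (rule wsum_mult[OF F.IH])
    fix \<delta> d assume "\<delta> \<in> {\<beta> + wt \<gamma> |\<gamma>. \<gamma> \<in> Qplus r}" and d: "wv \<delta> d"
    then obtain \<gamma> where g: "\<delta> = \<beta> + wt \<gamma>" "\<gamma> \<in> Qplus r" by blast
    have "\<delta> + alpha i = \<beta> + wt (\<gamma> + alpha i)" by (simp add: g wt_add wt_alpha add.assoc)
    then show "F i * d \<in> wsum {\<beta> + wt \<gamma> |\<gamma>. \<gamma> \<in> Qplus r}"
      using wv_F[OF d F.hyps(2)] Qplus_add_alpha[OF g(2) F.hyps(2)] by (intro wsum_wv) auto
  qed
qed (simp_all add: wsum_add wsum_scal wsum_ideal)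

lemma singular_wsum:
  assumes "\<And>i. i \<in> {1..r} \<Longrightarrow> E i * a \<in> I" "wv \<beta> a"
  shows "u * a \<in> wsum {\<beta> + wt \<gamma> |\<gamma>. \<gamma> \<in> Qplus r}"
  using low_wsum[OF assms(2) low_submodule[OF assms]] .

lemma all_wsum: "u \<in> wsum (wt ` Qplus r)"
  using singular_wsum[of 1 0 u] wv_1 by (simp add: ket_E image_def Bex_def conj_commute)

text \<open>Every application of F lands in weights below lambda, so a scalar part can only come
  from the highest weight vector itself. This plays the role of a one-dimensional top weight
  space.\<close>

lemma all_wsum_0: "\<exists>c. \<exists>d\<in>wsum (wt ` (Qplus r - {0})). u \<approx> scal c + d"
proof -
  have "u * 1 \<in> low 1" by (rule low_submodule[OF _ wv_1]) (simp add: ket_E)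
  then have "u \<in> low 1" by simp
  then show ?thesis
  proof induction
    case base
    show ?case by (rule exI[of _ 1], rule bexI[of _ 0]) (simp_all add: wsum_ideal ID)
  next
    case (F x i)
    show ?case
    proof (rule exI[of _ 0], rule bexI[of _ "F i * x"])
      show "F i * x \<in> wsum (wt ` (Qplus r - {0}))"
      proof (rule wsum_mult[OF all_wsum])
        fix \<delta> d assume "\<delta> \<in> wt ` Qplus r" and d: "wv \<delta> d"
        then obtain \<gamma> where g: "\<delta> = wt \<gamma>" "\<gamma> \<in> Qplus r" by blast
        have "\<gamma> + alpha i \<noteq> 0"
        proof
          assume "\<gamma> + alpha i = 0"
          then have "(\<gamma> + alpha i) i = 0 i" by metis
          then show False by simp
        qed
        then show "F i * d \<in> wsum (wt ` (Qplus r - {0}))"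
          using wv_F[OF d F.hyps(2)] Qplus_add_alpha[OF g(2) F.hyps(2)]
          by (intro wsum_wv) (auto simp: g wt_add wt_alpha intro!: image_eqI[of _ _ "\<gamma> + alpha i"])
      qed
    qed simp
  next
    case (add x y)
    then obtain c d c' d' where *: "d \<in> wsum (wt ` (Qplus r - {0}))" "x \<approx> scal c + d"
      "d' \<in> wsum (wt ` (Qplus r - {0}))" "y \<approx> scal c' + d'" by blast
    have "x + y \<approx> scal (c + c') + (d + d')"
      using cg_add[OF *(2,4)] by (simp add: scal_add algebra_simps)
    then show ?case using wsum_add[OF *(1,3)] by blast
  next
    case (scal x c)
    then obtain c' d where *: "d \<in> wsum (wt ` (Qplus r - {0}))" "x \<approx> scal c' + d" by blast
    have "scal c * x \<approx> scal (c * c') + scal c * d"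
      using cg_mult[OF *(2), of "scal c"] by (simp add: scal_mult distrib_left)
    then show ?case using wsum_scal[OF *(1)] by blast
  next
    case (ideal x)
    show ?case by (rule exI[of _ 0], rule bexI[of _ x]) (simp_all add: wsum_ideal ideal)
  qed
qed

end

subsection \<open>Generic parameters\<close>

lemma qpow_eq_1_int:
  assumes root: "\<And>n::nat. n \<ge> 1 \<Longrightarrow> exp h ^ n \<noteq> 1" and x: "x \<in> \<int>" "qpow h x = 1"
  shows "x = 0"
proof -
  obtain m where m: "x = of_int m" using x(1) by (auto elim: Ints_cases)
  have pos: "qpow h (of_int n) \<noteq> 1" if "n > 0" for n
  proof -
    have "qpow h (of_int n) = exp h ^ nat n"
      using that by (simp add: qpow_def mult.commute flip: exp_of_nat_mult)
    then show ?thesis using root[of "nat n"] that by simp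
  qed
  have "qpow h (of_int (- m)) * qpow h (of_int m) = 1" by (simp flip: qpow_add)
  then have "qpow h (of_int (- m)) = 1" using x(2) m by simp
  then show ?thesis using pos[of m] pos[of "- m"] x(2) m by (cases m "0::int" rule: linorder_cases) auto
qed

text \<open>These two conditions follow from genericity at q and are stable under q -> 1/q, so
  everything proved here is available for both parameters.\<close>

locale generic_verma = verma_rep +
  assumes root: "\<And>n::nat. n \<ge> 1 \<Longrightarrow> exp h ^ n \<noteq> 1"
    and nontrivial: "1 \<notin> ket_ideal r h lam"
begin

lemma qdiff_neq_0: "qdiff h \<noteq> 0"
proof
  assume "qdiff h = 0"
  then have "qpow h 2 = 1" by (simp add: qdiff_def qpow_def exp_minus field_simps flip: exp_add)
  then show False using qpow_eq_1_int[OF root, of 2] by simp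
qed

text \<open>If all eigenvalues agreed, the integers (\<delta> - \<gamma>|alpha_i) would be exponents
  at which q has power 1, hence 0; invertibility of the Cartan matrix then gives equal
  coordinates.\<close>

lemma ev_separated:
  assumes int: "\<And>k. \<delta> k - \<gamma> k \<in> \<int>" and k: "k \<in> {1..r}" "\<delta> k \<noteq> \<gamma> k"
  shows "\<exists>i\<in>{1..r}. ev \<delta> i \<noteq> ev \<gamma> i"
proof (rule ccontr)
  assume "\<not> ?thesis"
  then have eq: "ev \<delta> i = ev \<gamma> i" if "i \<in> {1..r}" for i using that by auto
  have "form r (\<delta> - \<gamma>) (alpha i) = 0" if i: "i \<in> {1..r}" for i
  proof (rule qpow_eq_1_int[OF root])
    have "cut r (\<delta> - \<gamma>) k \<in> \<int>" for k using int by (simp add: cut_def)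
    then show "form r (\<delta> - \<gamma>) (alpha i) \<in> \<int>" using i by (simp add: form_alpha)
    have "ev \<delta> i * qpow h (form r (\<delta> - \<gamma>) (alpha i)) = ev \<gamma> i"
      unfolding ev_def qpow_add[symmetric] by (simp add: form_diff)
    then show "qpow h (form r (\<delta> - \<gamma>) (alpha i)) = 1" using eq[OF i] by (simp add: ev_def)
  qed
  then have "form r (\<delta> - \<gamma>) (icartan r k) = 0"
    unfolding form_alpha_expand[of r _ "icartan r k"] by (intro sum.neutral) simp
  then show False using form_icartan_right[of k r "\<delta> - \<gamma>"] k by (simp add: cut_def)
qed

lemma wsum_0_ideal:
  assumes "x \<in> wsum (wt ` (Qplus r - {0}))" "wv 0 x"
  shows "x \<in> I"
proof (rule wsum_separated[OF assms])
  fix \<gamma> assume "\<gamma> \<in> wt ` (Qplus r - {0})"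
  then obtain \<beta> where b: "\<gamma> = wt \<beta>" "\<beta> \<in> Qplus r" "\<beta> \<noteq> 0" by auto
  obtain k where k: "\<beta> k \<noteq> 0"
  proof (rule ccontr)
    assume "\<not> thesis"
    then have "\<beta> = 0" using that by (intro ext) (simp only: zero_fun_def, metis)
    then show False using b(3) by simp
  qed
  moreover from k have "k \<in> {1..r}"
    using b(2) unfolding Qplus_def by (simp only: mem_Collect_eq) metis
  ultimately show "\<exists>i\<in>{1..r}. ev 0 i \<noteq> ev \<gamma> i"
    using ev_separated[of 0 \<gamma> k] by (simp add: b(1) wt_def)
qed

lemma wv_0_scal:
  assumes "wv 0 x"
  shows "\<exists>c. x \<approx> scal c"
proof -
  obtain c d where d: "d \<in> wsum (wt ` (Qplus r - {0}))" "x \<approx> scal c + d" using all_wsum_0 by blast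
  have *: "x - scal c \<approx> d" using cg_diff[OF d(2) cg_refl[of "scal c"]] by simp
  have "wv 0 (x - scal c)" using wv_diff[OF assms wv_scal[OF wv_1, of c]] by simp
  then have "x - scal c \<in> I" by (rule wsum_0_ideal[OF wsum_cong[OF * d(1)]])
  then show ?thesis by (auto simp: cg_def)
qed

text \<open>The weight of \<open>E j * x\<close> lies outside $\lambda - Q_+$.\<close>

lemma E_ideal:
  assumes "wv (wt \<beta>) x" "j \<in> {1..r}" "\<beta> j = 0"
  shows "E j * x \<in> I"
proof (rule wsum_separated[OF all_wsum wv_E[OF assms(1,2)]])
  fix \<gamma> assume "\<gamma> \<in> wt ` Qplus r"
  then obtain \<beta>' where b: "\<gamma> = wt \<beta>'" by auto
  have "(wt \<beta> - alpha j) k - \<gamma> k \<in> \<int>" for k by (simp add: b wt_def alpha_def)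
  moreover have "(wt \<beta> - alpha j) j \<noteq> \<gamma> j"
  proof
    assume "(wt \<beta> - alpha j) j = \<gamma> j"
    then have "(0::complex) = of_nat (Suc (\<beta>' j))" using assms(3) by (simp add: b wt_def) (metis add.right_inverse)
    then show False by (metis of_nat_eq_0_iff nat.distinct(1))
  qed
  ultimately show "\<exists>i\<in>{1..r}. ev (wt \<beta> - alpha j) i \<noteq> ev \<gamma> i"
    using ev_separated assms(2) by blast
qed

section \<open>The vacuum expectation value and the pairing\<close>

lemma one_not_wsum: "1 \<notin> wsum (wt ` (Qplus r - {0}))"
  using wsum_0_ideal wv_1 nontrivial by blast

text \<open>F_i lowers every vector, while K_i - q^(lambda_i) kills the scalar part of a vector and
  keeps lower weights low; so both kinds of generators map the whole module below the weight
  lambda.\<close>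

lemma bra_wsum:
  assumes "x \<in> bra_ideal r h lam"
  shows "x \<in> wsum (wt ` (Qplus r - {0}))"
proof -
  let ?W = "wsum (wt ` (Qplus r - {0}))"
  \<comment> \<open>Quantifying over all right factors turns the condition into a right ideal,
    against which minimality of \<open>bra_ideal\<close> can be used.\<close>
  let ?J = "{y. \<forall>a. y * a \<in> ?W}"
  have "bra_ideal r h lam \<subseteq> ?J"
    unfolding bra_ideal_def
  proof (rule right_ideal_gen_least)
    show "right_ideal ?J"
      unfolding right_ideal_def by (auto simp: wsum_ideal ID distrib_right wsum_add mult.assoc)
    have "y * a \<in> ?W" if "y \<in> uq_ideal r h" for y a
      using uq_in[OF that] wsum_ideal by blast
    moreover have "F i * a \<in> ?W" if i: "i \<in> {1..r}" for i a
    proof (rule wsum_mult[OF all_wsum])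
      fix \<delta> d assume "\<delta> \<in> wt ` Qplus r" and d: "wv \<delta> d"
      then obtain \<gamma> where g: "\<delta> = wt \<gamma>" "\<gamma> \<in> Qplus r" by blast
      have "\<gamma> + alpha i \<noteq> 0"
      proof
        assume "\<gamma> + alpha i = 0"
        then have "(\<gamma> + alpha i) i = 0 i" by metis
        then show False by simp
      qed
      then show "F i * d \<in> ?W"
        using wv_F[OF d i] Qplus_add_alpha[OF g(2) i]
        by (intro wsum_wv) (auto simp: g wt_add wt_alpha intro!: image_eqI[of _ _ "\<gamma> + alpha i"])
    qed
    moreover have "(K i - scal (qpow h (form r lam (alpha i)))) * a \<in> ?W" if i: "i \<in> {1..r}" for i a
    proof -
      let ?A = "K i - scal (ev 0 i)"
      have A: "?A * y \<approx> scal (ev \<eta> i - ev 0 i) * y" if "wv \<eta> y" for \<eta> y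
        using cg_diff[OF wvD[OF that i] cg_refl[of "scal (ev 0 i) * y"]]
        by (simp add: left_diff_distrib scal_diff)
      obtain c d where d: "d \<in> ?W" "a \<approx> scal c + d" using all_wsum_0 by blast
      have "?A * d \<in> ?W"
        by (rule wsum_mult[OF d(1)]) (blast intro: wsum_wv wv_cong[OF A] wv_scal)
      moreover have "?A * a \<approx> ?A * scal c + ?A * d" using cg_mult[OF d(2), of ?A] by (simp add: distrib_left)
      moreover have "?A * scal c \<in> I" using A[OF wv_scal[OF wv_1, of c]] by (simp add: cg_0)
      ultimately have "?A * a \<in> ?W" using wsum_cong wsum_add wsum_ideal by meson
      then show ?thesis by (simp add: ev_def)
    qed
    ultimately show "uq_ideal r h \<union> (\<Union>i\<in>{1..r}. {F i, K i - scal (qpow h (form r lam (alpha i)))}) \<subseteq> ?J"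
      by blast
  qed
  then have "x * 1 \<in> ?W" using assms by blast
  then show ?thesis by simp
qed

text \<open>The subspace on which \<open>vev\<close> is to vanish. Scalars are central, so a right
  ideal plus a left ideal is still a subspace; that it misses 1 makes the scalar in
  \<open>vev\<close> unique.\<close>

definition vac :: "free_alg set" where
  "vac = bra_ideal r h lam + I"

lemma vac_iff: "x \<in> vac \<longleftrightarrow> (\<exists>b\<in>bra_ideal r h lam. \<exists>k\<in>I. x = b + k)"
  unfolding vac_def by (auto simp: set_plus_def)

lemma one_not_vac: "1 \<notin> vac"
  unfolding vac_iff using bra_wsum wsum_ideal wsum_add one_not_wsum by fastforce

lemmas BD = right_idealD[OF bra_ideal_right[of r h lam]]

lemma vac_add: "x \<in> vac \<Longrightarrow> y \<in> vac \<Longrightarrow> x + y \<in> vac"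
  and vac_scal: "x \<in> vac \<Longrightarrow> scal c * x \<in> vac"
  and vac_bra: "x \<in> bra_ideal r h lam \<Longrightarrow> x \<in> vac"
  and vac_ket: "x \<in> I \<Longrightarrow> x \<in> vac"
proof -
  assume x: "x \<in> vac"
  {
    assume "y \<in> vac"
    then obtain b k b' k' where "b \<in> bra_ideal r h lam" "b' \<in> bra_ideal r h lam" "k \<in> I" "k' \<in> I"
      "x = b + k" "y = b' + k'" using x unfolding vac_iff by blast
    moreover from this have "x + y = (b + b') + (k + k')" by simp
    ultimately show "x + y \<in> vac" unfolding vac_iff using BD(2) ID(2) by blast
  }
  obtain b k where "b \<in> bra_ideal r h lam" "k \<in> I" "x = b + k" using x unfolding vac_iff by blast
  moreover from this have "scal c * x = b * scal c + scal c * k" by (simp add: distrib_left scal_comm[of b])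
  ultimately show "scal c * x \<in> vac" unfolding vac_iff using BD(3) ID(3) by blast
next
  show "x \<in> bra_ideal r h lam \<Longrightarrow> x \<in> vac" unfolding vac_iff using ID(1) by force
  show "x \<in> I \<Longrightarrow> x \<in> vac" unfolding vac_iff using BD(1) by force
qed

lemma vac_diff: "x \<in> vac \<Longrightarrow> y \<in> vac \<Longrightarrow> x - y \<in> vac"
  using vac_add[OF _ vac_scal[of y "- 1"], of x] by (simp add: scal_minus)

lemma vev_eq:
  assumes "x - scal c \<in> vac"
  shows "vev r h lam x = c"
  unfolding vev_def vac_def[symmetric]
proof (rule the_equality)
  fix d assume "x - scal d \<in> vac"
  then have "scal (c - d) \<in> vac" using vac_diff[of "x - scal d" "x - scal c"] assms by (simp add: scal_diff)
  then show "d = c" using vac_scal[of "scal (c - d)" "1 / (c - d)"] one_not_vac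
    by (cases "c = d") (simp_all flip: scal_mult)
qed (rule assms)

text \<open>Changing a and b within their cosets changes the product by an element of the right
  ideal plus one of the left ideal, hence within \<open>vac\<close>.\<close>

lemma pairing_eq:
  assumes "a * b - scal c \<in> vac"
  shows "pairing r h lam (bra r h lam a) (ket r h lam b) = c"
proof -
  have vev: "vev r h lam (a' * b') = c" if ab: "a' \<in> bra r h lam a" "b' \<in> ket r h lam b" for a' b'
  proof (rule vev_eq)
    obtain x y where "x \<in> bra_ideal r h lam" "y \<in> I" "a' = a + x" "b' = b + y"
      using ab unfolding bra_def ket_def elt_set_plus_def by blast
    moreover from this have "a' * b' - scal c = (a * b - scal c) + (x * (b + y) + a * y)"
      by (simp add: algebra_simps)
    ultimately show "a' * b' - scal c \<in> vac"
      using vac_add[OF assms vac_add[OF vac_bra[OF BD(3)] vac_ket[OF ID(3)]]] by metis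
  qed
  have ab: "a \<in> bra r h lam a" "b \<in> ket r h lam b"
    using BD(1) ID(1) by (force simp: bra_def ket_def elt_set_plus_def)+
  show ?thesis
    unfolding pairing_def by (rule the_equality) (use vev ab in blast)+
qed

end

section \<open>The Whittaker vectors\<close>

lemma generic_verma_uminus:
  assumes "generic_verma r h lam"
  shows "generic_verma r (- h) lam"
proof
  interpret generic_verma r h lam by fact
  show "exp (- h) ^ n \<noteq> 1" if "n \<ge> 1" for n
    using root[OF that] by (simp add: exp_minus power_inverse)
  show "1 \<notin> ket_ideal r (- h) lam"
    using theta_ket_ideal[of 1 r "- h" lam] nontrivial by (auto simp: theta_simps)
qed

text \<open>The eigenvalue of $E_i$ from weight $\lambda-\beta$ to weight $\lambda-\beta+\alpha_i$
  on the Whittaker vector.\<close>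

definition chi :: "nat \<Rightarrow> complex \<Rightarrow> weight \<Rightarrow> (nat \<Rightarrow> complex) \<Rightarrow> nat \<Rightarrow> qroot \<Rightarrow> complex" where
  "chi r h lam \<mu> i \<beta> = \<mu> i * qpow h (of_nat (i - 1) * (form r (lam - wt \<beta>) (alpha i) + 2))"

lemma chi_diff_alpha:
  assumes "i \<in> {1..r}" "j \<in> {1..r}" "\<beta> i \<noteq> 0"
  shows "chi r h lam \<mu> j (\<beta> - alpha i) = chi r h lam \<mu> j \<beta> * qpow h (of_nat (j - 1) * of_int (cartan i j))"
  using assms form_alpha_alpha[OF assms(1,2)]
  by (simp add: chi_def wt_diff_alpha form_diff mult.assoc flip: qpow_add) (simp add: algebra_simps)

text \<open>The choice of the exponents \<open>i - 1\<close> in the Whittaker characters is what makes this work: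
  $(i-j)\,C_{i,j}$ is the shift of $\tau_i$ under subtraction of $\alpha_j$.\<close>

lemma chi_tau:
  assumes i: "i \<in> {1..r}" "\<beta> i \<noteq> 0" and j: "j \<in> {1..r}" "\<beta> j \<noteq> 0"
  shows "qpow h (- tau r lam i \<beta>) * chi r h lam \<mu> i \<beta> * chi r h lam \<mu> j (\<beta> - alpha i)
    = chi r h lam \<mu> j \<beta> * (qpow h (- tau r lam i (\<beta> - alpha j)) * chi r h lam \<mu> i (\<beta> - alpha j))"
proof -
  have "(of_nat (j - 1) :: complex) * of_int (cartan i j) = - eps i j + of_nat (i - 1) * of_int (cartan j i)"
    using i j by (auto simp: cartan_def eps_def of_nat_diff)
  then have "qpow h (of_nat (j - 1) * of_int (cartan i j))
      = qpow h (- eps i j) * qpow h (of_nat (i - 1) * of_int (cartan j i))"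
    by (simp flip: qpow_add)
  moreover have "qpow h (- tau r lam i (\<beta> - alpha j)) = qpow h (- tau r lam i \<beta>) * qpow h (- eps i j)"
    using tau_diff_alpha[of i r j \<beta> lam] i(1) j by (simp flip: qpow_add)
  ultimately show ?thesis
    unfolding chi_diff_alpha[of i r j \<beta>, OF i(1) j(1) i(2)] chi_diff_alpha[of j r i \<beta>, OF j(1) i(1) j(2)]
    by (simp only: mult_ac)
qed

text \<open>The guard is spelled out instead of using \<open>lower\<close>, so that each recursive
  call sits under the condition that makes the height decrease.\<close>

function wvec :: "nat \<Rightarrow> complex \<Rightarrow> weight \<Rightarrow> (nat \<Rightarrow> complex) \<Rightarrow> qroot \<Rightarrow> free_alg" where
  "wvec r h lam \<mu> \<beta> = (if \<beta> = 0 then 1 else scal (1 / vq r h lam \<beta>) *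
     (\<Sum>i\<in>{1..r}. scal (qpow h (- tau r lam i \<beta>) * chi r h lam \<mu> i \<beta>) *
        (F i * (if \<beta> i = 0 then 0 else wvec r h lam \<mu> (\<beta> - alpha i)))))"
  by pat_completeness auto
termination
  by (relation "Wellfounded.measure (\<lambda>(r, h, lam, \<mu>, \<beta>). height r \<beta>)") (auto simp: height_diff_alpha)

declare wvec.simps [simp del]

lemma wvec_0: "wvec r h lam \<mu> 0 = 1"
  by (simp add: wvec.simps)

lemma vq_wvec:
  assumes "\<beta> \<noteq> 0 \<Longrightarrow> vq r h lam \<beta> \<noteq> 0"
  shows "scal (vq r h lam \<beta>) * wvec r h lam \<mu> \<beta> = (\<Sum>i\<in>{1..r}.
    scal (qpow h (- tau r lam i \<beta>) * chi r h lam \<mu> i \<beta>) * (F i * lower i (wvec r h lam \<mu>) \<beta>))"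
proof (cases "\<beta> = 0")
  case True
  then show ?thesis by (simp only: vq_0 scal_0 mult_zero_left lower_0_root mult_zero_right sum.neutral_const)
next
  case False
  then show ?thesis
    using assms by (subst wvec.simps) (simp add: scal_scal lower_def)
qed

section \<open>Cosets, their action and weight spaces in terms of representatives\<close>

context verma_rep
begin

lemma ket_eq: "ket r h lam a = ket r h lam b \<longleftrightarrow> a \<approx> b"
proof
  assume "ket r h lam a = ket r h lam b"
  then have "a \<in> b +o I" using ID(1) by (auto simp: ket_def elt_set_plus_def)
  then show "a \<approx> b" by (simp add: cg_def set_minus_plus)
next
  assume ab: "a \<approx> b"
  have "x - a \<in> I \<longleftrightarrow> x - b \<in> I" for x
    using cg_trans[of x a b] cg_trans[of x b a] ab cg_sym[OF ab] by (auto simp: cg_def)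
  then show "ket r h lam a = ket r h lam b" by (auto simp: ket_def set_minus_plus[symmetric])
qed

lemma lact_ket: "lact r h lam u (ket r h lam a) = ket r h lam (u * a)"
proof (rule set_eqI)
  fix x
  have "x \<in> lact r h lam u (ket r h lam a) \<longleftrightarrow> (\<exists>k\<in>I. \<exists>k'\<in>I. x = u * (a + k) + k')"
    by (auto simp: lact_def ket_def elt_set_plus_def elt_set_times_def set_plus_def)
  also have "\<dots> \<longleftrightarrow> x - u * a \<in> I"
  proof
    assume "\<exists>k\<in>I. \<exists>k'\<in>I. x = u * (a + k) + k'"
    then obtain k k' where "k \<in> I" "k' \<in> I" "x - u * a = u * k + k'" by (auto simp: distrib_left)
    then show "x - u * a \<in> I" using ID(2,3) by simp
  next
    assume "x - u * a \<in> I"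
    then show "\<exists>k\<in>I. \<exists>k'\<in>I. x = u * (a + k) + k'"
      by (intro bexI[of _ 0] bexI[of _ "x - u * a"]) (simp_all add: ID)
  qed
  finally show "x \<in> lact r h lam u (ket r h lam a) \<longleftrightarrow> x \<in> ket r h lam (u * a)"
    by (simp add: ket_def set_minus_plus)
qed

lemma ket_space_iff: "X \<in> ket_space r h lam \<beta> \<longleftrightarrow> (\<exists>a. X = ket r h lam a \<and> wv (wt \<beta>) a)"
proof -
  have "(\<forall>i\<in>{1..r}. lact r h lam (K i) (ket r h lam a) =
      lact r h lam (scal (qpow h (form r (lam - wt \<beta>) (alpha i)))) (ket r h lam a)) \<longleftrightarrow> wv (wt \<beta>) a" for a
    by (simp only: lact_ket ket_eq wv_def ev_def)
  then show ?thesis unfolding ket_space_def verma_def by blast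
qed

lemma ket_in_space: "ket r h lam a \<in> ket_space r h lam \<beta> \<longleftrightarrow> wv (wt \<beta>) a"
  unfolding ket_space_iff ket_eq using wv_cong cg_refl by blast

end

text \<open>\<open>no_singular\<close> is the form in which irreducibility enters: it speaks of
  elements rather than submodules, so a symmetry of the free algebra can carry it from q to
  1/q.\<close>

locale whittaker_verma = generic_verma +
  assumes vq_neq_0: "\<And>\<beta>. \<beta> \<in> Qplus r \<Longrightarrow> \<beta> \<noteq> 0 \<Longrightarrow> vq r h lam \<beta> \<noteq> 0"
    and no_singular: "\<And>\<beta> a. \<beta> \<in> Qplus r \<Longrightarrow> \<beta> \<noteq> 0 \<Longrightarrow> wv (wt \<beta>) a \<Longrightarrow>
      (\<And>i. i \<in> {1..r} \<Longrightarrow> E i * a \<in> I) \<Longrightarrow> a \<in> I"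
begin

lemma wvec_wv: "\<beta> \<in> Qplus r \<Longrightarrow> wv (wt \<beta>) (wvec r h lam \<mu> \<beta>)"
proof (induction rule: Qplus_induct)
  case (step \<beta>)
  show ?case
  proof (cases "\<beta> = 0")
    case True
    then show ?thesis by (simp only: wvec_0 wt_0 wv_1)
  next
    case False
    have "wv (wt \<beta>) (F i * (if \<beta> i = 0 then 0 else wvec r h lam \<mu> (\<beta> - alpha i)))" if i: "i \<in> {1..r}" for i
    proof (cases "\<beta> i = 0")
      case False
      have "wt (\<beta> - alpha i) + alpha i = wt \<beta>" using False by (simp add: wt_diff_alpha)
      then have "wv (wt \<beta>) (F i * wvec r h lam \<mu> (\<beta> - alpha i))"
        using wv_F[OF step.IH[OF i False] i] by metis
      then show ?thesis using False by (simp only: if_False)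
    qed (simp add: wv_ideal ID)
    then have "wv (wt \<beta>) (scal (1 / vq r h lam \<beta>) *
     (\<Sum>i\<in>{1..r}. scal (qpow h (- tau r lam i \<beta>) * chi r h lam \<mu> i \<beta>) *
        (F i * (if \<beta> i = 0 then 0 else wvec r h lam \<mu> (\<beta> - alpha i)))))"
      by (intro wv_scal wv_sum)
    then show ?thesis using False by (subst wvec.simps) (simp only: if_False)
  qed
qed

lemma EF_wv:
  assumes "wv (wt \<beta> - alpha i) x" "i \<in> {1..r}"
  shows "E i * (F i * x) \<approx> F i * (E i * x) + scal (efcomm r h lam i \<beta>) * x"
proof -
  have ev: "ev (wt \<beta> - alpha i) i = qpow h (form r (lam - wt \<beta>) (alpha i) + 2)"
    using form_alpha_alpha[OF assms(2,2)] by (simp add: ev_def form_diff form_add cartan_def algebra_simps)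
  have inv: "1 / ev (wt \<beta> - alpha i) i = qpow h (- (form r (lam - wt \<beta>) (alpha i) + 2))"
    unfolding ev by (simp only: qpow_def mult_minus_right exp_minus inverse_eq_divide)
  have "E i * (F i * x) \<approx> F i * (E i * x) + scal (1 / qdiff h) * (K i * x - Kinv i * x)"
    using EF[OF assms(2,2)] by simp
  also have "\<dots> \<approx> F i * (E i * x) + scal (1 / qdiff h) *
      (scal (ev (wt \<beta> - alpha i) i) * x - scal (1 / ev (wt \<beta> - alpha i) i) * x)"
    by (intro cg_add cg_refl cg_mult cg_diff wvD[OF assms] wv_Kinv[OF assms])
  also have "\<dots> = F i * (E i * x) + scal (efcomm r h lam i \<beta>) * x"
    unfolding inv unfolding ev efcomm_def
    by (simp add: right_diff_distrib scal_scal diff_divide_distrib scal_diff left_diff_distrib)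
  finally show ?thesis .
qed

text \<open>By induction, pulling E_j through the recursion gives terms F_i w with both roots
  removed, which \<open>chi_tau\<close> reassembles into the recursion in degree \<beta> - alpha_j,
  plus one commutator term from i = j.\<close>

lemma wvec_E:
  assumes "\<beta> \<in> Qplus r" "j \<in> {1..r}"
  shows "E j * wvec r h lam \<mu> \<beta> \<approx> scal (chi r h lam \<mu> j \<beta>) * lower j (wvec r h lam \<mu>) \<beta>"
  using assms(1)
proof (induction rule: Qplus_induct)
  case (step \<beta>)
  let ?a = "wvec r h lam \<mu>" and ?v = "vq r h lam" and ?chi = "chi r h lam \<mu>"
  let ?c = "\<lambda>i \<beta>. qpow h (- tau r lam i \<beta>) * ?chi i \<beta>"
  note j = assms(2)
  show ?case
  proof (cases "\<beta> = 0")
    case True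
    then show ?thesis using ket_E[OF j, of h lam] by (simp only: wvec_0 lower_0_root) (simp add: cg_0)
  next
    case False
    have summand: "E j * (F i * lower i ?a \<beta>) \<approx> scal (?chi j (\<beta> - alpha i)) * (F i * lower i (lower j ?a) \<beta>)
        + (if i = j then scal (efcomm r h lam j \<beta>) * lower j ?a \<beta> else 0)" if i: "i \<in> {1..r}" for i
    proof (cases "\<beta> i = 0")
      case True
      then show ?thesis by (auto simp: lower_def)
    next
      case bi: False
      let ?x = "?a (\<beta> - alpha i)"
      have x: "lower i ?a \<beta> = ?x" "lower i (lower j ?a) \<beta> = lower j ?a (\<beta> - alpha i)"
        using bi by (simp_all add: lower_def[of i])
      have wx: "wv (wt \<beta> - alpha i) ?x"
        using wvec_wv[OF Qplus_diff_alpha[OF step.hyps], of i \<mu>] wt_diff_alpha[of \<beta> i] bi by metis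
      have "F i * (E j * ?x) \<approx> F i * (scal (?chi j (\<beta> - alpha i)) * lower j ?a (\<beta> - alpha i))"
        by (rule cg_mult[OF step.IH[OF i bi]])
      then have FE: "F i * (E j * ?x) \<approx> scal (?chi j (\<beta> - alpha i)) * (F i * lower j ?a (\<beta> - alpha i))"
        by (simp only: scal_gen_comm)
      have "E j * (F i * ?x) \<approx> F i * (E j * ?x) + (if i = j then scal (efcomm r h lam j \<beta>) * ?x else 0)"
        using EF[OF j i, of ?x] EF_wv[OF wx i] by (cases "i = j") simp_all
      also have "\<dots> \<approx> scal (?chi j (\<beta> - alpha i)) * (F i * lower j ?a (\<beta> - alpha i))
          + (if i = j then scal (efcomm r h lam j \<beta>) * ?x else 0)"
        by (rule cg_add[OF FE cg_refl])
      finally show ?thesis using x by (cases "i = j") simp_all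
    qed
    have V: "scal (?v \<gamma>) * ?a \<gamma> = (\<Sum>i\<in>{1..r}. scal (?c i \<gamma>) * (F i * lower i ?a \<gamma>))"
      if "\<gamma> \<in> Qplus r" for \<gamma>
      by (rule vq_wvec) (rule vq_neq_0[OF that])
    \<comment> \<open>The factor v is carried along and cancelled only at the end, so both degrees
      involved use the recursion without denominators.\<close>
    have "scal (?v \<beta>) * (E j * ?a \<beta>) = E j * (scal (?v \<beta>) * ?a \<beta>)" by (simp only: scal_gen_comm)
    also have "\<dots> = (\<Sum>i\<in>{1..r}. scal (?c i \<beta>) * (E j * (F i * lower i ?a \<beta>)))"
      unfolding V[OF step.hyps] sum_distrib_left by (simp only: scal_gen_comm)
    also have "\<dots> \<approx> (\<Sum>i\<in>{1..r}. scal (?c i \<beta>) * (scal (?chi j (\<beta> - alpha i)) * (F i * lower i (lower j ?a) \<beta>)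
        + (if i = j then scal (efcomm r h lam j \<beta>) * lower j ?a \<beta> else 0)))"
      by (intro cg_sum cg_mult summand)
    also have "\<dots> = (\<Sum>i\<in>{1..r}. scal (?c i \<beta> * ?chi j (\<beta> - alpha i)) * (F i * lower i (lower j ?a) \<beta>))
        + (\<Sum>i\<in>{1..r}. if i = j then scal (?c j \<beta> * efcomm r h lam j \<beta>) * lower j ?a \<beta> else 0)"
      unfolding sum.distrib[symmetric] by (intro sum.cong refl) (simp add: distrib_left scal_scal)
    also have "(\<Sum>i\<in>{1..r}. if i = j then scal (?c j \<beta> * efcomm r h lam j \<beta>) * lower j ?a \<beta> else 0)
        = scal (?c j \<beta> * efcomm r h lam j \<beta>) * lower j ?a \<beta>"
      using j by simp
    also have "(\<Sum>i\<in>{1..r}. scal (?c i \<beta> * ?chi j (\<beta> - alpha i)) * (F i * lower i (lower j ?a) \<beta>))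
        + scal (?c j \<beta> * efcomm r h lam j \<beta>) * lower j ?a \<beta> = scal (?v \<beta>) * (scal (?chi j \<beta>) * lower j ?a \<beta>)"
    proof (cases "\<beta> j = 0")
      case True
      then have "lower i (lower j ?a) \<beta> = 0" for i unfolding lower_commute[of i] by (simp add: lower_def[of j])
      then show ?thesis using True by (simp add: lower_def[of j])
    next
      case bj: False
      let ?g = "\<beta> - alpha j"
      have 1: "scal (?c i \<beta> * ?chi j (\<beta> - alpha i)) * (F i * lower i (lower j ?a) \<beta>)
          = scal (?chi j \<beta>) * (scal (?c i ?g) * (F i * lower i ?a ?g))" if i: "i \<in> {1..r}" for i
      proof -
        have x: "lower i (lower j ?a) \<beta> = lower i ?a ?g"
          unfolding lower_commute[of i] using bj by (simp add: lower_def[of j])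
        show ?thesis
        proof (cases "\<beta> i = 0")
          case True
          then have "lower i (lower j ?a) \<beta> = 0" by (simp add: lower_def[of i])
          then show ?thesis using x by simp
        next
          case False
          show ?thesis unfolding x chi_tau[OF i False j bj] scal_scal[symmetric] by (simp only: scal_mult mult.assoc)
        qed
      qed
      have "(\<Sum>i\<in>{1..r}. scal (?c i \<beta> * ?chi j (\<beta> - alpha i)) * (F i * lower i (lower j ?a) \<beta>))
          = (\<Sum>i\<in>{1..r}. scal (?chi j \<beta>) * (scal (?c i ?g) * (F i * lower i ?a ?g)))"
        by (rule sum.cong[OF refl 1])
      also have "\<dots> = scal (?chi j \<beta>) * (scal (?v ?g) * ?a ?g)"
        unfolding V[OF Qplus_diff_alpha[OF step.hyps]] sum_distrib_left ..
      finally have "(\<Sum>i\<in>{1..r}. scal (?c i \<beta> * ?chi j (\<beta> - alpha i)) * (F i * lower i (lower j ?a) \<beta>))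
        + scal (?c j \<beta> * efcomm r h lam j \<beta>) * lower j ?a \<beta>
        = scal (?chi j \<beta> * (?v ?g + qpow h (- tau r lam j \<beta>) * efcomm r h lam j \<beta>)) * lower j ?a \<beta>"
        using bj by (simp add: lower_def[of j] scal_scal distrib_left scal_add distrib_right mult_ac)
      \<comment> \<open>The commutator term supplies exactly the increment of v between the two
        degrees.\<close>
      also have "?v ?g + qpow h (- tau r lam j \<beta>) * efcomm r h lam j \<beta> = ?v \<beta>"
        using vq_diff[of j r \<beta> h lam] j bj qdiff_neq_0 by (simp add: algebra_simps)
      finally show ?thesis by (simp only: scal_scal mult.commute)
    qed
    finally show ?thesis by (rule scal_cancel[OF _ vq_neq_0[OF step.hyps False]])
  qed
qed

text \<open>The Whittaker conditions on representatives, with the normalisation expressed through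
  \<open>vac\<close>. In this form they serve both the ket at q and, through \<open>psi\<close>, the
  bra at 1/q.\<close>

definition is_whittaker :: "(nat \<Rightarrow> complex) \<Rightarrow> (qroot \<Rightarrow> free_alg) \<Rightarrow> bool" where
  "is_whittaker \<mu> x \<longleftrightarrow> (\<forall>\<beta>\<in>Qplus r. wv (wt \<beta>) (x \<beta>)) \<and> 1 - x 0 \<in> vac \<and>
     (\<forall>i\<in>{1..r}. \<forall>\<beta>\<in>Qplus r. E i * x (\<beta> + alpha i) \<approx> scal (\<mu> i) * K i ^ (i - 1) * x \<beta>)"

lemma is_whittaker_wvec: "is_whittaker \<mu> (wvec r h lam \<mu>)"
  unfolding is_whittaker_def
proof (intro conjI ballI)
  fix i \<beta> assume i: "i \<in> {1..r}" and b: "\<beta> \<in> Qplus r"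
  have ev: "chi r h lam \<mu> i (\<beta> + alpha i) = \<mu> i * ev (wt \<beta>) i ^ (i - 1)"
  proof -
    have "form r (lam - wt (\<beta> + alpha i)) (alpha i) + 2 = form r (lam - wt \<beta>) (alpha i)"
      using form_alpha_alpha[OF i i] by (simp add: wt_add wt_alpha form_diff form_add cartan_def)
    then show ?thesis by (simp add: chi_def ev_def qpow_def mult.left_commute flip: exp_of_nat_mult)
  qed
  have "E i * wvec r h lam \<mu> (\<beta> + alpha i) \<approx> scal (\<mu> i * ev (wt \<beta>) i ^ (i - 1)) * wvec r h lam \<mu> \<beta>"
    using wvec_E[OF Qplus_add_alpha[OF b i] i, of \<mu>] by (simp only: lower_add_alpha ev)
  also have "\<dots> = scal (\<mu> i) * (scal (ev (wt \<beta>) i ^ (i - 1)) * wvec r h lam \<mu> \<beta>)" by (simp only: scal_scal)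
  also have "\<dots> \<approx> scal (\<mu> i) * (K i ^ (i - 1) * wvec r h lam \<mu> \<beta>)"
    by (intro cg_mult cg_sym[OF wv_K_power] wvec_wv b i)
  finally show "E i * wvec r h lam \<mu> (\<beta> + alpha i) \<approx> scal (\<mu> i) * K i ^ (i - 1) * wvec r h lam \<mu> \<beta>"
    by (simp only: mult.assoc)
qed (simp_all add: wvec_wv wvec_0 vac_ket ID)

lemma is_whittaker_unique:
  assumes x: "is_whittaker \<mu> x" and b: "\<beta> \<in> Qplus r"
  shows "x \<beta> \<approx> wvec r h lam \<mu> \<beta>"
  using b
proof (induction rule: Qplus_induct)
  case (step \<beta>)
  let ?a = "wvec r h lam \<mu>"
  note a = is_whittaker_wvec[of \<mu>]
  show ?case
  proof (cases "\<beta> = 0")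
    case True
    have "wv (wt 0) (x 0)" using x Qplus_0 unfolding is_whittaker_def by blast
    then obtain c where c: "x 0 \<approx> scal c" using wv_0_scal by (auto simp only: wt_0)
    then have "x 0 - scal c \<in> vac" by (simp add: cg_def vac_ket)
    moreover have "1 - x 0 \<in> vac" using x by (simp add: is_whittaker_def)
    ultimately have "1 - scal c \<in> vac" using vac_add by fastforce
    then have "vev r h lam 1 = c" by (rule vev_eq)
    moreover have "vev r h lam 1 = 1" by (rule vev_eq) (simp add: vac_ket ID)
    ultimately show ?thesis using c True by (simp only: wvec_0 scal_1)
  next
    case False
    have wv: "wv (wt \<beta>) (x \<beta> - ?a \<beta>)"
      using x a step.hyps unfolding is_whittaker_def by (intro wv_diff) blast+
    \<comment> \<open>If the i-th coordinate is 0, the Whittaker equations do not constrain E_i here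
      and the weight argument takes over; otherwise both vectors have the same image by the
      induction hypothesis.\<close>
    have "E i * (x \<beta> - ?a \<beta>) \<in> I" if i: "i \<in> {1..r}" for i
    proof (cases "\<beta> i = 0")
      case True
      then show ?thesis by (rule E_ideal[OF wv i])
    next
      case bi: False
      let ?g = "\<beta> - alpha i"
      have g: "?g \<in> Qplus r" "?g + alpha i = \<beta>" by (rule Qplus_diff_alpha[OF step.hyps], rule diff_alpha_add, rule bi)
      have "E i * x (?g + alpha i) \<approx> scal (\<mu> i) * K i ^ (i - 1) * x ?g"
        using x i g(1) unfolding is_whittaker_def by blast
      also have "\<dots> \<approx> scal (\<mu> i) * K i ^ (i - 1) * ?a ?g" by (rule cg_mult[OF step.IH[OF i bi]])
      also have "\<dots> \<approx> E i * ?a (?g + alpha i)"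
        using a i g(1) unfolding is_whittaker_def by (blast intro: cg_sym)
      finally have "E i * x \<beta> \<approx> E i * ?a \<beta>" unfolding g(2) .
      then show ?thesis by (simp add: cg_def right_diff_distrib)
    qed
    from no_singular[OF step.hyps False wv this] show ?thesis by (simp add: cg_def)
  qed
qed

lemma pairing_ket_1: "pairing r h lam (bra r h lam 1) (ket r h lam a) = 1 \<longleftrightarrow> 1 - a \<in> vac"
  if a: "wv 0 a"
proof -
  obtain c where "a \<approx> scal c" using wv_0_scal[OF a] by blast
  then have c: "a - scal c \<in> vac" by (simp add: cg_def vac_ket)
  then have p: "pairing r h lam (bra r h lam 1) (ket r h lam a) = c" using pairing_eq[of 1 a c] by simp
  show ?thesis
  proof
    assume "pairing r h lam (bra r h lam 1) (ket r h lam a) = 1"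
    then show "1 - a \<in> vac" using p vac_scal[OF c, of "- 1"] by (simp add: scal_minus)
  next
    assume "1 - a \<in> vac"
    then have "1 - scal c \<in> vac" using vac_add[OF _ c, of "1 - a"] by simp
    then have "vev r h lam 1 = c" by (rule vev_eq)
    moreover have "vev r h lam 1 = 1" by (rule vev_eq) (simp add: vac_ket ID)
    ultimately show "pairing r h lam (bra r h lam 1) (ket r h lam a) = 1" using p by simp
  qed
qed

lemma whittaker_ket_eq:
  assumes b: "\<beta> \<in> Qplus r"
  shows "whittaker_ket r h lam \<mu> \<beta> = ket r h lam (wvec r h lam \<mu> \<beta>)"
proof -
  let ?P = "\<lambda>w. w \<in> (\<Pi>\<^sub>E \<beta>\<in>Qplus r. ket_space r h lam \<beta>) \<and>
             pairing r h lam (bra r h lam 1) (w 0) = 1 \<and>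
             (\<forall>i\<in>{1..r}. \<forall>\<beta>\<in>Qplus r.
                lact r h lam (E i) (w (\<beta> + alpha i)) =
                lact r h lam (scal (\<mu> i) * K i ^ (i - 1)) (w \<beta>))"
  \<comment> \<open>Stated for arbitrary representatives of the right weights, this yields existence
    from \<open>wvec\<close> and reduces uniqueness to \<open>is_whittaker_unique\<close>.\<close>
  have iff: "?P (\<lambda>\<beta>\<in>Qplus r. ket r h lam (x \<beta>)) \<longleftrightarrow> is_whittaker \<mu> x"
    if x: "\<forall>\<beta>\<in>Qplus r. wv (wt \<beta>) (x \<beta>)" for x
  proof -
    have "wv 0 (x 0)" using x Qplus_0 wt_0 by metis
    then show ?thesis
      using x by (auto simp: is_whittaker_def Qplus_0 Qplus_add_alpha lact_ket ket_eq ket_in_space pairing_ket_1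
        simp del: atLeastAtMost_iff)
  qed
  have "(THE w. ?P w) = (\<lambda>\<beta>\<in>Qplus r. ket r h lam (wvec r h lam \<mu> \<beta>))"
  proof (rule the_equality)
    show "?P (\<lambda>\<beta>\<in>Qplus r. ket r h lam (wvec r h lam \<mu> \<beta>))"
      using iff[of "wvec r h lam \<mu>"] is_whittaker_wvec wvec_wv by blast
  next
    fix w assume w: "?P w"
    then have "\<forall>\<beta>\<in>Qplus r. \<exists>a. w \<beta> = ket r h lam a \<and> wv (wt \<beta>) a"
      by (auto simp: PiE_iff ket_space_iff)
    then obtain x where x: "\<forall>\<beta>\<in>Qplus r. w \<beta> = ket r h lam (x \<beta>)" "\<forall>\<beta>\<in>Qplus r. wv (wt \<beta>) (x \<beta>)"
      by metis
    have wx: "w = (\<lambda>\<beta>\<in>Qplus r. ket r h lam (x \<beta>))"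
      by (rule PiE_ext[of w "Qplus r" "ket_space r h lam"]) (use w x in \<open>auto simp: ket_in_space\<close>)
    have "is_whittaker \<mu> x" using w iff[OF x(2)] unfolding wx by blast
    then show "w = (\<lambda>\<beta>\<in>Qplus r. ket r h lam (wvec r h lam \<mu> \<beta>))"
      unfolding wx by (auto simp: restrict_def fun_eq_iff ket_eq is_whittaker_unique)
  qed
  then show ?thesis unfolding whittaker_ket_def using b by simp
qed

end

text \<open>A singular vector at 1/q is sent by \<open>theta\<close> to one at q: E_i is fixed, and
  inverting both K_i and q preserves the weight. Nonvanishing of v at 1/q is not obtained this way
  and is assumed.\<close>

lemma whittaker_verma_uminus:
  assumes "whittaker_verma r h lam"
    and v: "\<And>\<beta>. \<beta> \<in> Qplus r \<Longrightarrow> \<beta> \<noteq> 0 \<Longrightarrow> vq r (- h) lam \<beta> \<noteq> 0"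
  shows "whittaker_verma r (- h) lam"
proof -
  interpret p: whittaker_verma r h lam by fact
  interpret m: generic_verma r "- h" lam by (rule generic_verma_uminus) unfold_locales
  show ?thesis
  proof
    fix \<beta> a assume b: "\<beta> \<in> Qplus r" "\<beta> \<noteq> 0" and wv: "m.wv (wt \<beta>) a"
      and sing: "\<And>i. i \<in> {1..r} \<Longrightarrow> E i * a \<in> ket_ideal r (- h) lam"
    have I: "theta x \<in> p.I" if "x \<in> ket_ideal r (- h) lam" for x
      using theta_ket_ideal[OF that] by simp
    have "p.wv (wt \<beta>) (theta a)"
      unfolding p.wv_def
    proof
      fix i assume i: "i \<in> {1..r}"
      have e: "p.ev (wt \<beta>) i * m.ev (wt \<beta>) i = 1"
        by (simp add: p.ev_def m.ev_def qpow_uminus flip: qpow_add)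
      have K: "Kinv i * theta a - scal (m.ev (wt \<beta>) i) * theta a \<in> p.I"
        using I[OF m.wvD[OF wv i, unfolded m.cg_def]] by (simp add: theta_simps)
      then have "p.cg (scal (p.ev (wt \<beta>) i) * (K i * (Kinv i * theta a)))
          (scal (p.ev (wt \<beta>) i) * (K i * (scal (m.ev (wt \<beta>) i) * theta a)))"
        by (intro p.cg_mult) (simp add: p.cg_def)
      also have "scal (p.ev (wt \<beta>) i) * (K i * (scal (m.ev (wt \<beta>) i) * theta a)) = K i * theta a"
        by (simp add: scal_gen_comm scal_scal e)
      finally have 1: "p.cg (scal (p.ev (wt \<beta>) i) * (K i * (Kinv i * theta a))) (K i * theta a)" .
      have "p.cg (K i * (Kinv i * theta a)) (theta a)"
        using p.uq_cg[OF uq_rels(1)[OF i i], of "theta a"] by (simp add: mult.assoc)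
      from p.cg_trans[OF p.cg_sym[OF 1] p.cg_mult[OF this]]
      show "p.cg (K i * theta a) (scal (p.ev (wt \<beta>) i) * theta a)" .
    qed
    moreover have "E i * theta a \<in> p.I" if "i \<in> {1..r}" for i
      using I[OF sing[OF that]] by (simp add: theta_simps)
    ultimately have "theta a \<in> p.I" using p.no_singular[OF b] by blast
    then show "a \<in> ket_ideal r (- h) lam" using theta_ket_ideal[of "theta a" r h lam] by simp
  qed (fact v)
qed

lemma (in verma_rep) wsum_mono: "B \<subseteq> B' \<Longrightarrow> wsum B \<subseteq> wsum B'"
  unfolding wsum_def by blast

text \<open>A singular vector of weight lambda - beta with beta nonzero generates a submodule with
  weights in lambda - beta - Q_+. It misses the highest weight vector, so irreducibility makes it
  zero.\<close>

lemma generic_whittaker_verma: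
  assumes "generic r h lam"
  shows "whittaker_verma r h lam"
proof -
  interpret verma_rep r h lam .
  have irr: "verma_irreducible r h lam" using assms by (simp add: generic_def)
  have ketI: "ket r h lam a = I \<longleftrightarrow> a \<in> I" for a
    using ket_eq[of a 0] by (simp add: cg_0) (simp add: ket_def)
  interpret generic_verma r h lam
  proof
    show "exp h ^ n \<noteq> 1" if "n \<ge> 1" for n using assms that by (simp add: generic_def)
    show "1 \<notin> I"
    proof
      assume "1 \<in> I"
      then have "a \<in> I" for a using ID(3)[of 1 a] by simp
      then have "ket r h lam = (\<lambda>a. I)" using ketI by blast
      then have "verma r h lam = {I}" by (simp add: verma_def)
      then show False using irr by (simp add: verma_irreducible_def)
    qed
  qed
  show ?thesis
  proof
    show "vq r h lam \<beta> \<noteq> 0" if "\<beta> \<in> Qplus r" "\<beta> \<noteq> 0" for \<beta>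
      using assms that by (simp add: generic_def)
  next
    fix \<beta> a assume b: "\<beta> \<in> Qplus r" "\<beta> \<noteq> 0" and wv: "wv (wt \<beta>) a"
      and sing: "\<And>i. i \<in> {1..r} \<Longrightarrow> E i * a \<in> I"
    have "x \<in> I + I \<longleftrightarrow> x \<in> I" for x
    proof
      show "x \<in> I + I \<Longrightarrow> x \<in> I" by (elim set_plus_elim) (simp only: ID(2))
      show "x \<in> I \<Longrightarrow> x \<in> I + I" using set_plus_intro[OF ID(1), of x I] by simp
    qed
    then have II: "I + I = I" by (rule set_eqI)
    let ?N = "range (\<lambda>u. ket r h lam (u * a))"
    have "verma_submodule r h lam ?N"
      unfolding verma_submodule_def
    proof (intro conjI ballI allI)
      show "?N \<subseteq> verma r h lam" by (auto simp: verma_def)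
      show "I \<in> ?N" by (rule range_eqI[of _ _ 0], rule sym) (simp add: ketI ID)
    next
      fix X Y assume "X \<in> ?N" "Y \<in> ?N"
      then obtain u v where "X = ket r h lam (u * a)" "Y = ket r h lam (v * a)" by blast
      then have "X + Y = ket r h lam ((u + v) * a)" by (simp only: ket_def distrib_right set_plus_rearrange II)
      then show "X + Y \<in> ?N" by blast
    next
      fix u X assume "X \<in> ?N"
      then obtain v where "X = ket r h lam (v * a)" by blast
      then have "lact r h lam u X = ket r h lam (u * v * a)" by (simp add: lact_ket mult.assoc)
      then show "lact r h lam u X \<in> ?N" by blast
    qed
    then consider "?N = {I}" | "?N = verma r h lam" using irr unfolding verma_irreducible_def by blast
    then show "a \<in> I"
    proof cases
      case 1
      have "ket r h lam (1 * a) \<in> ?N" by blast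
      then show ?thesis unfolding 1 using ketI by simp
    next
      case 2
      then have "ket r h lam 1 \<in> ?N" by (auto simp: verma_def)
      then obtain u where u: "ket r h lam 1 = ket r h lam (u * a)" by blast
      have "1 \<in> wsum {wt \<beta> + wt \<gamma> |\<gamma>. \<gamma> \<in> Qplus r}"
        using wsum_cong[OF _ singular_wsum[OF sing wv]] u by (simp only: ket_eq)
      moreover have "{wt \<beta> + wt \<gamma> |\<gamma>. \<gamma> \<in> Qplus r} \<subseteq> wt ` (Qplus r - {0})"
      proof
        fix x assume "x \<in> {wt \<beta> + wt \<gamma> |\<gamma>. \<gamma> \<in> Qplus r}"
        then obtain \<gamma> where g: "x = wt (\<beta> + \<gamma>)" "\<gamma> \<in> Qplus r" by (auto simp: wt_add)
        have "\<beta> + \<gamma> \<noteq> 0"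
        proof
          assume "\<beta> + \<gamma> = 0"
          then have "\<beta> k + \<gamma> k = 0" for k by (metis plus_fun_apply zero_fun_apply)
          then have "\<beta> = 0" by (intro ext) simp
          then show False using b(2) by simp
        qed
        moreover have "\<beta> + \<gamma> \<in> Qplus r" using b(1) g(2) by (simp add: Qplus_def)
        ultimately show "x \<in> wt ` (Qplus r - {0})" using g(1) by blast
      qed
      ultimately show ?thesis using one_not_wsum wsum_mono by blast
    qed
  qed
qed


section \<open>The dual Whittaker vector at 1/q\<close>

lemma psi_bra_ideal: "psi x \<in> ket_ideal r (- h) lam \<longleftrightarrow> x \<in> bra_ideal r h lam"
  using psi_ket_ideal[of "psi x" r "- h" lam] by simp

lemma bra_eq: "bra r h lam a = bra r h lam b \<longleftrightarrow> a - b \<in> bra_ideal r h lam"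
proof -
  note B = right_idealD[OF bra_ideal_right[of r h lam]]
  show ?thesis
  proof
    assume "bra r h lam a = bra r h lam b"
    then have "a \<in> b +o bra_ideal r h lam" using B(1) by (auto simp: bra_def elt_set_plus_def)
    then show "a - b \<in> bra_ideal r h lam" by (simp add: set_minus_plus)
  next
    assume ab: "a - b \<in> bra_ideal r h lam"
    have "x - a \<in> bra_ideal r h lam \<longleftrightarrow> x - b \<in> bra_ideal r h lam" for x
      using B(2)[OF _ ab, of "x - a"] B(5)[OF _ ab, of "x - b"] by auto
    then show "bra r h lam a = bra r h lam b" by (auto simp: bra_def set_minus_plus[symmetric])
  qed
qed

lemma ract_bra: "ract r h lam (bra r h lam a) u = bra r h lam (a * u)"
proof (rule set_eqI)
  note B = right_idealD[OF bra_ideal_right[of r h lam]]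
  fix x
  have "x \<in> ract r h lam (bra r h lam a) u \<longleftrightarrow>
      (\<exists>k\<in>bra_ideal r h lam. \<exists>k'\<in>bra_ideal r h lam. x = (a + k) * u + k')"
    by (auto simp: ract_def bra_def elt_set_plus_def set_plus_def)
  also have "\<dots> \<longleftrightarrow> x - a * u \<in> bra_ideal r h lam"
  proof
    assume "\<exists>k\<in>bra_ideal r h lam. \<exists>k'\<in>bra_ideal r h lam. x = (a + k) * u + k'"
    then obtain k k' where "k \<in> bra_ideal r h lam" "k' \<in> bra_ideal r h lam" "x - a * u = k * u + k'"
      by (auto simp: distrib_right)
    then show "x - a * u \<in> bra_ideal r h lam" using B(2,3) by simp
  next
    assume "x - a * u \<in> bra_ideal r h lam"
    then show "\<exists>k\<in>bra_ideal r h lam. \<exists>k'\<in>bra_ideal r h lam. x = (a + k) * u + k'"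
      by (intro bexI[of _ 0] bexI[of _ "x - a * u"]) (simp_all add: B)
  qed
  finally show "x \<in> ract r h lam (bra r h lam a) u \<longleftrightarrow> x \<in> bra r h lam (a * u)"
    by (simp add: bra_def set_minus_plus)
qed

context whittaker_verma
begin

lemma generic_verma_inverse_q: "generic_verma r (- h) lam"
  by (rule generic_verma_uminus) unfold_locales

lemma bra_psi_eq: "bra r (- h) lam (psi a) = bra r (- h) lam (psi b) \<longleftrightarrow> a \<approx> b"
  unfolding bra_eq psi_simps(3)[symmetric] psi_ket_ideal cg_def ..

text \<open>\<open>psi\<close> turns the action of K_i on bras into that of its inverse on kets, so
  weight vectors must be recognisable from the inverses alone.\<close>

lemma wv_Kinv_iff: "wv \<delta> a \<longleftrightarrow> (\<forall>i\<in>{1..r}. Kinv i * a \<approx> scal (1 / ev \<delta> i) * a)"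
proof
  assume K: "\<forall>i\<in>{1..r}. Kinv i * a \<approx> scal (1 / ev \<delta> i) * a"
  show "wv \<delta> a"
    unfolding wv_def
  proof
    fix i assume i: "i \<in> {1..r}"
    have e: "ev \<delta> i \<noteq> 0" by (simp add: ev_def)
    have "a \<approx> K i * (Kinv i * a)"
      using uq_cg[OF uq_rels(1)[OF i i], of a] by (simp add: mult.assoc cg_sym)
    also have "\<dots> \<approx> K i * (scal (1 / ev \<delta> i) * a)" using K i by (intro cg_mult) blast
    finally have "scal (ev \<delta> i) * a \<approx> scal (ev \<delta> i) * (K i * (scal (1 / ev \<delta> i) * a))" by (rule cg_mult)
    also have "\<dots> = K i * a" using e by (simp add: scal_gen_comm scal_scal)
    finally show "K i * a \<approx> scal (ev \<delta> i) * a" by (rule cg_sym)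
  qed
qed (simp add: wv_Kinv)

lemma bra_space_psi: "bra r (- h) lam (psi a) \<in> bra_space r (- h) lam \<beta> \<longleftrightarrow> wv (wt \<beta>) a"
proof -
  have e: "scal (qpow (- h) (form r (lam - wt \<beta>) (alpha i))) = psi (scal (1 / ev (wt \<beta>) i))" for i
    by (simp add: psi_simps ev_def qpow_def exp_minus inverse_eq_divide)
  have "(\<forall>i\<in>{1..r}. ract r (- h) lam (bra r (- h) lam (psi a)) (K i) = ract r (- h) lam (bra r (- h) lam (psi a))
      (scal (qpow (- h) (form r (lam - wt \<beta>) (alpha i))))) \<longleftrightarrow> wv (wt \<beta>) a"
    unfolding wv_Kinv_iff ract_bra e psi_simps(10)[symmetric] psi_mult[symmetric] bra_psi_eq ..
  then show ?thesis unfolding bra_space_def dual_verma_def by blast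
qed

lemma psi_vac: "psi x \<in> bra_ideal r (- h) lam + ket_ideal r (- h) lam \<longleftrightarrow> x \<in> vac"
proof
  assume "psi x \<in> bra_ideal r (- h) lam + ket_ideal r (- h) lam"
  then obtain b k where bk: "b \<in> bra_ideal r (- h) lam" "k \<in> ket_ideal r (- h) lam" "psi x = b + k"
    by (auto simp: set_plus_def)
  then have "x = psi k + psi b" by (metis psi_psi psi_simps(1) add.commute)
  moreover have "psi b \<in> I" "psi k \<in> bra_ideal r h lam"
    using psi_ket_ideal[of "psi b" r h lam] psi_bra_ideal[of "psi k" r h lam] bk by simp_all
  ultimately show "x \<in> vac" unfolding vac_iff by blast
next
  assume "x \<in> vac"
  then obtain b k where "b \<in> bra_ideal r h lam" "k \<in> I" "x = b + k" unfolding vac_iff by blast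
  then have "psi x = psi k + psi b" "psi k \<in> bra_ideal r (- h) lam" "psi b \<in> ket_ideal r (- h) lam"
    by (simp_all add: psi_simps psi_ket_ideal psi_bra_ideal)
  then show "psi x \<in> bra_ideal r (- h) lam + ket_ideal r (- h) lam" by (metis set_plus_intro)
qed

lemma pairing_bra_1: "pairing r (- h) lam (bra r (- h) lam (psi a)) (ket r (- h) lam 1) = 1 \<longleftrightarrow> 1 - a \<in> vac"
  if a: "wv 0 a"
proof -
  interpret m: generic_verma r "- h" lam by (rule generic_verma_inverse_q)
  obtain c where c: "a \<approx> scal c" using wv_0_scal[OF a] by blast
  then have "a - scal c \<in> vac" by (simp add: cg_def vac_ket)
  then have "psi a * 1 - scal c \<in> m.vac" using psi_vac[of "a - scal c"] by (simp add: psi_simps m.vac_def)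
  then have p: "pairing r (- h) lam (bra r (- h) lam (psi a)) (ket r (- h) lam 1) = c" by (rule m.pairing_eq)
  have "pairing r h lam (bra r h lam 1) (ket r h lam a) = c"
    using c by (intro pairing_eq) (simp add: cg_def vac_ket)
  then show ?thesis using p pairing_ket_1[OF a] by simp
qed

text \<open>Under \<open>psi\<close> the conditions on the bra at 1/q are those of
  \<open>is_whittaker\<close> at q, with the exponent -(i - 1) turned into i - 1; existence and
  uniqueness are inherited.\<close>

lemma whittaker_bra_eq:
  assumes b: "\<beta> \<in> Qplus r"
  shows "whittaker_bra r (- h) lam \<mu> \<beta> = bra r (- h) lam (psi (wvec r h lam \<mu> \<beta>))"
proof -
  let ?bra = "\<lambda>a. bra r (- h) lam (psi a)"
  let ?P = "\<lambda>w. w \<in> (\<Pi>\<^sub>E \<beta>\<in>Qplus r. bra_space r (- h) lam \<beta>) \<and>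
             pairing r (- h) lam (w 0) (ket r (- h) lam 1) = 1 \<and>
             (\<forall>i\<in>{1..r}. \<forall>\<beta>\<in>Qplus r.
                ract r (- h) lam (w (\<beta> + alpha i)) (F i) =
                ract r (- h) lam (w \<beta>) (scal (\<mu> i) * Kinv i ^ (i - 1)))"
  have 1: "ract r (- h) lam (?bra x) (F i) = ?bra (E i * x)" for x i
    by (simp add: ract_bra psi_mult psi_simps)
  have 2: "ract r (- h) lam (?bra x) (scal (\<mu> i) * Kinv i ^ (i - 1)) = ?bra (scal (\<mu> i) * K i ^ (i - 1) * x)" for x i
    by (simp add: ract_bra psi_mult psi_simps psi_power scal_comm[of "Kinv i ^ _"])
  have iff: "?P (\<lambda>\<beta>\<in>Qplus r. ?bra (x \<beta>)) \<longleftrightarrow> is_whittaker \<mu> x"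
    if x: "\<forall>\<beta>\<in>Qplus r. wv (wt \<beta>) (x \<beta>)" for x
  proof -
    have "wv 0 (x 0)" using x Qplus_0 wt_0 by metis
    then show ?thesis
      using x by (auto simp: is_whittaker_def Qplus_0 Qplus_add_alpha 1 2[simplified] bra_psi_eq bra_space_psi pairing_bra_1
        simp del: atLeastAtMost_iff)
  qed
  have "(THE w. ?P w) = (\<lambda>\<beta>\<in>Qplus r. ?bra (wvec r h lam \<mu> \<beta>))"
  proof (rule the_equality)
    show "?P (\<lambda>\<beta>\<in>Qplus r. ?bra (wvec r h lam \<mu> \<beta>))"
      using iff[of "wvec r h lam \<mu>"] is_whittaker_wvec wvec_wv by blast
  next
    fix w assume w: "?P w"
    have "\<exists>a. w \<beta> = ?bra a \<and> wv (wt \<beta>) a" if "\<beta> \<in> Qplus r" for \<beta>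
    proof -
      have wb: "w \<beta> \<in> bra_space r (- h) lam \<beta>" using w that by (auto simp: PiE_iff)
      then obtain y where "w \<beta> = bra r (- h) lam y" unfolding bra_space_def dual_verma_def by blast
      then have "w \<beta> = ?bra (psi y)" by simp
      then show ?thesis using wb bra_space_psi by metis
    qed
    then obtain x where x: "\<forall>\<beta>\<in>Qplus r. w \<beta> = ?bra (x \<beta>)" "\<forall>\<beta>\<in>Qplus r. wv (wt \<beta>) (x \<beta>)"
      by metis
    have wx: "w = (\<lambda>\<beta>\<in>Qplus r. ?bra (x \<beta>))"
      by (rule PiE_ext[of w "Qplus r" "bra_space r (- h) lam"]) (use w x in \<open>auto simp: bra_space_psi\<close>)
    have "is_whittaker \<mu> x" using w iff[OF x(2)] unfolding wx by blast
    then show "w = (\<lambda>\<beta>\<in>Qplus r. ?bra (wvec r h lam \<mu> \<beta>))"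
      unfolding wx by (auto simp: restrict_def fun_eq_iff bra_psi_eq is_whittaker_unique)
  qed
  then show ?thesis unfolding whittaker_bra_def using b by simp
qed

lemma vac_sum: "(\<And>k. k \<in> S \<Longrightarrow> f k \<in> vac) \<Longrightarrow> sum f S \<in> vac"
  by (induction S rule: infinite_finite_induct) (simp_all add: vac_add vac_ket ID)

end

section \<open>The pairing of the two Whittaker vectors\<close>

definition monom :: "nat \<Rightarrow> (nat \<Rightarrow> complex) \<Rightarrow> qroot \<Rightarrow> complex" where
  "monom r x \<beta> = (\<Prod>i=1..r. x i ^ \<beta> i)"

lemma monom_diff_alpha:
  assumes "i \<in> {1..r}" "\<beta> i \<noteq> 0"
  shows "monom r x \<beta> = x i * monom r x (\<beta> - alpha i)"
proof -
  have "monom r x \<beta> = (\<Prod>k=1..r. (if k = i then x i else 1) * x k ^ (\<beta> - alpha i) k)"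
    unfolding monom_def using assms(2)
    by (intro prod.cong refl) (auto simp: alpha_def simp flip: power_Suc)
  then show ?thesis using assms(1) by (simp add: prod.distrib monom_def)
qed

text \<open>The norm of the Whittaker vector obeys the path recursion: moving one \<open>F i\<close> from the ket to
  the bra, the characters \<open>chi\<close> at \<open>q\<close> and $q^{-1}$ cancel up to $\mu_i\mu'_i$.\<close>

lemma pairing_wvec:
  assumes "whittaker_verma r h lam" "whittaker_verma r (- h) lam" and b: "\<beta> \<in> Qplus r"
  shows "pairing r (- h) lam (whittaker_bra r (- h) lam \<mu>' \<beta>) (whittaker_ket r (- h) lam \<mu> \<beta>)
    = monom r (\<lambda>i. \<mu> i * \<mu>' i) \<beta> * Zpath r (- h) lam \<beta>"
proof -
  interpret p: whittaker_verma r h lam by fact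
  interpret m: whittaker_verma r "- h" lam by fact
  let ?M = "monom r (\<lambda>i. \<mu> i * \<mu>' i)" and ?Z = "Zpath r (- h) lam" and ?v = "vq r (- h) lam"
  let ?b = "\<lambda>\<beta>. psi (wvec r h lam \<mu>' \<beta>)" and ?a = "wvec r (- h) lam \<mu>"
  \<comment> \<open>The induction runs on products modulo \<open>vac\<close>, where linearity is at
    hand; \<open>pairing\<close> itself is evaluated only once, at the end.\<close>
  have "?b \<beta> * ?a \<beta> - scal (?M \<beta> * ?Z \<beta>) \<in> m.vac"
    using b
  proof (induction rule: Qplus_induct)
    case (step \<beta>)
    show ?case
    proof (cases "\<beta> = 0")
      case True
      have M0: "?M 0 = 1" by (simp add: monom_def)
      show ?thesis unfolding True wvec_0 Zpath_0 M0 by (simp add: psi_simps m.vac_ket m.ID)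
    next
      case False
      define c where "c i = qpow (- h) (- tau r lam i \<beta>) * chi r (- h) lam \<mu> i \<beta>" for i
      have V: "scal (?v \<beta>) * ?a \<beta> = (\<Sum>i\<in>{1..r}. scal (c i) * (F i * lower i ?a \<beta>))"
        unfolding c_def by (rule vq_wvec) (rule m.vq_neq_0[OF step.hyps])
      have summand: "?b \<beta> * (scal (c i) * (F i * lower i ?a \<beta>))
          - scal (?M \<beta> * (qpow (- h) (- tau r lam i \<beta>) * lower i ?Z \<beta>)) \<in> m.vac" if i: "i \<in> {1..r}" for i
      proof (cases "\<beta> i = 0")
        case True
        then show ?thesis by (simp add: lower_def m.vac_ket m.ID)
      next
        case bi: False
        let ?g = "\<beta> - alpha i"
        have "E i * wvec r h lam \<mu>' \<beta> - scal (chi r h lam \<mu>' i \<beta>) * wvec r h lam \<mu>' ?g \<in> p.I"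
          using p.wvec_E[OF step.hyps i, of \<mu>'] bi unfolding p.cg_def by (simp only: lower_def if_False)
        then have "psi (E i * wvec r h lam \<mu>' \<beta> - scal (chi r h lam \<mu>' i \<beta>) * wvec r h lam \<mu>' ?g)
            \<in> bra_ideal r (- h) lam"
          by (simp only: psi_ket_ideal)
        \<comment> \<open>The equation for E_i on the ket at q, read through \<open>psi\<close>:
          right multiplication by F_i removes alpha_i from the bra at 1/q.\<close>
        then have "?b \<beta> * F i - scal (chi r h lam \<mu>' i \<beta>) * ?b ?g \<in> bra_ideal r (- h) lam"
          by (simp only: psi_simps psi_mult scal_comm[of "?b ?g"])
        from m.vac_scal[OF m.vac_bra[OF m.BD(3)[OF this, of "?a ?g"]], of "c i"]
        have "scal (c i) * (?b \<beta> * (F i * ?a ?g)) - scal (c i * chi r h lam \<mu>' i \<beta>) * (?b ?g * ?a ?g) \<in> m.vac"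
          by (simp only: left_diff_distrib right_diff_distrib mult.assoc scal_scal)
        moreover have "scal (c i * chi r h lam \<mu>' i \<beta>) * (?b ?g * ?a ?g - scal (?M ?g * ?Z ?g)) \<in> m.vac"
          by (rule m.vac_scal[OF step.IH[OF i bi]])
        ultimately have "scal (c i) * (?b \<beta> * (F i * ?a ?g)) - scal (c i * chi r h lam \<mu>' i \<beta> * (?M ?g * ?Z ?g)) \<in> m.vac"
          using m.vac_add[of "scal (c i) * (?b \<beta> * (F i * ?a ?g)) - scal (c i * chi r h lam \<mu>' i \<beta>) * (?b ?g * ?a ?g)"
              "scal (c i * chi r h lam \<mu>' i \<beta>) * (?b ?g * ?a ?g - scal (?M ?g * ?Z ?g))"]
          by (simp only: right_diff_distrib scal_mult[symmetric] diff_add_cancel add_diff_eq)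
        moreover have "c i * chi r h lam \<mu>' i \<beta> * (?M ?g * ?Z ?g)
            = ?M \<beta> * (qpow (- h) (- tau r lam i \<beta>) * lower i ?Z \<beta>)"
        proof -
          have "chi r (- h) lam \<mu> i \<beta> * chi r h lam \<mu>' i \<beta> = \<mu> i * \<mu>' i"
            by (simp add: chi_def qpow_uminus mult_ac flip: qpow_add)
          then have "c i * chi r h lam \<mu>' i \<beta> = qpow (- h) (- tau r lam i \<beta>) * (\<mu> i * \<mu>' i)"
            unfolding c_def by (simp only: mult.assoc)
          moreover have "lower i ?Z \<beta> = ?Z ?g" using bi by (simp add: lower_def)
          ultimately show ?thesis using monom_diff_alpha[of i r \<beta> "\<lambda>i. \<mu> i * \<mu>' i"] i bi
            by (simp only: mult_ac not_False_eq_True)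
        qed
        moreover have "lower i ?a \<beta> = ?a ?g" using bi by (simp add: lower_def)
        ultimately show ?thesis by (simp only: scal_left_comm[of "?b \<beta>"])
      qed
      have "scal (?v \<beta>) * (?b \<beta> * ?a \<beta>) - scal (?M \<beta> * (?v \<beta> * ?Z \<beta>)) =
        (\<Sum>i\<in>{1..r}. ?b \<beta> * (scal (c i) * (F i * lower i ?a \<beta>))
          - scal (?M \<beta> * (qpow (- h) (- tau r lam i \<beta>) * lower i ?Z \<beta>)))"
      proof -
        have scal_sum: "scal (sum f S) = (\<Sum>i\<in>S. scal (f i))" for f :: "nat \<Rightarrow> complex" and S
          by (induction S rule: infinite_finite_induct) (simp_all add: scal_add)
        have "scal (?v \<beta>) * (?b \<beta> * ?a \<beta>) = ?b \<beta> * (scal (?v \<beta>) * ?a \<beta>)" by (simp only: scal_left_comm)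
        moreover have "?v \<beta> * ?Z \<beta> = (\<Sum>i\<in>{1..r}. qpow (- h) (- tau r lam i \<beta>) * lower i ?Z \<beta>)"
          by (rule vq_Zpath[OF step.hyps]) (rule m.vq_neq_0[OF step.hyps])
        ultimately show ?thesis
          unfolding V
          by (simp only: sum_subtractf sum_distrib_left scal_sum)
      qed
      also have "\<dots> \<in> m.vac" by (rule m.vac_sum[OF summand])
      finally have "scal (1 / ?v \<beta>) * (scal (?v \<beta>) * (?b \<beta> * ?a \<beta>) - scal (?M \<beta> * (?v \<beta> * ?Z \<beta>))) \<in> m.vac"
        by (rule m.vac_scal)
      then show ?thesis
        using m.vq_neq_0[OF step.hyps False] by (simp add: right_diff_distrib scal_scal mult_ac flip: scal_mult)
    qed
  qed
  from m.pairing_eq[OF this] show ?thesis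
    by (simp only: p.whittaker_bra_eq[OF b] m.whittaker_ket_eq[OF b])
qed

section \<open>The Toda equation\<close>

lemma inv_shiftS: "inv (shiftS r i) = (\<lambda>f \<phi>. f (\<phi> + omega r i))"
  by (rule inv_equality) (simp_all add: shiftS_def)

lemma shiftT_apply: "shiftT r i f = (\<lambda>\<phi>. f (\<phi> - omega r (i + 1) + omega r i))"
  by (simp add: shiftT_def inv_shiftS shiftS_def)

text \<open>This is the meaning of v_q in the Toda equation: it measures how far the eigenvalue of
  the sum of the T_i^2 in degree beta falls short of the total eigenvalue.\<close>

lemma sum_T_squared:
  assumes d: "qdiff h \<noteq> 0"
  shows "(\<Sum>i=0..r. qpow h (2 * (cut r (lam + rho r - wt \<beta>) i - cut r (lam + rho r - wt \<beta>) (i + 1))))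
    = toda_eigenvalue r h lam - (qdiff h)\<^sup>2 * vq r h lam \<beta>"
proof -
  let ?y = "cut r (lam + rho r)" and ?b = "cut r (wt \<beta>)"
  have E: "toda_eigenvalue r h lam = (\<Sum>i=0..r. qpow h (2 * (?y i - ?y (i + 1))))"
    unfolding toda_eigenvalue_def by (intro sum.cong refl) (simp add: form_diff_right form_omega)
  have v: "(qdiff h)\<^sup>2 * vq r h lam \<beta> =
     (\<Sum>i=0..r. qpow h (2 * (?y i - ?y (i + 1))) * (1 - qpow h (2 * (?b (i + 1) - ?b i))))"
    using d by (simp add: vq_cut)
  show ?thesis
    unfolding E v sum_subtractf[symmetric]
    by (intro sum.cong refl) (simp add: right_diff_distrib cut_diff algebra_simps flip: qpow_add)
qed

text \<open>Each homogeneous term is an exponential in \<phi>, on which shifts act by scalars. In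
  degree beta the equation becomes (q - 1/q)^2 times the recursion \<open>vq_Zpath\<close>.\<close>

lemma toda_eq:
  assumes d: "qdiff h \<noteq> 0" and b: "\<beta> \<in> Qplus r"
    and v: "\<beta> \<noteq> 0 \<Longrightarrow> vq r h lam \<beta> \<noteq> 0"
    and f: "\<And>\<beta>. \<beta> \<in> Qplus r \<Longrightarrow> f \<beta> = (\<lambda>\<phi>. monom r (\<lambda>i. \<mu> i * \<mu>' i) \<beta> *
        qpow h (form r (lam + rho r - wt \<beta>) \<phi>) * Zpath r h lam \<beta>)"
  shows "toda r h \<mu> \<mu>' f \<beta> \<phi> = toda_eigenvalue r h lam * f \<beta> \<phi>"
proof -
  let ?M = "monom r (\<lambda>i. \<mu> i * \<mu>' i)" and ?Z = "Zpath r h lam" and ?x = "lam + rho r - wt \<beta>"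
  have T2: "(shiftT r i ^^ 2) (f \<beta>) \<phi> = qpow h (2 * (cut r ?x i - cut r ?x (i + 1))) * f \<beta> \<phi>"
    if "i \<in> {0..r}" for i
  proof -
    have "form r ?x (\<phi> - omega r (i + 1) + omega r i - omega r (i + 1) + omega r i)
      = 2 * (cut r ?x i - cut r ?x (i + 1)) + form r ?x \<phi>"
      using that by (simp only: form_diff_right form_add_right) (simp add: form_omega)
    then show ?thesis by (simp add: numeral_2_eq_2 shiftT_apply f[OF b] qpow_add mult_ac)
  qed
  have TT: "(if \<beta> i = 0 then 0 else \<mu> i * \<mu>' i * qpow h (- form r \<phi> (alpha i)) *
      (shiftT r (i - 1) \<circ> shiftT r i) (f (\<beta> - alpha i)) \<phi>)
    = ?M \<beta> * qpow h (form r ?x \<phi>) * (qpow h (- tau r lam i \<beta>) * lower i ?Z \<beta>)"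
    if i: "i \<in> {1..r}" for i
  proof (cases "\<beta> i = 0")
    case True
    then show ?thesis by (simp add: lower_def)
  next
    case False
    let ?g = "\<beta> - alpha i"
    have i': "i - 1 \<le> r + 1" "i \<le> r + 1" "i + 1 \<le> r + 1" using i by auto
    have "form r (lam + rho r - wt ?g) (\<phi> - omega r i + omega r (i - 1) - omega r (i + 1) + omega r i)
      = form r ?x (\<phi> + omega r (i - 1) - omega r (i + 1)) + form r (alpha i) (\<phi> + omega r (i - 1) - omega r (i + 1))"
      using wt_diff_alpha[of \<beta> i] False
      by (simp only: form_diff_right form_add_right form_diff form_add not_False_eq_True) (simp add: algebra_simps)
    \<comment> \<open>T_{i-1} T_i shifts by omega_{i-1} - omega_{i+1}; this is the origin of
      tau_i.\<close>
    also have "form r ?x (\<phi> + omega r (i - 1) - omega r (i + 1)) = form r ?x \<phi> - tau r lam i \<beta>"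
      using i' i by (simp only: form_diff_right[of r ?x] form_add_right form_omega tau_cut) simp
    \<comment> \<open>The term of degree \<beta> - alpha_i carries an extra q^((alpha_i|phi)),
      untouched by the shift since alpha_i is orthogonal to the two neighbouring fundamental
      weights; it cancels the potential of the Toda operator.\<close>
    also have "form r (alpha i) (\<phi> + omega r (i - 1) - omega r (i + 1)) = form r \<phi> (alpha i)"
      using i' i by (simp only: form_diff_right form_add_right form_omega cut_alpha form_commute[of r "alpha i" \<phi>]) auto
    finally have F: "form r (lam + rho r - wt ?g) (\<phi> - omega r i + omega r (i - 1) - omega r (i + 1) + omega r i)
      = form r ?x \<phi> + - tau r lam i \<beta> + form r \<phi> (alpha i)" by (simp only: add_uminus_conv_diff)
    have "(shiftT r (i - 1) \<circ> shiftT r i) (f ?g) \<phi>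
        = f ?g (\<phi> - omega r i + omega r (i - 1) - omega r (i + 1) + omega r i)"
      using i by (simp add: shiftT_apply)
    also have "\<dots> = ?M ?g * (qpow h (form r ?x \<phi>) * qpow h (- tau r lam i \<beta>) * qpow h (form r \<phi> (alpha i))) * ?Z ?g"
      unfolding f[OF Qplus_diff_alpha[OF b]] F qpow_add ..
    finally have S: "(shiftT r (i - 1) \<circ> shiftT r i) (f ?g) \<phi> = \<dots>" .
    have Q: "qpow h (- form r \<phi> (alpha i)) * qpow h (form r \<phi> (alpha i)) = 1" by (simp flip: qpow_add)
    have "\<mu> i * \<mu>' i * qpow h (- form r \<phi> (alpha i)) * (shiftT r (i - 1) \<circ> shiftT r i) (f ?g) \<phi>
      = (qpow h (- form r \<phi> (alpha i)) * qpow h (form r \<phi> (alpha i))) * (((\<mu> i * \<mu>' i) * ?M ?g) *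
         qpow h (form r ?x \<phi>) * (qpow h (- tau r lam i \<beta>) * ?Z ?g))"
      unfolding S by (simp only: mult_ac)
    also have "\<dots> = ?M \<beta> * qpow h (form r ?x \<phi>) * (qpow h (- tau r lam i \<beta>) * ?Z ?g)"
      unfolding Q using monom_diff_alpha[of i r \<beta> "\<lambda>i. \<mu> i * \<mu>' i"] i False by simp
    finally show ?thesis using False by (simp only: lower_def if_False)
  qed
  have vZ: "vq r h lam \<beta> * ?Z \<beta> = (\<Sum>i\<in>{1..r}. qpow h (- tau r lam i \<beta>) * lower i ?Z \<beta>)"
    by (rule vq_Zpath[OF b]) (rule v)
  have "toda r h \<mu> \<mu>' f \<beta> \<phi> = (\<Sum>i=0..r. qpow h (2 * (cut r ?x i - cut r ?x (i + 1))) * f \<beta> \<phi>)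
     + (qdiff h)\<^sup>2 * (\<Sum>i=1..r. ?M \<beta> * qpow h (form r ?x \<phi>) * (qpow h (- tau r lam i \<beta>) * lower i ?Z \<beta>))"
    unfolding toda_def
    by (intro arg_cong2[of _ _ _ _ "(+)"] arg_cong[of _ _ "(*) ((qdiff h)\<^sup>2)"] sum.cong refl T2 TT)
  also have "\<dots> = (toda_eigenvalue r h lam - (qdiff h)\<^sup>2 * vq r h lam \<beta>) * f \<beta> \<phi>
     + (qdiff h)\<^sup>2 * (?M \<beta> * qpow h (form r ?x \<phi>) * (vq r h lam \<beta> * ?Z \<beta>))"
    by (simp only: sum_distrib_right[symmetric] sum_distrib_left[symmetric] sum_T_squared[OF d] vZ)
  also have "\<dots> = toda_eigenvalue r h lam * f \<beta> \<phi>"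
    unfolding f[OF b] by (simp add: algebra_simps)
  finally show ?thesis .
qed

theorem theorem6p19:
  fixes r :: nat and q h :: complex and lam :: weight and \<mu> \<mu>' :: "nat \<Rightarrow> complex"
  assumes rank: "r \<ge> 1"
    and log_q: "q \<noteq> 0" "exp h = q"
    and gen: "generic r h lam"
    and nonzero: "\<forall>i\<in>{1..r}. \<mu> i \<noteq> 0 \<and> \<mu>' i \<noteq> 0"
  shows "(\<forall>\<beta>\<in>Qplus r. \<forall>\<phi>.
            mod_whittaker r h lam \<mu> \<mu>' \<beta> \<phi> =
              (\<Prod>i=1..r. (\<mu> i * \<mu>' i) ^ \<beta> i) *
              qpow h (form r (lam + rho r - wt \<beta>) \<phi>) * Zpath r h lam \<beta>)
       \<and> (\<forall>\<beta>\<in>Qplus r. \<forall>\<phi>.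
            toda r h \<mu> \<mu>' (mod_whittaker r h lam \<mu> \<mu>') \<beta> \<phi> =
              toda_eigenvalue r h lam * mod_whittaker r h lam \<mu> \<mu>' \<beta> \<phi>)"
proof -
  interpret p: whittaker_verma r h lam by (rule generic_whittaker_verma[OF gen])
  have v': "vq r (- h) lam \<beta> \<noteq> 0" if "\<beta> \<in> Qplus r" "\<beta> \<noteq> 0" for \<beta>
    using gen that by (simp add: generic_def)
  \<comment> \<open>Both parameters are involved: the ket of \<open>mod_whittaker\<close> lives at
    1/q, and its bra is the \<open>psi\<close> image of the ket at q.\<close>
  interpret m: whittaker_verma r "- h" lam
    by (rule whittaker_verma_uminus[OF p.whittaker_verma_axioms v'])
  have Z: "Zpath r (- h) lam \<beta> = Zpath r h lam \<beta>" if "\<beta> \<in> Qplus r" for \<beta>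
    by (rule Zpath_uminus[OF p.qdiff_neq_0 p.vq_neq_0 v' that])
  have W: "mod_whittaker r h lam \<mu> \<mu>' \<beta> \<phi> = monom r (\<lambda>i. \<mu> i * \<mu>' i) \<beta> *
      qpow h (form r (lam + rho r - wt \<beta>) \<phi>) * Zpath r h lam \<beta>" if b: "\<beta> \<in> Qplus r" for \<beta> \<phi>
  proof -
    \<comment> \<open>The prefactor with exponent the sum of the phi_i is q^((rho|phi)); it
      completes lambda to lambda + rho.\<close>
    have "form r (lam + rho r - wt \<beta>) \<phi> = (\<Sum>i\<in>{1..r}. \<phi> i) + form r (lam - wt \<beta>) \<phi>"
      by (simp only: form_diff form_add form_rho) simp
    then show ?thesis
      unfolding mod_whittaker_def whittaker_def
        pairing_wvec[OF p.whittaker_verma_axioms m.whittaker_verma_axioms b] Z[OF b]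
      by (simp add: qpow_uminus qpow_add mult_ac)
  qed
  moreover have "toda r h \<mu> \<mu>' (mod_whittaker r h lam \<mu> \<mu>') \<beta> \<phi> =
      toda_eigenvalue r h lam * mod_whittaker r h lam \<mu> \<mu>' \<beta> \<phi>" if b: "\<beta> \<in> Qplus r" for \<beta> \<phi>
    by (rule toda_eq[OF p.qdiff_neq_0 b p.vq_neq_0[OF b]]) (use W in \<open>auto simp: fun_eq_iff\<close>)
  ultimately show ?thesis by (auto simp: monom_def)
qed

end
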